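(* Let $G$ be a compact second countable group with Haar probability measure $m_G$, and let $\Gamma$ be a countable dense subgroup of $G$. Suppose that the left translation action $\Gamma\curvearrowright (G,m_G)$ has spectral gap. Assume that at least one of the following holds: (1) the left translation action $\Gamma\curvearrowright (G,m_G)$ is orbit equivalent to a profinite p.m.p. action $\Delta\curvearrowright (Y,\nu)$ of a countable group $\Delta$; or, more generally, (2) there exist a measurable set $D\subset G$ with $m_G(D)=1$, a modular action $\Delta\curvearrowright Y$ of a countable group $\Delta$, and a countable-to-one Borel homomorphism from $\mathcal R(\Gamma\curvearrowright G)_{|D}$ to $\mathcal R(\Delta\curvearrowright Y)$. Then $G$ is a profinite group.
   Context: A p.m.p. action $\Gamma\curvearrowright (X,\mu)$ is a Borel action of a countable group $\Gamma$ on a standard Borel space $X$ preserving the Borel probability measure $\mu$ (so $(X,\mu)$ is a standard probability space). For a Borel action $\Gamma\curvearrowright X$ of a countable group on a standard Borel space, $\mathcal R(\Gamma\curvearrowright X)=\{(x_1,x_2)\in X\times X : \Gamma\cdot x_1=\Gamma\cdot x_2\}$ is its orbit equivalence relation, and $\mathcal R_{|D}=\mathcal R\cap (D\times D)$ for $D\subset X$. A homomorphism from an equivalence relation $\mathcal R$ on $X$ to an equivalence relation $\mathcal S$ on $Y$ is a map $\alpha:X\to Y$ with $(\alpha\times\alpha)(\mathcal R)\subset\mathcal S$; it is countable-to-one if every point of $Y$ has countable preimage. Borel maps on $D$ are Borel with respect to the relative Borel structure of $D$. Two p.m.p. actions $\Gamma\curvearrowright (X,\mu)$ and $\Delta\curvearrowright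 (Y,\nu)$ are orbit equivalent if there exists an isomorphism of probability spaces $\alpha:X\to Y$ such that $(\alpha\times\alpha)(\mathcal R(\Gamma\curvearrowright X))=\mathcal R(\Delta\curvearrowright Y)$, almost everywhere (i.e., after discarding null sets). A p.m.p. action $\Gamma\curvearrowright (X,\mu)$ is profinite if there exists a sequence $\{\mathcal P_n\}$ of finite measurable partitions of $X$ which separates points in $X$, such that each $\mathcal P_n$ is $\Gamma$-invariant (i.e., its pieces are permuted by $\Gamma$); null sets are ignored. Profinite actions are not assumed to be free. A Borel action $\Delta\curvearrowright Y$ of a countable group on a standard Borel space is modular if there exists a sequence $\{\mathcal P_n\}$ of countable Borel partitions of $Y$ which separates points in $Y$, such that each $\mathcal P_n$ is $\Delta$-invariant (i.e., its pieces are permuted by $\Delta$). A p.m.p. action $\Gamma\curvearrowright (X,\mu)$ has spectral gap if the Koopman representation of $\Gamma$ on $L^2_0(X)=L^2(X)\ominus\mathbb C\mathbf 1_X$ does not admit almost invariant vectors, i.e., there is no sequence of unit vectors $\xi_n\in L^2_0(X)$ such that $\|g\cdot\xi_n-\xi_n\|_2\to 0$ for all $g\in\Gamma$. *)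

theory Defs
  imports
    "HOL-Probability.Probability_Measure"
    "HOL-Algebra.Group_Action"
    "HOL-Algebra.Product_Groups"
begin

definition topological_group :: "('a, 'b) monoid_scheme \<Rightarrow> 'a topology \<Rightarrow> bool" where
  "topological_group G T \<longleftrightarrow>
     group G \<and> topspace T = carrier G \<and>
     continuous_map (prod_topology T T) T (\<lambda>(x, y). x \<otimes>\<^bsub>G\<^esub> y) \<and>
     continuous_map T T (\<lambda>x. inv\<^bsub>G\<^esub> x)"

definition borel_of :: "'a topology \<Rightarrow> 'a measure" where
  "borel_of T = sigma (topspace T) {U. openin T U}"

definition haar_prob :: "('a, 'b) monoid_scheme \<Rightarrow> 'a topology \<Rightarrow> 'a measure \<Rightarrow> bool" where
  "haar_prob G T m \<longleftrightarrow>
     prob_space m \<and> space m = carrier G \<and> sets m = sets (borel_of T) \<and>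
     (\<forall>g\<in>carrier G. \<forall>A\<in>sets m. emeasure m (g <#\<^bsub>G\<^esub> A) = emeasure m A)"

text \<open>
  Inverse systems of finite groups over a directed partially ordered set \<open>(I, r)\<close>; the
  transition map \<open>f i j\<close> goes from \<open>H j\<close> to \<open>H i\<close> whenever \<open>(i, j) \<in> r\<close>, that is \<open>i \<le> j\<close>.
\<close>

definition finite_inverse_system ::
  "'i set \<Rightarrow> 'i rel \<Rightarrow> ('i \<Rightarrow> 'h monoid) \<Rightarrow> ('i \<Rightarrow> 'i \<Rightarrow> 'h \<Rightarrow> 'h) \<Rightarrow> bool" where
  "finite_inverse_system I r H f \<longleftrightarrow>
     I \<noteq> {} \<and> partial_order_on I r \<and>
     (\<forall>i\<in>I. \<forall>j\<in>I. \<exists>k\<in>I. (i, k) \<in> r \<and> (j, k) \<in> r) \<and>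
     (\<forall>i\<in>I. group (H i) \<and> finite (carrier (H i))) \<and>
     (\<forall>(i, j)\<in>r. f i j \<in> hom (H j) (H i)) \<and>
     (\<forall>i\<in>I. \<forall>x\<in>carrier (H i). f i i x = x) \<and>
     (\<forall>i j k. (i, j) \<in> r \<longrightarrow> (j, k) \<in> r \<longrightarrow>
        (\<forall>x\<in>carrier (H k). f i j (f j k x) = f i k x))"

definition inverse_limit ::
  "'i set \<Rightarrow> 'i rel \<Rightarrow> ('i \<Rightarrow> 'h monoid) \<Rightarrow> ('i \<Rightarrow> 'i \<Rightarrow> 'h \<Rightarrow> 'h) \<Rightarrow> ('i \<Rightarrow> 'h) monoid" where
  "inverse_limit I r H f = (product_group I H)
     \<lparr>carrier := {x \<in> carrier (product_group I H). \<forall>(i, j)\<in>r. f i j (x j) = x i}\<rparr>"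

definition inverse_limit_topology ::
  "'i set \<Rightarrow> 'i rel \<Rightarrow> ('i \<Rightarrow> 'h monoid) \<Rightarrow> ('i \<Rightarrow> 'i \<Rightarrow> 'h \<Rightarrow> 'h) \<Rightarrow> ('i \<Rightarrow> 'h) topology" where
  "inverse_limit_topology I r H f =
     subtopology (product_topology (\<lambda>i. discrete_topology (carrier (H i))) I)
       (carrier (inverse_limit I r H f))"

text \<open>
  A profinite group is a topological group isomorphic to an inverse limit of finite discrete
  groups. The types of the quantified inverse system lose no generality: a profinite group is the
  inverse limit of its quotients by open normal subgroups, so sets of group elements suffice as
  indices, and every finite group has an isomorphic copy carried by natural numbers.
\<close>

definition profinite_group :: "('a, 'b) monoid_scheme \<Rightarrow> 'a topology \<Rightarrow> bool" where
  "profinite_group G T \<longleftrightarrow>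
     topological_group G T \<and>
     (\<exists>(I :: 'a set set) r (H :: 'a set \<Rightarrow> nat monoid) f h.
        finite_inverse_system I r H f \<and>
        h \<in> iso G (inverse_limit I r H f) \<and>
        homeomorphic_map T (inverse_limit_topology I r H f) h)"

definition standard_borel :: "'x measure \<Rightarrow> bool" where
  "standard_borel M \<longleftrightarrow>
     (\<exists>T. topspace T = space M \<and> completely_metrizable_space T \<and> second_countable T \<and>
          sets M = sets (borel_of T))"

text \<open>Only the \<open>\<sigma>\<close>-algebra of \<open>M\<close> matters in the next definition, not its measure.\<close>

definition borel_action :: "('g, 'b) monoid_scheme \<Rightarrow> ('g \<Rightarrow> 'x \<Rightarrow> 'x) \<Rightarrow> 'x measure \<Rightarrow> bool" where
  "borel_action \<Gamma> \<phi> M \<longleftrightarrow>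
     standard_borel M \<and> countable (carrier \<Gamma>) \<and> group_action \<Gamma> (space M) \<phi> \<and>
     (\<forall>g\<in>carrier \<Gamma>. \<phi> g \<in> measurable M M)"

definition pmp_action :: "('g, 'b) monoid_scheme \<Rightarrow> ('g \<Rightarrow> 'x \<Rightarrow> 'x) \<Rightarrow> 'x measure \<Rightarrow> bool" where
  "pmp_action \<Gamma> \<phi> \<mu> \<longleftrightarrow>
     borel_action \<Gamma> \<phi> \<mu> \<and> prob_space \<mu> \<and> (\<forall>g\<in>carrier \<Gamma>. distr \<mu> \<mu> (\<phi> g) = \<mu>)"

text \<open>Actions by \<open>group_action\<close> consist of extensional functions, hence the restriction.\<close>

definition left_translation :: "('a, 'b) monoid_scheme \<Rightarrow> 'a \<Rightarrow> 'a \<Rightarrow> 'a" where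
  "left_translation G g = (\<lambda>x\<in>carrier G. g \<otimes>\<^bsub>G\<^esub> x)"

definition orbit_rel :: "('g, 'b) monoid_scheme \<Rightarrow> ('g \<Rightarrow> 'x \<Rightarrow> 'x) \<Rightarrow> 'x set \<Rightarrow> 'x rel" where
  "orbit_rel \<Gamma> \<phi> X = {(x, y). x \<in> X \<and> y \<in> X \<and> orbit \<Gamma> \<phi> x = orbit \<Gamma> \<phi> y}"

definition orbit_equivalent ::
  "('g, 'b) monoid_scheme \<Rightarrow> ('g \<Rightarrow> 'x \<Rightarrow> 'x) \<Rightarrow> 'x measure \<Rightarrow>
   ('h, 'c) monoid_scheme \<Rightarrow> ('h \<Rightarrow> 'y \<Rightarrow> 'y) \<Rightarrow> 'y measure \<Rightarrow> bool" where
  "orbit_equivalent \<Gamma> \<phi> \<mu> \<Delta> \<psi> \<nu> \<longleftrightarrow>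
     (\<exists>X\<^sub>0\<in>sets \<mu>. \<exists>Y\<^sub>0\<in>sets \<nu>. \<exists>\<alpha>.
        emeasure \<mu> X\<^sub>0 = 1 \<and> emeasure \<nu> Y\<^sub>0 = 1 \<and> bij_betw \<alpha> X\<^sub>0 Y\<^sub>0 \<and>
        \<alpha> \<in> measurable (restrict_space \<mu> X\<^sub>0) (restrict_space \<nu> Y\<^sub>0) \<and>
        inv_into X\<^sub>0 \<alpha> \<in> measurable (restrict_space \<nu> Y\<^sub>0) (restrict_space \<mu> X\<^sub>0) \<and>
        distr (restrict_space \<mu> X\<^sub>0) (restrict_space \<nu> Y\<^sub>0) \<alpha> = restrict_space \<nu> Y\<^sub>0 \<and>
        map_prod \<alpha> \<alpha> ` Restr (orbit_rel \<Gamma> \<phi> (space \<mu>)) X\<^sub>0 =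
          Restr (orbit_rel \<Delta> \<psi> (space \<nu>)) Y\<^sub>0)"

definition separates_points :: "'x set \<Rightarrow> (nat \<Rightarrow> 'x set set) \<Rightarrow> bool" where
  "separates_points X P \<longleftrightarrow>
     (\<forall>x\<in>X. \<forall>y\<in>X. x \<noteq> y \<longrightarrow> (\<exists>n. \<exists>A\<in>P n. x \<in> A \<and> y \<notin> A))"

text \<open>
  The conditions are required on a conull set \<open>X\<^sub>0\<close>. As the group is countable, the
  exceptional null sets can be enlarged to an invariant one, so \<open>X\<^sub>0\<close> is taken invariant.
\<close>

definition profinite_action :: "('g, 'b) monoid_scheme \<Rightarrow> ('g \<Rightarrow> 'x \<Rightarrow> 'x) \<Rightarrow> 'x measure \<Rightarrow> bool" where
  "profinite_action \<Gamma> \<phi> \<mu> \<longleftrightarrow>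
     pmp_action \<Gamma> \<phi> \<mu> \<and>
     (\<exists>X\<^sub>0\<in>sets \<mu>. \<exists>P.
        emeasure \<mu> X\<^sub>0 = 1 \<and> (\<forall>g\<in>carrier \<Gamma>. \<phi> g ` X\<^sub>0 = X\<^sub>0) \<and>
        (\<forall>n. partition_on X\<^sub>0 (P n) \<and> finite (P n) \<and> P n \<subseteq> sets \<mu> \<and>
             (\<forall>g\<in>carrier \<Gamma>. \<forall>A\<in>P n. \<phi> g ` A \<in> P n)) \<and>
        separates_points X\<^sub>0 P)"

definition modular_action :: "('g, 'b) monoid_scheme \<Rightarrow> ('g \<Rightarrow> 'x \<Rightarrow> 'x) \<Rightarrow> 'x measure \<Rightarrow> bool" where
  "modular_action \<Gamma> \<phi> M \<longleftrightarrow>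
     borel_action \<Gamma> \<phi> M \<and>
     (\<exists>P.
        (\<forall>n. partition_on (space M) (P n) \<and> countable (P n) \<and> P n \<subseteq> sets M \<and>
             (\<forall>g\<in>carrier \<Gamma>. \<forall>A\<in>P n. \<phi> g ` A \<in> P n)) \<and>
        separates_points (space M) P)"

definition countable_to_one_borel_hom ::
  "'x measure \<Rightarrow> 'x rel \<Rightarrow> 'y measure \<Rightarrow> 'y rel \<Rightarrow> ('x \<Rightarrow> 'y) \<Rightarrow> bool" where
  "countable_to_one_borel_hom M R N S \<alpha> \<longleftrightarrow>
     \<alpha> \<in> measurable M N \<and> map_prod \<alpha> \<alpha> ` R \<subseteq> S \<and>
     (\<forall>y\<in>space N. countable {x \<in> space M. \<alpha> x = y})"

definition L2_zero :: "'x measure \<Rightarrow> ('x \<Rightarrow> complex) set" where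
  "L2_zero \<mu> = {\<xi> \<in> borel_measurable \<mu>.
     integrable \<mu> (\<lambda>x. (cmod (\<xi> x))\<^sup>2) \<and> (\<integral>x. \<xi> x \<partial>\<mu>) = 0}"

definition L2_norm :: "'x measure \<Rightarrow> ('x \<Rightarrow> complex) \<Rightarrow> real" where
  "L2_norm \<mu> \<xi> = sqrt (\<integral>x. (cmod (\<xi> x))\<^sup>2 \<partial>\<mu>)"

definition koopman ::
  "('g, 'b) monoid_scheme \<Rightarrow> ('g \<Rightarrow> 'x \<Rightarrow> 'x) \<Rightarrow> 'g \<Rightarrow> ('x \<Rightarrow> complex) \<Rightarrow> 'x \<Rightarrow> complex" where
  "koopman \<Gamma> \<phi> g \<xi> = (\<lambda>x. \<xi> (\<phi> (inv\<^bsub>\<Gamma>\<^esub> g) x))"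

definition spectral_gap :: "('g, 'b) monoid_scheme \<Rightarrow> ('g \<Rightarrow> 'x \<Rightarrow> 'x) \<Rightarrow> 'x measure \<Rightarrow> bool" where
  "spectral_gap \<Gamma> \<phi> \<mu> \<longleftrightarrow>
     \<not> (\<exists>\<xi>. (\<forall>n::nat. \<xi> n \<in> L2_zero \<mu> \<and> L2_norm \<mu> (\<xi> n) = 1) \<and>
            (\<forall>g\<in>carrier \<Gamma>.
               (\<lambda>n. L2_norm \<mu> (\<lambda>x. koopman \<Gamma> \<phi> g (\<xi> n) x - \<xi> n x)) \<longlonglongrightarrow> 0))"

end

theory Submission
  imports Defs "HOL-Algebra.Weak_Morphisms"
begin

text \<open>
  The invariant partitions of the modular action pull back along \<open>\<alpha>\<close> to partitions of \<open>G\<close> into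
  countably many cells. On a set of positive measure \<open>\<alpha>\<close> is injective; moving almost every point
  into this set by an element of \<open>\<Gamma>\<close> and recording that element, one may take the partitions to
  separate points almost everywhere. Every \<open>g \<in> \<Gamma>\<close> then maps most of most cells of the \<open>n\<close>-th
  partition into a single cell, once \<open>n\<close> is large. Hence the unit vectors \<open>v\<^sub>x \<in> L\<^sup>2(G)\<close> given by
  the translates \<open>x\<^sup>-\<^sup>1 A(x)\<close> of the cell \<open>A(x)\<close> of \<open>x\<close> satisfy \<open>v\<^bsub>gx\<^esub> \<approx> v\<^sub>x\<close> for most \<open>x\<close>, and
  by the spectral gap \<open>v\<^sub>x\<close> is nearly constant in \<open>x\<close>. Now \<open>x\<^sup>-\<^sup>1 A(x) \<approx> (xb)\<^sup>-\<^sup>1 A(x)\<close> for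
  most \<open>b \<in> B = x\<^sup>-\<^sup>1 A(x)\<close> says that \<open>b\<^sup>-\<^sup>1 B \<approx> B\<close>, so \<open>B\<close> is close to a subgroup, which is open.
  Since the cells shrink to points, these subgroups form a neighbourhood base at the identity.
\<close>

text \<open>No freeness is assumed, so there is no cocycle from \<Gamma> to \<Delta>: for
  \<open>g\<close> in \<Gamma>, the element of \<Delta> that carries the image of \<open>x\<close>
  to the image of \<open>g x\<close> is merely some element, chosen with least index. This choice,
  together with the element recorded at \<open>g x\<close>, takes countably many values and is the
  same at every level \<open>n\<close>. It cuts the group into countably many fixed pieces such that
  two points of one piece that share a cell have images that share a cell, at all levels at once. As
  the cells shrink, most of them lie almost entirely in one piece. The gap enters twice: as
  ergodicity, which spreads a set of positive measure over almost the whole group, and as a Poincare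
  inequality, applied coordinate by coordinate to a map with values in L^2. The passage to an exact
  subgroup rests on a jump: for the set B at hand, a translate that meets B in more than half of its
  measure meets it in at least 7/8, so near invariance survives products.\<close>

primrec joint_code :: "(nat \<Rightarrow> nat) \<Rightarrow> nat \<Rightarrow> nat" where
  "joint_code a 0 = a 0"
| "joint_code a (Suc n) = prod_encode (joint_code a n, a (Suc n))"

text \<open>A later code remembers all earlier coordinates, so the partitions coded in this way
  refine one another.\<close>

lemma joint_code_eq_iff: "joint_code a n = joint_code b n \<longleftrightarrow> (\<forall>k\<le>n. a k = b k)"
  by (induction n) (auto simp: le_Suc_eq prod_encode_eq)

lemma measurable_nat_binary:
  fixes f g :: "'a \<Rightarrow> nat"
  assumes f: "f \<in> measurable M (count_space UNIV)" and g: "g \<in> measurable M (count_space UNIV)"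
  shows "(\<lambda>x. h (f x) (g x)) \<in> measurable M (count_space UNIV)"
proof -
  have "(\<lambda>x. h (f x) j) \<in> measurable M (count_space UNIV)" for j
    by (rule measurable_compose[OF f]) simp
  then show ?thesis by (rule measurable_compose_countable[OF _ g])
qed

section \<open>Regularity of the Haar measure\<close>

locale compact_haar =
  fixes G :: "('a, 'b) monoid_scheme" (structure) and T :: "'a topology" and m :: "'a measure"
  assumes topological_group: "topological_group G T"
    and compact: "compact_space T" and Hausdorff: "Hausdorff_space T"
    and second_countable: "second_countable T"
    and haar: "haar_prob G T m"

sublocale compact_haar \<subseteq> group G
  using topological_group by (simp add: topological_group_def)

sublocale compact_haar \<subseteq> prob_space m
  using haar by (simp add: haar_prob_def)

context compact_haar
begin

lemma space_m [simp]: "space m = carrier G"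
  using haar by (simp add: haar_prob_def)

lemma topspace_T [simp]: "topspace T = carrier G"
  using topological_group by (simp add: topological_group_def)

lemma sets_m: "sets m = sigma_sets (carrier G) {U. openin T U}"
proof -
  have "sets m = sets (borel_of T)"
    using haar by (simp add: haar_prob_def)
  also have "\<dots> = sigma_sets (carrier G) {U. openin T U}"
    unfolding borel_of_def by (subst sets_measure_of) (use openin_subset[of T] in auto)
  finally show ?thesis .
qed

lemma openin_sets: "openin T U \<Longrightarrow> U \<in> sets m"
  by (simp add: sets_m sigma_sets.Basic)

lemma closedin_sets:
  assumes "closedin T C"
  shows "C \<in> sets m"
proof -
  have "space m - (carrier G - C) \<in> sets m"
    using assms by (intro sets.compl_sets openin_sets) (auto simp: closedin_def)
  moreover have "space m - (carrier G - C) = C"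
    using closedin_subset[OF assms] by auto
  ultimately show ?thesis by simp
qed

lemma measurable_mI:
  assumes "f \<in> space M \<rightarrow> carrier G"
    and "\<And>U. openin T U \<Longrightarrow> f -` U \<inter> space M \<in> sets M"
  shows "f \<in> measurable M m"
  by (rule measurable_sigma_sets[OF sets_m]) (use assms openin_subset[of T] in auto)

text \<open>Closures of base sets serve as \<open>\<K> i\<close>; regularity of a compact Hausdorff
  space shrinks them into any neighbourhood. The closed companions supply the compact sets of later
  covering arguments.\<close>

lemma countable_base:
  obtains \<O> \<K> :: "nat \<Rightarrow> 'a set" where "\<And>i. openin T (\<O> i)" "\<And>i. closedin T (\<K> i)"
    "\<And>i. \<O> i \<subseteq> \<K> i" "\<And>x U. openin T U \<Longrightarrow> x \<in> U \<Longrightarrow> \<exists>i. x \<in> \<O> i \<and> \<K> i \<subseteq> U"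
proof -
  obtain \<B> where "countable \<B> \<and> (\<forall>V\<in>\<B>. openin T V) \<and>
      (\<forall>U x. openin T U \<and> x \<in> U \<longrightarrow> (\<exists>V\<in>\<B>. x \<in> V \<and> V \<subseteq> U))"
    using second_countable unfolding second_countable_def ..
  then have \<B>: "countable \<B>" "\<And>V. V \<in> \<B> \<Longrightarrow> openin T V"
    "\<And>U x. openin T U \<Longrightarrow> x \<in> U \<Longrightarrow> \<exists>V\<in>\<B>. x \<in> V \<and> V \<subseteq> U" by simp_all
  \<comment> \<open>The empty set is added so that \<open>from_nat_into\<close> has a nonempty set
    to enumerate.\<close>
  have ne: "insert {} \<B> \<noteq> {}" "countable (insert {} \<B>)" using \<B> by auto
  have range: "range (from_nat_into (insert {} \<B>)) = insert {} \<B>"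
    using ne by (rule range_from_nat_into)
  have reg: "regular_space T"
    using compact Hausdorff by (simp add: compact_Hausdorff_imp_regular_space)
  define \<O> where "\<O> = from_nat_into (insert {} \<B>)"
  have op: "openin T (\<O> i)" for i
    using \<B>(2) range unfolding \<O>_def by (metis insertE openin_empty rangeI)
  have "\<exists>i. x \<in> \<O> i \<and> T closure_of (\<O> i) \<subseteq> U"
    if U: "openin T U" "x \<in> U" for x U
  proof -
    obtain W C where W: "openin T W" "closedin T C" "x \<in> W" "W \<subseteq> C" "C \<subseteq> U"
      using reg U unfolding neighbourhood_base_of_closedin[symmetric] neighbourhood_base_of by meson
    obtain V where V: "V \<in> \<B>" "x \<in> V" "V \<subseteq> W" using \<B>(3) W by blast
    have "T closure_of V \<subseteq> C" using V W by (meson closure_of_minimal subset_trans)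
    moreover obtain i where "V = \<O> i"
      using V range unfolding \<O>_def by (metis imageE insertI2)
    ultimately show ?thesis using V W by blast
  qed
  then show ?thesis
    using that[of \<O> "\<lambda>i. T closure_of (\<O> i)"] op closure_of_subset[OF openin_subset[OF op]] by auto
qed

text \<open>Second countability writes an open set of the square as a countable union of boxes. This
  makes multiplication jointly measurable, as the exchange of integrals later requires.\<close>

lemma openin_prod_sets:
  assumes W: "openin (prod_topology T T) W"
  shows "W \<in> sets (m \<Otimes>\<^sub>M m)"
proof -
  obtain \<O> \<K> :: "nat \<Rightarrow> 'a set" where \<O>: "\<And>i. openin T (\<O> i)" "\<And>i. closedin T (\<K> i)"
    "\<And>i. \<O> i \<subseteq> \<K> i" "\<And>x U. openin T U \<Longrightarrow> x \<in> U \<Longrightarrow> \<exists>i. x \<in> \<O> i \<and> \<K> i \<subseteq> U"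
    by (rule countable_base, rule that) assumption+
  have "W = (\<Union>ij\<in>{ij. \<O> (fst ij) \<times> \<O> (snd ij) \<subseteq> W}. \<O> (fst ij) \<times> \<O> (snd ij))"
  proof (intro subset_antisym subsetI)
    fix z assume z: "z \<in> W"
    obtain x y where xy: "z = (x, y)" by force
    obtain U V where UV: "openin T U" "openin T V" "x \<in> U" "y \<in> V" "U \<times> V \<subseteq> W"
      using W[unfolded openin_prod_topology_alt, rule_format, of x y] z xy by auto
    obtain i where i: "x \<in> \<O> i" "\<K> i \<subseteq> U" using \<O>(4)[OF UV(1,3)] by blast
    obtain j where j: "y \<in> \<O> j" "\<K> j \<subseteq> V" using \<O>(4)[OF UV(2,4)] by blast
    have "\<O> i \<times> \<O> j \<subseteq> U \<times> V"
      using i j \<O>(3)[of i] \<O>(3)[of j] by (intro Sigma_mono) auto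
    then have "(i, j) \<in> {ij. \<O> (fst ij) \<times> \<O> (snd ij) \<subseteq> W}" using UV(5) by auto
    moreover have "z \<in> \<O> (fst (i, j)) \<times> \<O> (snd (i, j))" using i j xy by simp
    ultimately show "z \<in> (\<Union>ij\<in>{ij. \<O> (fst ij) \<times> \<O> (snd ij) \<subseteq> W}. \<O> (fst ij) \<times> \<O> (snd ij))"
      by (rule UN_I)
  qed auto
  also have "\<dots> \<in> sets (m \<Otimes>\<^sub>M m)"
    by (intro sets.countable_UN' uncountable_def countableI_type)
      (auto intro!: pair_measureI openin_sets \<O>(1))
  finally show ?thesis .
qed

section \<open>Measurable multiplication and invariance under translations\<close>

lemma mult_measurable_pair: "(\<lambda>z. fst z \<otimes> snd z) \<in> measurable (m \<Otimes>\<^sub>M m) m"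
proof (rule measurable_mI)
  show "(\<lambda>z. fst z \<otimes> snd z) \<in> space (m \<Otimes>\<^sub>M m) \<rightarrow> carrier G"
    by (auto simp: space_pair_measure)
  fix U assume U: "openin T U"
  have "openin (prod_topology T T) {z \<in> topspace (prod_topology T T). (\<lambda>(x, y). x \<otimes> y) z \<in> U}"
    using topological_group U unfolding topological_group_def continuous_map by blast
  moreover have "(\<lambda>z. fst z \<otimes> snd z) -` U \<inter> space (m \<Otimes>\<^sub>M m)
      = {z \<in> topspace (prod_topology T T). (\<lambda>(x, y). x \<otimes> y) z \<in> U}"
    by (auto simp: space_pair_measure)
  ultimately show "(\<lambda>z. fst z \<otimes> snd z) -` U \<inter> space (m \<Otimes>\<^sub>M m) \<in> sets (m \<Otimes>\<^sub>M m)"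
    by (simp add: openin_prod_sets)
qed

lemma mult_measurable [measurable (raw)]:
  assumes "f \<in> measurable M m" "g \<in> measurable M m"
  shows "(\<lambda>x. f x \<otimes> g x) \<in> measurable M m"
  using measurable_compose[OF measurable_Pair[OF assms] mult_measurable_pair] by simp

lemma translation_measurable [measurable]:
  "g \<in> carrier G \<Longrightarrow> (\<lambda>x. g \<otimes> x) \<in> measurable m m"
  by (rule mult_measurable) simp_all

lemma l_coset_eq: "g \<in> carrier G \<Longrightarrow> A \<subseteq> carrier G \<Longrightarrow>
    g <# A = {x \<in> carrier G. inv g \<otimes> x \<in> A}"
  unfolding l_coset_def by (auto simp: m_assoc[symmetric])

lemma emeasure_translate:
  assumes g: "g \<in> carrier G" and A: "A \<in> sets m"
  shows "emeasure m {x \<in> carrier G. g \<otimes> x \<in> A} = emeasure m A"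
proof -
  have "emeasure m (inv g <# A) = emeasure m A"
    using haar g A by (simp add: haar_prob_def)
  then show ?thesis
    using g sets.sets_into_space[OF A] by (simp add: l_coset_eq)
qed

lemma distr_translate:
  assumes g: "g \<in> carrier G"
  shows "distr m m (\<lambda>x. g \<otimes> x) = m"
proof (rule measure_eqI)
  fix A assume "A \<in> sets (distr m m (\<lambda>x. g \<otimes> x))"
  then have A: "A \<in> sets m" by simp
  have "(\<lambda>x. g \<otimes> x) -` A \<inter> space m = {x \<in> carrier G. g \<otimes> x \<in> A}" by auto
  then show "emeasure (distr m m (\<lambda>x. g \<otimes> x)) A = emeasure m A"
    using emeasure_translate[OF g A] A g by (simp add: emeasure_distr)
qed simp

text \<open>The translate g^-1 A, as a preimage. In this convention \<open>tr x (cell f x)\<close>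
  is the cell of \<open>x\<close> moved back to the identity, and composition reverses the order as
  in \<open>tr_tr\<close>.\<close>

definition tr :: "'a \<Rightarrow> 'a set \<Rightarrow> 'a set"
  where "tr g A = {x \<in> carrier G. g \<otimes> x \<in> A}"

lemma tr_sets [measurable]: "g \<in> carrier G \<Longrightarrow> A \<in> sets m \<Longrightarrow> tr g A \<in> sets m"
proof -
  assume "g \<in> carrier G" "A \<in> sets m"
  then have "(\<lambda>x. g \<otimes> x) -` A \<inter> space m \<in> sets m"
    by (intro measurable_sets[OF translation_measurable])
  moreover have "(\<lambda>x. g \<otimes> x) -` A \<inter> space m = tr g A" by (auto simp: tr_def)
  ultimately show ?thesis by simp
qed

lemma measure_tr: "g \<in> carrier G \<Longrightarrow> A \<in> sets m \<Longrightarrow> measure m (tr g A) = measure m A"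
  unfolding tr_def measure_def by (subst emeasure_translate) auto

lemma tr_tr: "g \<in> carrier G \<Longrightarrow> h \<in> carrier G \<Longrightarrow> tr g (tr h A) = tr (h \<otimes> g) A"
  by (auto simp: tr_def m_assoc)

lemma tr_one: "A \<subseteq> carrier G \<Longrightarrow> tr \<one> A = A"
  by (auto simp: tr_def)

lemma tr_Int: "tr g (A \<inter> B) = tr g A \<inter> tr g B"
  by (auto simp: tr_def)

section \<open>Approximation from inside and outside, and Lusin's theorem\<close>

lemma openin_closedin_approx:
  assumes "openin T U" "e > 0"
  shows "\<exists>C. closedin T C \<and> C \<subseteq> U \<and> measure m (U - C) < e"
proof -
  obtain \<O> \<K> :: "nat \<Rightarrow> 'a set" where \<O>: "\<And>i. openin T (\<O> i)" "\<And>i. closedin T (\<K> i)"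
    "\<And>i. \<O> i \<subseteq> \<K> i" "\<And>x U. openin T U \<Longrightarrow> x \<in> U \<Longrightarrow> \<exists>i. x \<in> \<O> i \<and> \<K> i \<subseteq> U"
    by (rule countable_base, rule that) assumption+
  define C where "C n = (\<Union>i\<in>{i. i < n \<and> \<K> i \<subseteq> U}. \<K> i)" for n
  have closed: "closedin T (C n)" for n unfolding C_def by (intro closedin_Union) (auto simp: \<O>(2))
  have sub: "C n \<subseteq> U" for n by (auto simp: C_def)
  have Un: "(\<Union>n. C n) = U"
  proof (intro subset_antisym subsetI)
    fix x assume x: "x \<in> U"
    then obtain i where i: "x \<in> \<O> i" "\<K> i \<subseteq> U" using \<O>(4)[OF assms(1) x] by blast
    then have "x \<in> \<K> i" using \<O>(3) by blast
    then have "x \<in> C (Suc i)" using i by (auto simp: C_def)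
    then show "x \<in> (\<Union>n. C n)" by blast
  qed (use sub in auto)
  have "(\<lambda>n. measure m (C n)) \<longlonglongrightarrow> measure m (\<Union>n. C n)"
  proof (rule finite_Lim_measure_incseq)
    show "range C \<subseteq> sets m" using closed closedin_sets by blast
    show "incseq C" unfolding incseq_def C_def by (intro allI impI UN_mono) auto
  qed
  then have "(\<lambda>n. measure m (C n)) \<longlonglongrightarrow> measure m U" using Un by simp
  then have "\<forall>\<^sub>F n in sequentially. measure m U - e < measure m (C n)"
    using assms(2) by (intro order_tendstoD) auto
  then obtain n where "measure m U - e < measure m (C n)"
    by (auto simp: eventually_sequentially)
  moreover have "measure m (U - C n) = measure m U - measure m (C n)"
    using sub by (intro finite_measure_Diff openin_sets closedin_sets closed assms)
  ultimately show ?thesis using closed sub by (intro exI[of _ "C n"]) auto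
qed

text \<open>The sets that admit such approximations for every bound form a \<sigma>-algebra
  containing the open sets.\<close>

lemma regular_approx:
  assumes A: "A \<in> sets m" and e: "e > 0"
  shows "\<exists>C U. closedin T C \<and> openin T U \<and> C \<subseteq> A \<and> A \<subseteq> U \<and> measure m (U - C) < e"
proof -
  have "\<forall>e>0. \<exists>C U. closedin T C \<and> openin T U \<and> C \<subseteq> A \<and> A \<subseteq> U \<and> measure m (U - C) < e"
    using A unfolding sets_m
  proof (induction rule: sigma_sets.induct)
    case (Basic A)
    then have A: "openin T A" by simp
    show ?case
    proof (intro allI impI)
      fix e :: real assume "e > 0"
      then obtain C where "closedin T C" "C \<subseteq> A" "measure m (A - C) < e"
        using openin_closedin_approx[OF A] by auto
      then show "\<exists>C U. closedin T C \<and> openin T U \<and> C \<subseteq> A \<and> A \<subseteq> U \<and> measure m (U - C) < e"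
        using A by (intro exI[of _ C] exI[of _ A]) simp
    qed
  next
    case Empty
    then show ?case by (intro allI impI exI[of _ "{}"]) auto
  next
    case (Compl A)
    show ?case
    proof (intro allI impI)
      fix e :: real assume "e > 0"
      then obtain C U where CU: "closedin T C" "openin T U" "C \<subseteq> A" "A \<subseteq> U" "measure m (U - C) < e"
        using Compl.IH[rule_format, of e] by auto
      have "(carrier G - C) - (carrier G - U) = U - C"
        using openin_subset[OF CU(2)] by auto
      then show "\<exists>C U. closedin T C \<and> openin T U \<and> C \<subseteq> carrier G - A \<and> carrier G - A \<subseteq> U
          \<and> measure m (U - C) < e"
        using CU closedin_diff[OF closedin_topspace CU(2)] openin_diff[OF openin_topspace CU(1)]
        by (intro exI[of _ "carrier G - U"] exI[of _ "carrier G - C"]) auto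
    qed
  next
    case (Union A)
    show ?case
    proof (intro allI impI)
      fix e :: real assume e: "e > 0"
      have "\<exists>C U. closedin T C \<and> openin T U \<and> C \<subseteq> A n \<and> A n \<subseteq> U \<and> measure m (U - C) < (e/2) * (1/2) ^ Suc n"
        for n using e by (intro Union.IH[of n, rule_format]) simp
      then obtain C U where CU: "\<And>n. closedin T (C n)" "\<And>n. openin T (U n)" "\<And>n. C n \<subseteq> A n"
        "\<And>n. A n \<subseteq> U n" "\<And>n. measure m (U n - C n) < (e/2) * (1/2) ^ Suc n" by metis
      have sums: "(\<lambda>n. (e/2) * (1/2::real) ^ Suc n) sums (e/2)"
        using sums_mult[OF power_half_series, of "e/2"] by simp
      let ?D = "\<lambda>n. U n - C n"
      have D: "?D n \<in> sets m" for n using CU by (auto intro: openin_sets closedin_sets)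
      have summ: "summable (\<lambda>n. measure m (?D n))"
        by (rule summable_comparison_test[OF _ sums_summable[OF sums]])
          (use less_imp_le[OF CU(5)] in simp)
      have "measure m (\<Union>n. ?D n) \<le> (\<Sum>n. measure m (?D n))"
        by (rule finite_measure_subadditive_countably) (use D summ in auto)
      also have "\<dots> \<le> (\<Sum>n. (e/2) * (1/2) ^ Suc n)"
        by (rule suminf_le[OF _ summ sums_summable[OF sums]]) (rule less_imp_le[OF CU(5)])
      also have "\<dots> = e/2" by (rule sums_unique[OF sums, symmetric])
      finally have half: "measure m (\<Union>n. ?D n) \<le> e/2" .
      have Cs: "(\<Union>i<n. C i) \<in> sets m" for n using CU by (auto intro: closedin_sets)
      \<comment> \<open>A countable union of closed sets need not be closed, so only finitely many
        are kept; continuity from below bounds the loss by \<open>e/2\<close>.\<close>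
      have "(\<lambda>n. measure m (\<Union>i<n. C i)) \<longlonglongrightarrow> measure m (\<Union>n. \<Union>i<n. C i)"
      proof (rule finite_Lim_measure_incseq)
        show "range (\<lambda>n. \<Union>i<n. C i) \<subseteq> sets m" using Cs by blast
        show "incseq (\<lambda>n. \<Union>i<n. C i)" unfolding incseq_def by (intro allI impI UN_mono) auto
      qed
      moreover have "(\<Union>n. \<Union>i<n. C i) = (\<Union>n. C n)" by blast
      ultimately have "\<forall>\<^sub>F n in sequentially. measure m (\<Union>n. C n) - e/2 < measure m (\<Union>i<n. C i)"
        using e by (intro order_tendstoD) auto
      then obtain n where n: "measure m (\<Union>n. C n) - e/2 < measure m (\<Union>i<n. C i)"
        by (auto simp: eventually_sequentially)
      have US: "(\<Union>n. U n) \<in> sets m" "(\<Union>n. C n) \<in> sets m" using CU by (auto intro: openin_sets closedin_sets)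
      have "measure m ((\<Union>n. U n) - (\<Union>i<n. C i)) = measure m (((\<Union>n. U n) - (\<Union>n. C n)) \<union> ((\<Union>n. C n) - (\<Union>i<n. C i)))"
      proof (rule arg_cong[where f="measure m"])
        have *: "X - Z = (X - Y) \<union> (Y - Z)" if "Z \<subseteq> Y" "Y \<subseteq> X" for X Y Z :: "'a set"
          using that by auto
        show "(\<Union>n. U n) - (\<Union>i<n. C i) = ((\<Union>n. U n) - (\<Union>n. C n)) \<union> ((\<Union>n. C n) - (\<Union>i<n. C i))"
          by (rule *) (auto dest: subsetD[OF CU(3)] subsetD[OF CU(4)])
      qed
      also have "\<dots> \<le> measure m ((\<Union>n. U n) - (\<Union>n. C n)) + measure m ((\<Union>n. C n) - (\<Union>i<n. C i))"
        by (rule measure_Un_le) (use US Cs in auto)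
      finally have 1: "measure m ((\<Union>n. U n) - (\<Union>i<n. C i))
        \<le> measure m ((\<Union>n. U n) - (\<Union>n. C n)) + measure m ((\<Union>n. C n) - (\<Union>i<n. C i))" .
      have 2: "measure m ((\<Union>n. U n) - (\<Union>n. C n)) \<le> measure m (\<Union>n. ?D n)"
        by (rule finite_measure_mono) (use D in auto)
      have 3: "measure m ((\<Union>n. C n) - (\<Union>i<n. C i)) = measure m (\<Union>n. C n) - measure m (\<Union>i<n. C i)"
        by (rule finite_measure_Diff) (use US Cs in auto)
      have "measure m ((\<Union>n. U n) - (\<Union>i<n. C i)) < e" using half n 1 2 3 by simp
      moreover have "closedin T (\<Union>i<n. C i)" using CU by (intro closedin_Union) auto
      moreover have "openin T (\<Union>n. U n)" using CU(2) by (intro openin_Union) auto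
      ultimately show "\<exists>C U. closedin T C \<and> openin T U \<and> C \<subseteq> \<Union> (range A) \<and> \<Union> (range A) \<subseteq> U
          \<and> measure m (U - C) < e"
        using CU(3,4) by (intro exI[of _ "\<Union>i<n. C i"] exI[of _ "\<Union>n. U n"] conjI UN_mono) auto
    qed
  qed
  then show ?thesis using e by simp
qed

text \<open>Squeeze each \<open>A i\<close> between a closed \<open>C i\<close> and an open
  \<open>U i\<close>, and remove the small open set \<open>W\<close> of all gaps: off
  \<open>W\<close> the sets \<open>A i\<close> and \<open>U i\<close> coincide. One \<open>K\<close>
  serves all \<open>i\<close>.\<close>

lemma lusin:
  fixes A :: "nat \<Rightarrow> 'a set"
  assumes S: "S \<in> sets m" and A: "\<And>i. A i \<in> sets m" and e: "e > 0"
  obtains K where "closedin T K" "K \<subseteq> S" "measure m (S - K) < e"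
    "\<And>i. \<exists>U. openin T U \<and> U \<inter> K = A i \<inter> K"
proof -
  have "\<exists>C U. closedin T C \<and> openin T U \<and> C \<subseteq> A i \<and> A i \<subseteq> U \<and> measure m (U - C) < (e/4) * (1/2) ^ Suc i" for i
    using e by (intro regular_approx A) simp
  then obtain C U where CU: "\<And>i. closedin T (C i)" "\<And>i. openin T (U i)" "\<And>i. C i \<subseteq> A i"
    "\<And>i. A i \<subseteq> U i" "\<And>i. measure m (U i - C i) < (e/4) * (1/2) ^ Suc i" by metis
  obtain L V where L: "closedin T L" "openin T V" "L \<subseteq> S" "S \<subseteq> V" "measure m (V - L) < e/4"
    using regular_approx[OF S, of "e/4"] e by auto
  define W where "W = (\<Union>i. U i - C i)"
  have UC: "U i - C i \<in> sets m" for i using CU by (auto intro: openin_sets closedin_sets)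
  have W: "openin T W" unfolding W_def using CU(1,2) by (intro openin_Union) auto
  have sums: "(\<lambda>n. (e/4) * (1/2::real) ^ Suc n) sums (e/4)"
    using sums_mult[OF power_half_series, of "e/4"] by simp
  have summ: "summable (\<lambda>n. measure m (U n - C n))"
    by (rule summable_comparison_test[OF _ sums_summable[OF sums]])
      (use less_imp_le[OF CU(5)] in simp)
  have "measure m W \<le> (\<Sum>n. measure m (U n - C n))"
    unfolding W_def by (rule finite_measure_subadditive_countably) (use UC summ in auto)
  also have "\<dots> \<le> (\<Sum>n. (e/4) * (1/2) ^ Suc n)"
    by (rule suminf_le[OF _ summ sums_summable[OF sums]]) (rule less_imp_le[OF CU(5)])
  also have "\<dots> = e/4" by (rule sums_unique[OF sums, symmetric])
  finally have mW: "measure m W \<le> e/4" .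
  define K where "K = L - W"
  have sets: "V - L \<in> sets m" "W \<in> sets m" using L W by (auto intro: openin_sets closedin_sets)
  have "measure m (S - K) \<le> measure m ((V - L) \<union> W)"
    using L sets by (intro finite_measure_mono) (auto simp: K_def)
  also have "\<dots> \<le> measure m (V - L) + measure m W" using sets by (rule measure_Un_le)
  finally have "measure m (S - K) < e" using mW L(5) e by simp
  moreover have "closedin T K" unfolding K_def using L(1) W by (rule closedin_diff)
  moreover have "K \<subseteq> S" using L(3) by (auto simp: K_def)
  moreover have "\<exists>V. openin T V \<and> V \<inter> K = A i \<inter> K" for i
  proof (intro exI conjI)
    show "openin T (U i)" using CU by simp
    show "U i \<inter> K = A i \<inter> K" using CU(3)[of i] CU(4)[of i] by (auto simp: K_def W_def)
  qed
  ultimately show ?thesis using that by simp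
qed

text \<open>Pairing \<open>n\<close> with \<open>i\<close> lists all level sets of all functions in
  one sequence, so every \<open>\<kappa> n\<close> is locally constant on the same
  \<open>K\<close>.\<close>

lemma lusin_nat:
  fixes \<kappa> :: "nat \<Rightarrow> 'a \<Rightarrow> nat"
  assumes S: "S \<in> sets m" and \<kappa>: "\<And>n. \<kappa> n \<in> measurable m (count_space UNIV)" and e: "e > 0"
  obtains K where "closedin T K" "K \<subseteq> S" "measure m (S - K) < e"
    "\<And>n i. \<exists>U. openin T U \<and> U \<inter> K = {x \<in> K. \<kappa> n x = i}"
proof -
  define A where "A j = {x \<in> space m. \<kappa> (fst (prod_decode j)) x = snd (prod_decode j)}" for j
  have "A j \<in> sets m" for j
    unfolding A_def using measurable_sets[OF \<kappa>, of "{snd (prod_decode j)}" "fst (prod_decode j)"]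
    by (simp add: vimage_def Int_def conj_commute)
  then obtain K where K: "closedin T K" "K \<subseteq> S" "measure m (S - K) < e"
    "\<And>j. \<exists>U. openin T U \<and> U \<inter> K = A j \<inter> K"
    using lusin[OF S _ e, of A] by metis
  have KG: "K \<subseteq> carrier G" using closedin_subset[OF K(1)] by simp
  have "\<exists>U. openin T U \<and> U \<inter> K = {x \<in> K. \<kappa> n x = i}" for n i
  proof -
    have "A (prod_encode (n, i)) \<inter> K = {x \<in> K. \<kappa> n x = i}" using KG by (auto simp: A_def)
    then show ?thesis using K(4)[of "prod_encode (n, i)"] by simp
  qed
  then show ?thesis using that K by simp
qed

section \<open>Cells of countable partitions and a density theorem\<close>

definition cell :: "('a \<Rightarrow> nat) \<Rightarrow> 'a \<Rightarrow> 'a set"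
  where "cell f x = {y \<in> carrier G. f y = f x}"

text \<open>Here \<open>f\<close> is thought of as fine and \<open>w\<close> as fixed: these are the
  points whose \<open>f\<close>-cell is cut by \<open>w\<close>, with more than the proportion
  \<open>d\<close> outside the piece of the point.\<close>

abbreviation split_points :: "('a \<Rightarrow> nat) \<Rightarrow> ('a \<Rightarrow> nat) \<Rightarrow> real \<Rightarrow> 'a set"
  where "split_points f w d \<equiv> {x \<in> carrier G. measure m (cell f x - cell w x) > d * measure m (cell f x)}"

lemma nat_pred_sets:
  assumes f: "f \<in> measurable m (count_space UNIV)"
  shows "{x \<in> carrier G. P (f x)} \<in> sets m"
proof -
  have eq: "f -` {i. P i} \<inter> space m = {x \<in> carrier G. P (f x)}" by auto
  have "f -` {i. P i} \<inter> space m \<in> sets m" by (rule measurable_sets[OF f]) simp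
  then show ?thesis unfolding eq .
qed

lemma cell_sets [measurable]:
  "f \<in> measurable m (count_space UNIV) \<Longrightarrow> cell f x \<in> sets m"
  unfolding cell_def by (rule nat_pred_sets)

lemma measure_fibers_le:
  fixes f :: "'a \<Rightarrow> nat"
  assumes f: "f \<in> measurable m (count_space UNIV)" and E: "E \<in> sets m"
    and le: "\<And>i. i \<in> I \<Longrightarrow> d * measure m {x \<in> carrier G. f x = i} \<le> measure m ({x \<in> carrier G. f x = i} - E)"
  shows "d * measure m {x \<in> carrier G. f x \<in> I} \<le> measure m ({x \<in> carrier G. f x \<in> I} - E)"
proof -
  define A where "A i = (if i \<in> I then {x \<in> carrier G. f x = i} else {})" for i
  have A: "A i \<in> sets m" for i using nat_pred_sets[OF f] by (simp add: A_def)
  have disj: "disjoint_family A" by (auto simp: disjoint_family_on_def A_def)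
  have "(\<lambda>i. measure m (A i)) sums measure m (\<Union>i. A i)"
    using A disj by (intro finite_measure_UNION) auto
  then have 1: "(\<lambda>i. d * measure m (A i)) sums (d * measure m (\<Union>i. A i))" by (rule sums_mult)
  have 2: "(\<lambda>i. measure m (A i - E)) sums measure m (\<Union>i. A i - E)"
    using A E disj by (intro finite_measure_UNION) (auto simp: disjoint_family_on_def)
  have "d * measure m (\<Union>i. A i) \<le> measure m (\<Union>i. A i - E)"
    by (rule sums_le[OF _ 1 2]) (use le in \<open>auto simp: A_def\<close>)
  moreover have "(\<Union>i. A i) = {x \<in> carrier G. f x \<in> I}" by (auto simp: A_def)
  moreover have "(\<Union>i. A i - E) = {x \<in> carrier G. f x \<in> I} - E" by (auto simp: A_def)
  ultimately show ?thesis by simp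
qed

text \<open>A Chebyshev argument. A bad point of \<open>E\<close> outside the union given by
  \<open>J\<close> lies in the symmetric difference, and each bad cell in the union has more than
  the proportion \<open>d\<close> of its mass there; this explains the summands 1 and
  \<open>1/d\<close>.\<close>

lemma measure_bad_cells:
  assumes f: "f \<in> measurable m (count_space UNIV)" and E: "E \<in> sets m" and d: "d > 0"
  shows "measure m {x \<in> E. measure m (cell f x - E) > d * measure m (cell f x)}
    \<le> (1/d + 1) * measure m (sym_diff E {x \<in> carrier G. f x \<in> J})"
proof -
  define I where "I = {i. measure m ({x \<in> carrier G. f x = i} - E) > d * measure m {x \<in> carrier G. f x = i}}"
  let ?F = "{x \<in> carrier G. f x \<in> J}" and ?B = "{x \<in> carrier G. f x \<in> I \<inter> J}"
  have sets: "?F \<in> sets m" "?B \<in> sets m" using nat_pred_sets[OF f] by auto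
  have EG: "E \<subseteq> carrier G" using sets.sets_into_space[OF E] by simp
  have "{x \<in> E. measure m (cell f x - E) > d * measure m (cell f x)} \<subseteq> ?B \<union> (E - ?F)"
    using EG by (auto simp: I_def cell_def)
  then have "measure m {x \<in> E. measure m (cell f x - E) > d * measure m (cell f x)}
      \<le> measure m (?B \<union> (E - ?F))"
    using sets E by (intro finite_measure_mono) auto
  also have "\<dots> \<le> measure m ?B + measure m (E - ?F)" using sets E by (intro measure_Un_le) auto
  also have "\<dots> \<le> measure m ?B + measure m (sym_diff E ?F)"
    using sets E by (intro add_left_mono finite_measure_mono) auto
  finally have 1: "measure m {x \<in> E. measure m (cell f x - E) > d * measure m (cell f x)}
      \<le> measure m ?B + measure m (sym_diff E ?F)" .
  have "d * measure m ?B \<le> measure m (?B - E)"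
    by (rule measure_fibers_le[OF f E]) (auto simp: I_def intro: less_imp_le)
  also have "\<dots> \<le> measure m (sym_diff E ?F)"
    using sets E by (intro finite_measure_mono) auto
  finally have "measure m ?B \<le> (1/d) * measure m (sym_diff E ?F)"
    using d by (simp add: field_simps)
  then show ?thesis using 1 by (simp add: algebra_simps)
qed

text \<open>This replaces martingale convergence. On a compact set where all
  \<open>\<kappa> n\<close> are locally constant, closed parts of \<open>E\<close> and of its
  complement are separated pair by pair; compactness of their product yields one level separating
  all pairs, and by refinement every later level does so too.\<close>

lemma approx_by_separating:
  fixes \<kappa> :: "nat \<Rightarrow> 'a \<Rightarrow> nat"
  assumes \<kappa>: "\<And>n. \<kappa> n \<in> measurable m (count_space UNIV)"
    and refine: "\<And>n x y. \<kappa> (Suc n) x = \<kappa> (Suc n) y \<Longrightarrow> \<kappa> n x = \<kappa> n y"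
    and S: "S \<in> sets m" "measure m S = 1"
    and sep: "\<And>x y. x \<in> S \<Longrightarrow> y \<in> S \<Longrightarrow> (\<And>n. \<kappa> n x = \<kappa> n y) \<Longrightarrow> x = y"
    and E: "E \<in> sets m" and e: "e > 0"
  shows "\<exists>N. \<forall>n\<ge>N. \<exists>J. measure m (sym_diff E {x \<in> carrier G. \<kappa> n x \<in> J}) < e"
proof -
  have mono: "\<kappa> n x = \<kappa> n y" if "k \<ge> n" "\<kappa> k x = \<kappa> k y" for n k x y
    using that by (induction k rule: dec_induct) (auto dest: refine)
  obtain K where K: "closedin T K" "K \<subseteq> S" "measure m (S - K) < e/4"
    "\<And>n i. \<exists>U. openin T U \<and> U \<inter> K = {x \<in> K. \<kappa> n x = i}"
  proof (rule lusin_nat[OF S(1) \<kappa>, of "e/4"])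
    show "e/4 > 0" using e by simp
  qed (rule that)
  have Ks: "K \<in> sets m" using K by (simp add: closedin_sets)
  obtain C1 U1 where C1: "closedin T C1" "C1 \<subseteq> E \<inter> K" "measure m (U1 - C1) < e/4" "E \<inter> K \<subseteq> U1" "openin T U1"
    using regular_approx[of "E \<inter> K" "e/4"] E Ks e by auto
  obtain C2 U2 where C2: "closedin T C2" "C2 \<subseteq> K - E" "measure m (U2 - C2) < e/4" "K - E \<subseteq> U2" "openin T U2"
    using regular_approx[of "K - E" "e/4"] E Ks e by auto
  \<comment> \<open>\<open>W n\<close> collects the open boxes whose two sides share no value of
    \<open>\<kappa> n\<close> on \<open>K\<close>. Over all \<open>n\<close> these sets cover the
    compact product of \<open>C1\<close> and \<open>C2\<close>.\<close>
  define W where "W n = \<Union>{U \<times> V |U V. openin T U \<and> openin T V \<and>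
      (\<forall>a\<in>U \<inter> K. \<forall>b\<in>V \<inter> K. \<kappa> n a \<noteq> \<kappa> n b)}" for n
  have opW: "openin (prod_topology T T) (W n)" for n
    unfolding W_def by (intro openin_Union) (auto simp: openin_prod_Times_iff)
  have "C1 \<times> C2 \<subseteq> (\<Union>n. W n)"
  proof
    fix z assume "z \<in> C1 \<times> C2"
    then obtain x y where z: "z = (x, y)" "x \<in> C1" "y \<in> C2" by auto
    then have xy: "x \<in> K" "y \<in> K" "x \<in> S" "y \<in> S" "x \<noteq> y" using C1(2) C2(2) K(2) by auto
    then obtain n where n: "\<kappa> n x \<noteq> \<kappa> n y" using sep by metis
    obtain U where U: "openin T U" "U \<inter> K = {a \<in> K. \<kappa> n a = \<kappa> n x}" using K(4) by metis
    obtain V where V: "openin T V" "V \<inter> K = {a \<in> K. \<kappa> n a = \<kappa> n y}" using K(4) by metis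
    have "x \<in> U \<inter> K" "y \<in> V \<inter> K" using U V xy by simp_all
    then have "z \<in> U \<times> V" using z by simp
    moreover have "\<forall>a\<in>U \<inter> K. \<forall>b\<in>V \<inter> K. \<kappa> n a \<noteq> \<kappa> n b" unfolding U(2) V(2) using n by simp
    ultimately have "z \<in> W n" unfolding W_def using U(1) V(1) by auto
    then show "z \<in> (\<Union>n. W n)" by auto
  qed
  moreover have "compactin (prod_topology T T) (C1 \<times> C2)"
    using closedin_compact_space[OF compact] C1(1) C2(1) by (simp add: compactin_Times)
  ultimately obtain \<F> where \<F>: "finite \<F>" "\<F> \<subseteq> range W" "C1 \<times> C2 \<subseteq> \<Union>\<F>"
    using compactinD[of "prod_topology T T" "C1 \<times> C2" "range W"] opW by (metis rangeE)
  obtain M where M: "finite M" "\<F> = W ` M" using finite_subset_image[OF \<F>(1,2)] by auto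
  obtain N where N: "\<And>n. n \<in> M \<Longrightarrow> n \<le> N" using M(1) finite_nat_set_iff_bounded_le by auto
  have neq: "\<kappa> n x \<noteq> \<kappa> n y" if n: "n \<ge> N" and xy: "x \<in> C1" "y \<in> C2" for n x y
  proof -
    obtain k where k: "k \<in> M" "(x, y) \<in> W k" using \<F>(3) M xy by auto
    have "x \<in> K" "y \<in> K" using xy C1 C2 by auto
    then have "\<kappa> k x \<noteq> \<kappa> k y" using k(2) unfolding W_def by auto
    then show ?thesis using mono[of k n x y] N[OF k(1)] n by auto
  qed
  \<comment> \<open>The witness for \<open>J\<close> is the set of labels met by \<open>C1\<close>.
    No point of \<open>C2\<close> bears such a label, so the symmetric difference lies in four
    remainders, one null and three below \<open>e/4\<close>.\<close>
  have "measure m (sym_diff E {x \<in> carrier G. \<kappa> n x \<in> \<kappa> n ` C1}) < e" if n: "n \<ge> N" for n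
  proof -
    have sets: "C1 \<in> sets m" "C2 \<in> sets m" "U1 \<in> sets m" "U2 \<in> sets m"
      using C1 C2 by (auto intro: closedin_sets openin_sets)
    have EG: "E \<subseteq> carrier G" "C1 \<subseteq> carrier G" using sets.sets_into_space E sets by fastforce+
    have sub: "sym_diff E {x \<in> carrier G. \<kappa> n x \<in> \<kappa> n ` C1}
      \<subseteq> (((carrier G - S) \<union> (S - K)) \<union> (U1 - C1)) \<union> (U2 - C2)"
    proof
      fix x assume x: "x \<in> sym_diff E {x \<in> carrier G. \<kappa> n x \<in> \<kappa> n ` C1}"
      then have xG: "x \<in> carrier G" using EG by auto
      have "x \<notin> C1" using x C1(2) EG by auto
      moreover have "x \<notin> C2"
      proof
        assume x2: "x \<in> C2"
        then obtain y where "y \<in> C1" "\<kappa> n x = \<kappa> n y" using x C2(2) by auto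
        then show False using neq[OF n _ x2, of y] by simp
      qed
      ultimately show "x \<in> (((carrier G - S) \<union> (S - K)) \<union> (U1 - C1)) \<union> (U2 - C2)"
        using xG C1(4) C2(4) by auto
    qed
    have GS: "carrier G - S \<in> sets m" using S sets.compl_sets[of S m] by simp
    have zero: "measure m (carrier G - S) = 0" using prob_compl[OF S(1)] S(2) by simp
    have "measure m (sym_diff E {x \<in> carrier G. \<kappa> n x \<in> \<kappa> n ` C1})
        \<le> measure m ((((carrier G - S) \<union> (S - K)) \<union> (U1 - C1)) \<union> (U2 - C2))"
      using sub S Ks sets GS by (intro finite_measure_mono) auto
    also have "\<dots> \<le> measure m (((carrier G - S) \<union> (S - K)) \<union> (U1 - C1)) + measure m (U2 - C2)"
      using S Ks sets GS by (intro measure_Un_le) auto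
    finally have 1: "measure m (sym_diff E {x \<in> carrier G. \<kappa> n x \<in> \<kappa> n ` C1})
      \<le> measure m (((carrier G - S) \<union> (S - K)) \<union> (U1 - C1)) + measure m (U2 - C2)" .
    have 2: "measure m (((carrier G - S) \<union> (S - K)) \<union> (U1 - C1))
        \<le> measure m ((carrier G - S) \<union> (S - K)) + measure m (U1 - C1)"
      using S Ks sets GS by (intro measure_Un_le) auto
    have 3: "measure m ((carrier G - S) \<union> (S - K)) \<le> measure m (carrier G - S) + measure m (S - K)"
      using S Ks sets GS by (intro measure_Un_le) auto
    show ?thesis using 1 2 3 zero K(3) C1(3) C2(3) e by linarith
  qed
  then have "\<exists>J. measure m (sym_diff E {x \<in> carrier G. \<kappa> n x \<in> J}) < e" if "n \<ge> N" for n
    using that by (rule_tac exI)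
  then show ?thesis by (intro exI[of _ N]) simp
qed

text \<open>A Lebesgue density theorem for the cells of \<open>\<kappa> n\<close>. Up to measure
  \<open>e/2\<close> only finitely many pieces of \<open>w\<close> occur; each is nearly a union of
  cells, and \<open>measure_bad_cells\<close> turns this into a bound on the cells that are
  cut.\<close>

lemma density:
  fixes \<kappa> :: "nat \<Rightarrow> 'a \<Rightarrow> nat" and w :: "'a \<Rightarrow> nat"
  assumes \<kappa>: "\<And>n. \<kappa> n \<in> measurable m (count_space UNIV)"
    and refine: "\<And>n x y. \<kappa> (Suc n) x = \<kappa> (Suc n) y \<Longrightarrow> \<kappa> n x = \<kappa> n y"
    and S: "S \<in> sets m" "measure m S = 1"
    and sep: "\<And>x y. x \<in> S \<Longrightarrow> y \<in> S \<Longrightarrow> (\<And>n. \<kappa> n x = \<kappa> n y) \<Longrightarrow> x = y"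
    and w: "w \<in> measurable m (count_space UNIV)" and d: "d > 0" and e: "e > 0"
  shows "\<exists>N. \<forall>n\<ge>N. measure m (split_points (\<kappa> n) w d) < e"
proof -
  define E where "E i = {x \<in> carrier G. w x = i}" for i
  have E: "E i \<in> sets m" for i unfolding E_def by (rule nat_pred_sets[OF w])
  have tail: "{x \<in> carrier G. w x \<ge> M} \<in> sets m" for M by (rule nat_pred_sets[OF w])
  have "(\<lambda>M. measure m {x \<in> carrier G. w x \<ge> M}) \<longlonglongrightarrow> measure m (\<Inter>M. {x \<in> carrier G. w x \<ge> M})"
    by (rule finite_Lim_measure_decseq) (use tail in \<open>auto simp: decseq_def\<close>)
  moreover have "(\<Inter>M. {x \<in> carrier G. w x \<ge> M}) = {}"
    using not_less_eq_eq by auto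
  ultimately have "\<forall>\<^sub>F M in sequentially. measure m {x \<in> carrier G. w x \<ge> M} < e/2"
    using e by (intro order_tendstoD) auto
  then obtain M where M: "measure m {x \<in> carrier G. w x \<ge> M} < e/2"
    by (auto simp: eventually_sequentially)
  \<comment> \<open>The divisor \<open>1/d + 1\<close> offsets the loss in
    \<open>measure_bad_cells\<close>; the other one makes \<open>M\<close> pieces contribute at most
    \<open>e/2\<close>, its summand 1 covering \<open>M = 0\<close>.\<close>
  define e' where "e' = e / (2 * (real M + 1)) / (1/d + 1)"
  have e': "e' > 0"
  proof -
    have "0 < 1/d + 1" "0 < 2 * (real M + 1)" using d by (auto intro: add_pos_pos)
    then show ?thesis unfolding e'_def using e by (intro divide_pos_pos)
  qed
  have "\<forall>i. \<exists>N. \<forall>n\<ge>N. \<exists>J. measure m (sym_diff (E i) {x \<in> carrier G. \<kappa> n x \<in> J}) < e'"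
    by (rule allI, rule approx_by_separating[where \<kappa>=\<kappa> and S=S]) (fact \<kappa> refine S sep E e')+
  from choice[OF this] obtain N
    where N: "\<And>i n. n \<ge> N i \<Longrightarrow> \<exists>J. measure m (sym_diff (E i) {x \<in> carrier G. \<kappa> n x \<in> J}) < e'"
    by auto
  define N0 where "N0 = Max (N ` {..M})"
  have N0: "N i \<le> N0" if "i < M" for i using that by (auto simp: N0_def)
  have "measure m (split_points (\<kappa> n) w d) < e"
    if n: "n \<ge> N0" for n
  proof -
    let ?Bd = "\<lambda>i. {x \<in> E i. measure m (cell (\<kappa> n) x - E i) > d * measure m (cell (\<kappa> n) x)}"
    have Bd: "?Bd i \<in> sets m" for i
    proof -
      let ?P = "\<lambda>j. measure m ({y \<in> carrier G. \<kappa> n y = j} - E i) > d * measure m {y \<in> carrier G. \<kappa> n y = j}"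
      have "?Bd i = E i \<inter> {x \<in> carrier G. ?P (\<kappa> n x)}"
        unfolding cell_def by (auto simp: E_def)
      moreover have "{x \<in> carrier G. ?P (\<kappa> n x)} \<in> sets m" by (rule nat_pred_sets[OF \<kappa>])
      ultimately show ?thesis using E[of i] by simp
    qed
    have le: "measure m (?Bd i) \<le> e / (2 * (real M + 1))" if i: "i < M" for i
    proof -
      obtain J where J: "measure m (sym_diff (E i) {x \<in> carrier G. \<kappa> n x \<in> J}) < e'"
        using N[of i n] N0[OF i] n by auto
      have pos: "1/d + 1 > 0" using d by (auto intro: add_pos_pos)
      have "measure m (?Bd i) \<le> (1/d + 1) * measure m (sym_diff (E i) {x \<in> carrier G. \<kappa> n x \<in> J})"
        by (rule measure_bad_cells[OF \<kappa> E d])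
      also have "\<dots> \<le> (1/d + 1) * e'" using J pos by (intro mult_left_mono) auto
      also have "\<dots> = e / (2 * (real M + 1))" using pos by (simp add: e'_def)
      finally show ?thesis .
    qed
    have "split_points (\<kappa> n) w d
        \<subseteq> {x \<in> carrier G. w x \<ge> M} \<union> (\<Union>i\<in>{..<M}. ?Bd i)"
    proof
      fix x assume x: "x \<in> split_points (\<kappa> n) w d"
      have "cell w x = E (w x)" by (simp add: cell_def E_def)
      then have "x \<in> ?Bd (w x)" using x by (simp add: E_def)
      then show "x \<in> {x \<in> carrier G. w x \<ge> M} \<union> (\<Union>i\<in>{..<M}. ?Bd i)"
        using x by (cases "w x < M") auto
    qed
    then have "measure m (split_points (\<kappa> n) w d)
        \<le> measure m ({x \<in> carrier G. w x \<ge> M} \<union> (\<Union>i\<in>{..<M}. ?Bd i))"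
      using tail Bd by (intro finite_measure_mono) auto
    also have "\<dots> \<le> measure m {x \<in> carrier G. w x \<ge> M} + measure m (\<Union>i\<in>{..<M}. ?Bd i)"
      using tail Bd by (intro measure_Un_le) auto
    finally have 1: "measure m (split_points (\<kappa> n) w d)
      \<le> measure m {x \<in> carrier G. w x \<ge> M} + measure m (\<Union>i\<in>{..<M}. ?Bd i)" .
    have "measure m (\<Union>i\<in>{..<M}. ?Bd i) \<le> (\<Sum>i\<in>{..<M}. measure m (?Bd i))"
      using Bd by (intro finite_measure_subadditive_finite) auto
    also have "\<dots> \<le> (\<Sum>i\<in>{..<M}. e / (2 * (real M + 1)))" using le by (intro sum_mono) auto
    also have "\<dots> \<le> e/2" using e by (simp add: field_simps)
    finally show ?thesis using M 1 by simp
  qed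
  then show ?thesis by (intro exI[of _ N0]) simp
qed

section \<open>Open subgroups\<close>

lemma continuous_mult: "continuous_map (prod_topology T T) T (\<lambda>(x, y). x \<otimes> y)"
  using topological_group by (simp add: topological_group_def)

lemma continuous_inv: "continuous_map T T (\<lambda>x. inv x)"
  using topological_group by (simp add: topological_group_def)

lemma continuous_map_mult:
  assumes "continuous_map X T f" "continuous_map X T g"
  shows "continuous_map X T (\<lambda>x. f x \<otimes> g x)"
  using continuous_map_compose[OF continuous_map_pairedI[OF assms] continuous_mult]
  by (simp add: o_def)

lemma continuous_map_inv:
  assumes "continuous_map X T f"
  shows "continuous_map X T (\<lambda>x. inv f x)"
  using continuous_map_compose[OF assms continuous_inv] by (simp add: o_def)

lemma openin_preimage_mult:
  assumes "openin T U"
  shows "openin (prod_topology T T) {z \<in> carrier G \<times> carrier G. fst z \<otimes> snd z \<in> U}"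
  using openin_continuous_map_preimage[OF continuous_mult assms]
  by (simp add: case_prod_beta)

lemma openin_tr:
  assumes "g \<in> carrier G" "openin T U"
  shows "openin T (tr g U)"
proof -
  have "continuous_map T T (\<lambda>x. g \<otimes> x)"
    using assms by (intro continuous_map_mult) auto
  from openin_continuous_map_preimage[OF this assms(2)] show ?thesis
    by (simp add: tr_def)
qed

lemma openin_subgroup:
  assumes H: "subgroup H G" and V: "openin T V" "\<one> \<in> V" "V \<subseteq> H"
  shows "openin T H"
proof (subst openin_subopen, intro ballI)
  fix h assume h: "h \<in> H"
  then have hG: "h \<in> carrier G" using subgroup.mem_carrier[OF H] by simp
  have "tr (inv h) V \<subseteq> H"
  proof
    fix x assume "x \<in> tr (inv h) V"
    then have x: "x \<in> carrier G" "inv h \<otimes> x \<in> H" using V by (auto simp: tr_def)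
    then have "h \<otimes> (inv h \<otimes> x) \<in> H" using h x by (simp add: subgroup.m_closed[OF H])
    then show "x \<in> H" using x hG by (simp add: m_assoc[symmetric])
  qed
  moreover have "h \<in> tr (inv h) V" using V hG by (simp add: tr_def)
  moreover have "openin T (tr (inv h) V)" using hG V by (intro openin_tr) auto
  ultimately show "\<exists>U. openin T U \<and> h \<in> U \<and> U \<subseteq> H" by metis
qed

lemma measure_Int_ge:
  assumes "B \<in> sets m" "C \<in> sets m" "D \<in> sets m" "C \<subseteq> B" "D \<subseteq> B"
  shows "measure m (C \<inter> D) \<ge> measure m C + measure m D - measure m B"
proof -
  have "measure m (C \<union> D) + measure m (C \<inter> D) = measure m C + measure m D"
    using assms(2,3) measure_Un3[of C m D] fmeasurable_eq_sets by simp
  moreover have "measure m (C \<union> D) \<le> measure m B"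
    using assms by (intro finite_measure_mono) auto
  ultimately show ?thesis by simp
qed

text \<open>Squeeze \<open>B\<close> between a compact \<open>C\<close> and an open
  \<open>U\<close>. The tube lemma gives \<open>V\<close> with V C inside \<open>U\<close>; for
  \<open>v\<close> in \<open>V\<close> both \<open>C\<close> and v^-1 C lie in v^-1 U, so they
  overlap in at least 2 m(C) - m(U), which exceeds half of m(B).\<close>

lemma steinhaus:
  assumes B: "B \<in> sets m" "measure m B > 0"
  obtains V where "openin T V" "\<one> \<in> V"
    "\<And>v. v \<in> V \<Longrightarrow> measure m (tr v B \<inter> B) > measure m B / 2"
proof -
  obtain C U where CU: "closedin T C" "openin T U" "C \<subseteq> B" "B \<subseteq> U" "measure m (U - C) < measure m B / 4"
    using regular_approx[OF B(1), of "measure m B / 4"] B(2) by auto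
  have CS: "C \<in> sets m" "U \<in> sets m" using CU by (auto intro: closedin_sets openin_sets)
  have "compactin T C" using compact CU(1) by (rule closedin_compact_space)
  moreover have "{\<one>} \<times> C \<subseteq> {z \<in> carrier G \<times> carrier G. fst z \<otimes> snd z \<in> U}"
    using subset_trans[OF CU(3,4)] sets.sets_into_space[OF CS(1)] by (auto simp: subset_eq)
  ultimately obtain V W where V: "openin T V" "\<one> \<in> V" "C \<subseteq> W"
    "V \<times> W \<subseteq> {z \<in> carrier G \<times> carrier G. fst z \<otimes> snd z \<in> U}"
    using tube_lemma_right[OF openin_preimage_mult[OF CU(2)], of C \<one>] by auto
  have "measure m (tr v B \<inter> B) > measure m B / 2" if v: "v \<in> V" for v
  proof -
    have vG: "v \<in> carrier G" using V(1) v openin_subset by fastforce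
    have "V \<times> C \<subseteq> {z \<in> carrier G \<times> carrier G. fst z \<otimes> snd z \<in> U}"
      using V(3,4) by (meson Sigma_mono order_refl subset_trans)
    then have sub: "C \<subseteq> tr v U" using v by (auto simp: tr_def)
    have "measure m (C \<inter> tr v C) \<ge> measure m C + measure m (tr v C) - measure m (tr v U)"
    proof (rule measure_Int_ge)
      show "tr v U \<in> sets m" "tr v C \<in> sets m" "C \<in> sets m" using vG CS by auto
      show "tr v C \<subseteq> tr v U" using CU(3,4) by (auto simp: tr_def)
    qed (rule sub)
    moreover have "measure m (tr v C) = measure m C" "measure m (tr v U) = measure m U"
      using vG CS by (auto simp: measure_tr)
    moreover have "measure m (U - C) = measure m U - measure m C"
      using CS CU by (intro finite_measure_Diff) auto
    moreover have "measure m B \<le> measure m U" using CU CS by (intro finite_measure_mono) auto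
    moreover have "measure m (C \<inter> tr v C) \<le> measure m (tr v B \<inter> B)"
    proof (rule finite_measure_mono)
      show "C \<inter> tr v C \<subseteq> tr v B \<inter> B" using CU(3) by (auto simp: tr_def)
      show "tr v B \<inter> B \<in> sets m" using vG B by auto
    qed
    ultimately show ?thesis using CU(5) by linarith
  qed
  then show ?thesis using that V by simp
qed

text \<open>The elements with overlap above one half form a subgroup because of a jump. Such an
  \<open>h\<close> equals (h b) b^-1 with \<open>b\<close> and h b in \<open>D\<close>, and two
  overlaps of 15/16 leave 7/8. Two elements with 7/8 leave 3/4 for their product, again above one
  half. The last conclusion confines \<open>H\<close> to D D^-1.\<close>

lemma openin_subgroup_of_almost_subgroup:
  assumes B: "B \<in> sets m" "measure m B > 0"
    and D: "D \<in> sets m" "D \<subseteq> B" "measure m (B - D) \<le> measure m B / 8"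
    and stable: "\<And>b. b \<in> D \<Longrightarrow> measure m (tr b B \<inter> B) \<ge> 15/16 * measure m B"
  obtains H where "subgroup H G" "openin T H"
    "\<And>h. h \<in> H \<Longrightarrow> \<exists>b\<in>D. h \<otimes> b \<in> D"
proof -
  define H where "H = {g \<in> carrier G. measure m (tr g B \<inter> B) > measure m B / 2}"
  have BG: "B \<subseteq> carrier G" using sets.sets_into_space[OF B(1)] by simp
  have ex: "\<exists>b\<in>D. h \<otimes> b \<in> D" if h: "h \<in> H" for h
  proof (rule ccontr)
    assume no: "\<not> ?thesis"
    have hG: "h \<in> carrier G" using h by (simp add: H_def)
    \<comment> \<open>If no such \<open>b\<close> exists, the overlap is covered by
      \<open>B - D\<close> and a translate of it, together at most a quarter of the measure of
      \<open>B\<close>.\<close>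
    have "tr h B \<inter> B \<subseteq> tr h (B - D) \<union> (B - D)" using no by (auto simp: tr_def)
    then have "measure m (tr h B \<inter> B) \<le> measure m (tr h (B - D) \<union> (B - D))"
      using B D hG by (intro finite_measure_mono) auto
    also have "\<dots> \<le> measure m (tr h (B - D)) + measure m (B - D)"
      using B D hG by (intro measure_Un_le) auto
    also have "\<dots> = measure m (B - D) + measure m (B - D)"
      using B D hG by (subst measure_tr) auto
    finally show False using h D(3) B(2) by (simp add: H_def)
  qed
  have ge: "measure m (tr h B \<inter> B) \<ge> 7/8 * measure m B" if h: "h \<in> H" for h
  proof -
    obtain b where b: "b \<in> D" "h \<otimes> b \<in> D" using ex[OF h] by auto
    have G: "h \<in> carrier G" "b \<in> carrier G" "h \<otimes> b \<in> carrier G"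
      using h b D(2) BG by (auto simp: H_def)
    \<comment> \<open>Translating by \<open>b\<close> turns the overlap for \<open>h\<close> into
      that of (h b)^-1 B with b^-1 B, and both sets nearly fill \<open>B\<close>.\<close>
    have "measure m (tr h B \<inter> B) = measure m (tr b (tr h B \<inter> B))"
      using G B by (subst measure_tr) auto
    also have "tr b (tr h B \<inter> B) = tr (h \<otimes> b) B \<inter> tr b B" using G by (simp add: tr_Int tr_tr)
    also have "measure m \<dots> \<ge> measure m ((tr (h \<otimes> b) B \<inter> B) \<inter> (tr b B \<inter> B))"
      using G B by (intro finite_measure_mono) auto
    also have "measure m ((tr (h \<otimes> b) B \<inter> B) \<inter> (tr b B \<inter> B))
        \<ge> measure m (tr (h \<otimes> b) B \<inter> B) + measure m (tr b B \<inter> B) - measure m B"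
      using G B by (intro measure_Int_ge) auto
    finally show ?thesis using stable[OF b(1)] stable[OF b(2)] by simp
  qed
  have "subgroup H G"
  proof
    show "H \<subseteq> carrier G" by (auto simp: H_def)
    show "\<one> \<in> H" using B BG by (simp add: H_def tr_one)
  next
    fix g h assume gh: "g \<in> H" "h \<in> H"
    then have G: "g \<in> carrier G" "h \<in> carrier G" by (auto simp: H_def)
    have "measure m ((tr h B \<inter> B) \<inter> tr h (tr g B \<inter> B))
        \<ge> measure m (tr h B \<inter> B) + measure m (tr h (tr g B \<inter> B)) - measure m (tr h B)"
      using G B by (intro measure_Int_ge tr_sets sets.Int) (auto simp: tr_def)
    moreover have "measure m (tr h (tr g B \<inter> B)) = measure m (tr g B \<inter> B)"
      "measure m (tr h B) = measure m B"
      using G B by (auto simp: measure_tr)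
    moreover have "measure m ((tr h B \<inter> B) \<inter> tr h (tr g B \<inter> B)) \<le> measure m (tr (g \<otimes> h) B \<inter> B)"
      using G B by (intro finite_measure_mono) (auto simp: tr_Int tr_tr)
    ultimately have "measure m (tr (g \<otimes> h) B \<inter> B) \<ge> 3/4 * measure m B"
      using ge[OF gh(1)] ge[OF gh(2)] by simp
    then show "g \<otimes> h \<in> H" using G B by (simp add: H_def)
  next
    fix g assume g: "g \<in> H"
    then have G: "g \<in> carrier G" by (auto simp: H_def)
    have "measure m (tr (inv g) B \<inter> B) = measure m (tr g (tr (inv g) B \<inter> B))"
      using G B by (subst measure_tr) auto
    also have "tr g (tr (inv g) B \<inter> B) = tr g B \<inter> B"
      using G BG by (auto simp: tr_Int tr_tr tr_one)
    finally show "inv g \<in> H" using g G by (simp add: H_def)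
  qed
  moreover obtain V where V: "openin T V" "\<one> \<in> V"
      "\<And>v. v \<in> V \<Longrightarrow> measure m (tr v B \<inter> B) > measure m B / 2"
    using steinhaus[OF B] by metis
  then have "V \<subseteq> H" using openin_subset by (fastforce simp: H_def)
  ultimately show ?thesis using that openin_subgroup V ex by metis
qed

text \<open>The intersection of all conjugates of \<open>H\<close>. It is open by compactness: the
  tube lemma, applied to conjugation along the whole group, finds one neighbourhood of the identity
  all of whose conjugates stay in \<open>H\<close>.\<close>

lemma openin_normal_core:
  assumes H: "subgroup H G" "openin T H"
  obtains N where "N \<lhd> G" "openin T N" "N \<subseteq> H"
proof -
  define N where "N = {x \<in> carrier G. \<forall>g\<in>carrier G. inv g \<otimes> x \<otimes> g \<in> H}"
  let ?W = "{z \<in> carrier G \<times> carrier G. inv (fst z) \<otimes> snd z \<otimes> fst z \<in> H}"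
  have "continuous_map (prod_topology T T) T (\<lambda>z. inv (fst z) \<otimes> snd z \<otimes> fst z)"
    by (intro continuous_map_mult continuous_map_inv continuous_map_fst continuous_map_snd)
  from openin_continuous_map_preimage[OF this H(2)]
  have "openin (prod_topology T T) ?W" by simp
  moreover have "compactin T (carrier G)" using compact by (simp add: compact_space_def)
  moreover have "carrier G \<times> {\<one>} \<subseteq> ?W" using subgroup.one_closed[OF H(1)] by auto
  ultimately obtain U V where V: "openin T V" "carrier G \<subseteq> U" "\<one> \<in> V" "U \<times> V \<subseteq> ?W"
    using tube_lemma_left[of T T ?W "carrier G" \<one>] by auto
  have "carrier G \<times> V \<subseteq> ?W" using V(2,4) by (meson Sigma_mono order_refl subset_trans)
  then have VN: "V \<subseteq> N" using openin_subset[OF V(1)] by (auto simp: N_def)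
  have sub: "subgroup N G"
  proof
    show "N \<subseteq> carrier G" by (auto simp: N_def)
    show "\<one> \<in> N" using subgroup.one_closed[OF H(1)] by (auto simp: N_def)
  next
    fix x y assume xy: "x \<in> N" "y \<in> N"
    have "inv g \<otimes> (x \<otimes> y) \<otimes> g \<in> H" if g: "g \<in> carrier G" for g
    proof -
      have "(inv g \<otimes> x \<otimes> g) \<otimes> (inv g \<otimes> y \<otimes> g) \<in> H"
        using xy g by (simp add: N_def subgroup.m_closed[OF H(1)])
      moreover have "(inv g \<otimes> x \<otimes> g) \<otimes> (inv g \<otimes> y \<otimes> g) = inv g \<otimes> (x \<otimes> y) \<otimes> g"
      proof -
        have "g \<otimes> (inv g \<otimes> z) = z" if "z \<in> carrier G" for z
          using g that by (simp add: m_assoc[symmetric])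
        then show ?thesis using xy g by (simp add: N_def m_assoc)
      qed
      ultimately show ?thesis by simp
    qed
    then show "x \<otimes> y \<in> N" using xy by (simp add: N_def)
  next
    fix x assume x: "x \<in> N"
    have "inv g \<otimes> inv x \<otimes> g \<in> H" if g: "g \<in> carrier G" for g
    proof -
      have "inv (inv g \<otimes> x \<otimes> g) \<in> H"
        using x g by (simp add: N_def subgroup.m_inv_closed[OF H(1)])
      then show ?thesis using x g by (simp add: N_def inv_mult_group m_assoc)
    qed
    then show "inv x \<in> N" using x by (simp add: N_def)
  qed
  moreover have "N \<lhd> G"
    unfolding normal_inv_iff
  proof (intro conjI ballI sub)
    fix x h assume xh: "x \<in> carrier G" "h \<in> N"
    have "inv g \<otimes> (x \<otimes> h \<otimes> inv x) \<otimes> g \<in> H" if g: "g \<in> carrier G" for g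
    proof -
      have "inv (inv x \<otimes> g) \<otimes> h \<otimes> (inv x \<otimes> g) \<in> H" using xh g by (simp add: N_def)
      then show ?thesis using xh g by (simp add: N_def inv_mult_group m_assoc)
    qed
    then show "x \<otimes> h \<otimes> inv x \<in> N" using xh by (simp add: N_def)
  qed
  moreover have "openin T N" using openin_subgroup[OF sub] V VN by simp
  moreover have "N \<subseteq> H"
  proof
    fix x assume "x \<in> N"
    then have "inv \<one> \<otimes> x \<otimes> \<one> \<in> H" "x \<in> carrier G" by (auto simp only: N_def mem_Collect_eq one_closed)
    then show "x \<in> H" by simp
  qed
  ultimately show ?thesis using that by simp
qed

section \<open>Finite quotients and their inverse limit\<close>

definition coset_code :: "'a set \<Rightarrow> 'a \<Rightarrow> nat"
  where "coset_code N x = to_nat_on (rcosets N) (N #> x)"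

lemma openin_r_coset:
  assumes N: "subgroup N G" "openin T N" and x: "x \<in> carrier G"
  shows "openin T (N #> x)"
proof -
  have "continuous_map T T (\<lambda>y. y \<otimes> inv x)"
    using x by (intro continuous_map_mult) auto
  from openin_continuous_map_preimage[OF this N(2)]
  have "openin T {y \<in> carrier G. y \<otimes> inv x \<in> N}" by simp
  moreover have "N #> x = {y \<in> carrier G. y \<otimes> inv x \<in> N}"
  proof (intro subset_antisym subsetI)
    fix y assume "y \<in> N #> x"
    then obtain n where n: "n \<in> N" "y = n \<otimes> x" by (auto simp: r_coset_def)
    then show "y \<in> {y \<in> carrier G. y \<otimes> inv x \<in> N}"
      using x subgroup.mem_carrier[OF N(1) n(1)] by (simp add: m_assoc)
  next
    fix y assume y: "y \<in> {y \<in> carrier G. y \<otimes> inv x \<in> N}"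
    then have "y = (y \<otimes> inv x) \<otimes> x" using x by (simp add: m_assoc)
    then show "y \<in> N #> x" using y unfolding r_coset_def by auto
  qed
  ultimately show ?thesis by simp
qed

lemma openin_coset_code_preimage:
  assumes N: "subgroup N G" "openin T N"
  shows "openin T {x \<in> carrier G. coset_code N x \<in> U}"
proof -
  have "{x \<in> carrier G. coset_code N x \<in> U} = (\<Union>x\<in>{x \<in> carrier G. coset_code N x \<in> U}. N #> x)"
  proof (intro subset_antisym subsetI)
    fix y assume "y \<in> (\<Union>x\<in>{x \<in> carrier G. coset_code N x \<in> U}. N #> x)"
    then obtain x where x: "x \<in> carrier G" "coset_code N x \<in> U" "y \<in> N #> x" by auto
    then have "y \<in> carrier G" using N(1) r_coset_subset_G subgroup.subset by (metis subsetD)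
    moreover have "N #> x = N #> y" using repr_independence x N(1) by simp
    ultimately show "y \<in> {x \<in> carrier G. coset_code N x \<in> U}" using x by (simp add: coset_code_def)
  qed (use rcos_self N(1) in auto)
  moreover have "openin T (\<Union>x\<in>{x \<in> carrier G. coset_code N x \<in> U}. N #> x)"
    using openin_r_coset N by auto
  ultimately show ?thesis by simp
qed

lemma finite_rcosets:
  assumes N: "subgroup N G" "openin T N"
  shows "finite (rcosets N)"
proof -
  have op: "\<forall>U\<in>rcosets N. openin T U" using openin_r_coset[OF N] by (auto simp: RCOSETS_def)
  have un: "\<Union>(rcosets N) = carrier G" by (rule rcosets_part_G[OF N(1)])
  obtain \<F> where \<F>: "finite \<F>" "\<F> \<subseteq> rcosets N" "carrier G \<subseteq> \<Union>\<F>"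
    using compact op un unfolding compact_space_def compactin_def by (metis order_refl topspace_T)
  have "rcosets N \<subseteq> \<F>"
  proof
    fix c assume c: "c \<in> rcosets N"
    then obtain x where x: "x \<in> carrier G" "c = N #> x" by (auto simp: RCOSETS_def)
    then obtain d where d: "d \<in> \<F>" "x \<in> d" using \<F>(3) by auto
    moreover have "x \<in> c" using x rcos_self N by simp
    ultimately have "c = d" using rcos_disjoint[OF N(1)] c \<F>(2) unfolding pairwise_def disjnt_iff by (metis subsetD)
    then show "c \<in> \<F>" using d by simp
  qed
  then show ?thesis using \<F>(1) finite_subset by metis
qed

lemma coset_code_eq_iff:
  assumes N: "subgroup N G" "openin T N" and xy: "x \<in> carrier G" "y \<in> carrier G"
  shows "coset_code N x = coset_code N y \<longleftrightarrow> x \<otimes> inv y \<in> N"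
proof -
  have c: "N #> x \<in> rcosets N" "N #> y \<in> rcosets N"
    using xy N(1) by (auto simp: rcosetsI subgroup.subset)
  have "coset_code N x = coset_code N y \<longleftrightarrow> N #> x = N #> y"
    unfolding coset_code_def
    using c finite_rcosets[OF N] by (simp add: countable_finite)
  also have "\<dots> \<longleftrightarrow> x \<otimes> inv y \<in> N"
    using N(1) xy by (metis coset_join1 coset_join2 coset_mult_inv1 coset_mult_inv2 inv_closed m_closed subgroup.subset)
  finally show ?thesis .
qed

lemma coset_code_eqI:
  assumes "N \<lhd> G" "openin T N" "x \<in> carrier G" "y \<in> carrier G" "x \<otimes> inv y \<in> N"
  shows "coset_code N x = coset_code N y"
  using assms coset_code_eq_iff normal_imp_subgroup by metis

text \<open>Equality of codes is congruence modulo the normal subgroup, which is what allows the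
  group structure to be carried over to the set of codes.\<close>

lemma weak_group_morphism_coset_code:
  assumes "N \<lhd> G" "openin T N"
  shows "weak_group_morphism (coset_code N) N G"
  using assms coset_code_eq_iff[OF normal_imp_subgroup[OF assms(1)] assms(2)]
  by (intro weak_group_morphismsI) auto

text \<open>\<open>image_group\<close> multiplies codes through chosen preimages, here
  \<open>x'\<close> and \<open>y'\<close>; normality makes the product independent of the
  choice.\<close>

lemma coset_code_mult:
  assumes N: "N \<lhd> G" "openin T N" and xy: "x \<in> carrier G" "y \<in> carrier G"
  shows "coset_code N x \<otimes>\<^bsub>image_group (coset_code N) G\<^esub> coset_code N y = coset_code N (x \<otimes> y)"
proof -
  define x' y' where "x' = inv_into (carrier G) (coset_code N) (coset_code N x)"
    and "y' = inv_into (carrier G) (coset_code N) (coset_code N y)"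
  have G: "x' \<in> carrier G" "y' \<in> carrier G"
    using xy by (auto simp: x'_def y'_def intro!: inv_into_into)
  have "coset_code N x' = coset_code N x" "coset_code N y' = coset_code N y"
    using xy by (auto simp: x'_def y'_def intro!: f_inv_into_f)
  then have *: "x' \<otimes> inv x \<in> N" "y' \<otimes> inv y \<in> N"
    using coset_code_eq_iff[OF normal_imp_subgroup[OF N(1)] N(2)] xy G by auto
  have "x \<otimes> (y' \<otimes> inv y) \<otimes> inv x \<in> N"
    using * xy N(1) by (simp add: normal_inv_iff)
  then have "(x' \<otimes> inv x) \<otimes> (x \<otimes> (y' \<otimes> inv y) \<otimes> inv x) \<in> N"
    using * by (simp add: subgroup.m_closed[OF normal_imp_subgroup[OF N(1)]])
  also have "(x' \<otimes> inv x) \<otimes> (x \<otimes> (y' \<otimes> inv y) \<otimes> inv x) = (x' \<otimes> y') \<otimes> inv (x \<otimes> y)"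
  proof -
    have "inv x \<otimes> (x \<otimes> z) = z" if "z \<in> carrier G" for z
      using xy that by (simp add: m_assoc[symmetric])
    then show ?thesis using xy G by (simp add: m_assoc inv_mult_group)
  qed
  finally have "coset_code N (x' \<otimes> y') = coset_code N (x \<otimes> y)"
    using N xy G by (intro coset_code_eqI) auto
  then show ?thesis by (simp add: image_group_def x'_def y'_def)
qed

text \<open>The index set consists of all open normal subgroups; cosets are numbered because the
  finite groups have to be carried by natural numbers. Normal cores of small open subgroups make
  \<open>h\<close> injective. Compactness makes it onto, and also a homeomorphism, as the limit is
  Hausdorff.\<close>

lemma profinite_groupI:
  assumes base: "\<And>U. openin T U \<Longrightarrow> \<one> \<in> U \<Longrightarrow> \<exists>H. subgroup H G \<and> openin T H \<and> H \<subseteq> U"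
  shows "profinite_group G T"
proof -
  define I where "I = {N. N \<lhd> G \<and> openin T N}"
  \<comment> \<open>A smaller subgroup is a larger index: the quotient by \<open>M\<close> maps onto
    the quotient by \<open>N\<close> when \<open>M\<close> lies in \<open>N\<close>.\<close>
  define r where "r = {(N, M). N \<in> I \<and> M \<in> I \<and> M \<subseteq> N}"
  define K where "K N = image_group (coset_code N) G" for N
  \<comment> \<open>The transition map is read off at an arbitrary preimage of the code;
    \<open>f_code\<close> shows that any preimage gives the same value.\<close>
  define f where "f N M c = coset_code N (inv_into (carrier G) (coset_code M) c)" for N M c
  define h where "h x = (\<lambda>N\<in>I. coset_code N x)" for x
  have I: "N \<lhd> G" "openin T N" "subgroup N G" if "N \<in> I" for N
    using that by (auto simp: I_def normal_imp_subgroup)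
  have carrier_K: "carrier (K N) = coset_code N ` carrier G" for N
    by (simp add: K_def image_group_def)
  have mult_K: "coset_code N x \<otimes>\<^bsub>K N\<^esub> coset_code N y = coset_code N (x \<otimes> y)"
    if "N \<in> I" "x \<in> carrier G" "y \<in> carrier G" for N x y
    unfolding K_def using coset_code_mult I that by simp
  have group_K: "group (K N)" if "N \<in> I" for N
    unfolding K_def by (rule image_group_is_group weak_group_morphism_coset_code I that)+
  have fin_K: "finite (carrier (K N))" if "N \<in> I" for N
  proof -
    have "carrier (K N) \<subseteq> to_nat_on (rcosets N) ` (rcosets N)"
      using I(3)[OF that] by (auto simp: carrier_K coset_code_def rcosetsI subgroup.subset)
    then show ?thesis using finite_rcosets[OF I(3,2)] that by (meson finite_imageI finite_subset)
  qed
  have f_code: "f N M (coset_code M x) = coset_code N x" if "(N, M) \<in> r" "x \<in> carrier G" for N M x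
  proof -
    define x' where "x' = inv_into (carrier G) (coset_code M) (coset_code M x)"
    have x': "x' \<in> carrier G" "coset_code M x' = coset_code M x"
      using that by (auto simp: x'_def intro!: inv_into_into f_inv_into_f)
    have NM: "N \<in> I" "M \<in> I" "M \<subseteq> N" using that by (auto simp: r_def)
    have "x' \<otimes> inv x \<in> M"
      using coset_code_eq_iff[OF I(3,2)[OF NM(2)]] x' that by simp
    then have "coset_code N x' = coset_code N x"
      using NM x' that I by (intro coset_code_eqI) auto
    then show ?thesis by (simp add: f_def x'_def)
  qed
  have Int: "N \<inter> M \<in> I" if "N \<in> I" "M \<in> I" for N M
  proof -
    have "subgroup (N \<inter> M) G" using that I by (intro subgroups_Inter_pair) auto
    then show ?thesis using that by (auto simp: I_def normal_inv_iff)
  qed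
  \<comment> \<open>The trivial quotient makes the index set nonempty, and it bounds the empty
    family in the finite intersection argument.\<close>
  have carrier_I: "carrier G \<in> I"
    using normal_inv_iff subgroup_self openin_topspace[of T] by (auto simp: I_def)
  have sys: "finite_inverse_system I r K f"
    unfolding finite_inverse_system_def
  proof (intro conjI ballI)
    show "I \<noteq> {}" using carrier_I by auto
    show "partial_order_on I r"
      by (auto simp: partial_order_on_def preorder_on_def refl_on_def trans_def antisym_def r_def)
    show "\<exists>k\<in>I. (i, k) \<in> r \<and> (j, k) \<in> r" if "i \<in> I" "j \<in> I" for i j
      using Int[OF that] that by (intro bexI[of _ "i \<inter> j"]) (auto simp: r_def)
    show "group (K i)" "finite (carrier (K i))" if "i \<in> I" for i
      using that by (simp_all add: group_K fin_K)
    show "f i i x = x" if "i \<in> I" "x \<in> carrier (K i)" for i x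
      using that by (auto simp: carrier_K f_code r_def)
    show "case p of (i, j) \<Rightarrow> f i j \<in> hom (K j) (K i)" if "p \<in> r" for p
    proof -
      obtain i j where p: "p = (i, j)" by force
      then have ij: "i \<in> I" "j \<in> I" using that by (auto simp: r_def)
      have "f i j \<in> hom (K j) (K i)"
        using that p ij by (auto simp: hom_def carrier_K f_code mult_K)
      then show ?thesis using p by simp
    qed
    show "\<forall>i j k. (i, j) \<in> r \<longrightarrow> (j, k) \<in> r \<longrightarrow> (\<forall>x\<in>carrier (K k). f i j (f j k x) = f i k x)"
    proof (intro allI impI ballI)
      fix i j k x assume *: "(i, j) \<in> r" "(j, k) \<in> r" "x \<in> carrier (K k)"
      then have "(i, k) \<in> r" by (auto simp: r_def)
      then show "f i j (f j k x) = f i k x" using * by (auto simp: carrier_K f_code)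
    qed
  qed
  have mem: "h x \<in> carrier (inverse_limit I r K f)" if "x \<in> carrier G" for x
    using that by (auto simp: inverse_limit_def h_def carrier_K f_code r_def)
  have hom: "h \<in> hom G (inverse_limit I r K f)"
  proof (rule homI)
    show "h x \<in> carrier (inverse_limit I r K f)" if "x \<in> carrier G" for x using mem[OF that] .
    show "h (x \<otimes> y) = h x \<otimes>\<^bsub>inverse_limit I r K f\<^esub> h y" if "x \<in> carrier G" "y \<in> carrier G" for x y
      using that by (auto simp: inverse_limit_def h_def mult_K intro!: restrict_ext)
  qed
  have inj: "inj_on h (carrier G)"
  proof
    fix x y assume xy: "x \<in> carrier G" "y \<in> carrier G" "h x = h y"
    define z where "z = x \<otimes> inv y"
    have z: "z \<in> carrier G" using xy by (simp add: z_def)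
    have zN: "z \<in> N" if "N \<in> I" for N
    proof -
      have "coset_code N x = coset_code N y" using fun_cong[OF xy(3), of N] that by (simp add: h_def)
      then show ?thesis using coset_code_eq_iff[OF I(3,2)[OF that]] xy by (simp add: z_def)
    qed
    have "z = \<one>"
    proof (rule ccontr)
      assume "z \<noteq> \<one>"
      then obtain U V where UV: "openin T U" "openin T V" "\<one> \<in> U" "z \<in> V" "disjnt U V"
        using Hausdorff z unfolding Hausdorff_space_def by (metis one_closed topspace_T)
      obtain L where L: "subgroup L G" "openin T L" "L \<subseteq> U" using base UV by metis
      obtain N where "N \<lhd> G" "openin T N" "N \<subseteq> L" using openin_normal_core[OF L(1,2)] by metis
      then have "z \<in> U" using zN[of N] L by (auto simp: I_def)
      then show False using UV by (auto simp: disjnt_iff)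
    qed
    then show "x = y" using xy by (metis inv_equality inv_inv z_def inv_closed)
  qed
  have surj: "h ` carrier G = carrier (inverse_limit I r K f)"
  proof (intro subset_antisym subsetI)
    fix z assume z: "z \<in> carrier (inverse_limit I r K f)"
    then have zE: "z \<in> (\<Pi>\<^sub>E i\<in>I. carrier (K i))" and zr: "\<And>i j. (i, j) \<in> r \<Longrightarrow> f i j (z j) = z i"
      by (auto simp: inverse_limit_def)
    \<comment> \<open>The coset prescribed by the coordinate \<open>N\<close> of \<open>z\<close>.
      Compatibility of the coordinates makes these closed sets decrease along the directed index
      set, so compactness yields a common point.\<close>
    define F where "F N = {x \<in> carrier G. coset_code N x = z N}" for N
    have ne: "\<exists>x\<in>carrier G. z N = coset_code N x" if "N \<in> I" for N
      using PiE_mem[OF zE that] by (auto simp: carrier_K)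
    have closed: "closedin T (F N)" if N: "N \<in> I" for N
    proof -
      have "openin T {x \<in> carrier G. coset_code N x \<in> - {z N}}"
        by (rule openin_coset_code_preimage[OF I(3)[OF N] I(2)[OF N]])
      moreover have "{x \<in> carrier G. coset_code N x \<in> - {z N}} = carrier G - F N" by (auto simp: F_def)
      ultimately have "openin T (carrier G - F N)" by simp
      then show ?thesis by (auto simp: closedin_def F_def)
    qed
    have mono: "F M \<subseteq> F N" if "(N, M) \<in> r" for N M
    proof
      fix x assume "x \<in> F M"
      then have x: "x \<in> carrier G" "coset_code M x = z M" by (auto simp: F_def)
      then show "x \<in> F N" using zr[OF that] f_code[OF that x(1)] by (simp add: F_def)
    qed
    have fip: "\<Inter>\<F> \<noteq> {}" if \<F>: "finite \<F>" "\<F> \<subseteq> F ` I" for \<F>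
    proof -
      obtain J where J: "finite J" "J \<subseteq> I" "\<F> = F ` J"
        using finite_subset_image[OF \<F>] by metis
      have "\<exists>M\<in>I. \<forall>N\<in>J. (N, M) \<in> r" using J(1,2)
      proof (induction J rule: finite_induct)
        case empty then show ?case using carrier_I by auto
      next
        case (insert N J)
        then obtain M where M: "M \<in> I" "\<forall>N\<in>J. (N, M) \<in> r" by auto
        have "N \<in> I" using insert by simp
        then show ?case using M Int[of N M] by (intro bexI[of _ "N \<inter> M"]) (auto simp: r_def)
      qed
      then obtain M where M: "M \<in> I" "\<And>N. N \<in> J \<Longrightarrow> (N, M) \<in> r" by auto
      obtain x where "x \<in> F M" using ne[OF M(1)] by (auto simp: F_def)
      then have "x \<in> \<Inter>\<F>" using mono M(2) J(3) by auto
      then show ?thesis by auto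
    qed
    have "\<Inter>(F ` I) \<noteq> {}"
      using compact[unfolded compact_space_fip, rule_format, of "F ` I"] closed fip by auto
    then obtain x where x: "\<And>N. N \<in> I \<Longrightarrow> x \<in> F N" by auto
    have xG: "x \<in> carrier G" using x[OF carrier_I] by (simp add: F_def)
    have "h x = z"
    proof
      fix N show "h x N = z N"
        using x[of N] PiE_arb[OF zE, of N] by (cases "N \<in> I") (auto simp: h_def F_def)
    qed
    then show "z \<in> h ` carrier G" using xG by auto
  qed (use mem in auto)
  let ?P = "product_topology (\<lambda>i. discrete_topology (carrier (K i))) I"
  have cont: "continuous_map T (inverse_limit_topology I r K f) h"
    unfolding inverse_limit_topology_def
  proof (intro continuous_map_into_subtopology)
    show "h \<in> topspace T \<rightarrow> carrier (inverse_limit I r K f)" using mem by auto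
    show "continuous_map T ?P h"
      unfolding continuous_map_componentwise
    proof (intro conjI ballI)
      show "h ` topspace T \<subseteq> extensional I" by (auto simp: h_def)
      fix N assume N: "N \<in> I"
      have "continuous_map T (discrete_topology (carrier (K N))) (coset_code N)"
        unfolding continuous_map_def
      proof (intro conjI allI impI)
        show "coset_code N \<in> topspace T \<rightarrow> topspace (discrete_topology (carrier (K N)))"
          by (auto simp: carrier_K)
        fix U :: "nat set"
        show "openin T {x \<in> topspace T. coset_code N x \<in> U}"
          using openin_coset_code_preimage[OF I(3)[OF N] I(2)[OF N]] by simp
      qed
      then show "continuous_map T (discrete_topology (carrier (K N))) (\<lambda>x. h x N)"
        using N by (simp add: h_def)
    qed
  qed
  have "homeomorphic_map T (inverse_limit_topology I r K f) h"
  proof (rule continuous_imp_homeomorphic_map[OF cont compact])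
    show "Hausdorff_space (inverse_limit_topology I r K f)"
      unfolding inverse_limit_topology_def
      by (intro Hausdorff_space_subtopology) (simp add: Hausdorff_space_product_topology)
    have "carrier (inverse_limit I r K f) \<subseteq> topspace ?P"
      by (auto simp: inverse_limit_def)
    then show "h ` topspace T = topspace (inverse_limit_topology I r K f)"
      using surj by (auto simp: inverse_limit_topology_def)
    show "inj_on h (topspace T)" using inj by simp
  qed
  moreover have "h \<in> iso G (inverse_limit I r K f)"
    using hom inj surj by (simp add: iso_def bij_betw_def)
  ultimately show ?thesis
    unfolding profinite_group_def using topological_group sys by blast
qed

section \<open>Countable fibres\<close>

text \<open>The measurable unions of fibres of the joint label map. They stand in for the
  \<sigma>-algebra of the target, so conditioning on fibres is expressed inside the group, by hulls
  instead of a disintegration.\<close>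

definition saturated :: "(nat \<Rightarrow> 'a \<Rightarrow> nat) \<Rightarrow> 'a set set"
  where "saturated p = {E \<in> sets m. \<forall>x\<in>E. \<forall>y\<in>carrier G. (\<forall>n. p n y = p n x) \<longrightarrow> y \<in> E}"

lemma saturated_sets: "E \<in> saturated p \<Longrightarrow> E \<in> sets m"
  by (simp add: saturated_def)

lemma saturated_carrier: "carrier G \<in> saturated p"
  using sets.top[of m] by (simp add: saturated_def)

lemma saturated_Diff:
  assumes "E \<in> saturated p" "F \<in> saturated p"
  shows "E - F \<in> saturated p"
  unfolding saturated_def
proof (intro CollectI conjI ballI impI)
  show "E - F \<in> sets m" using assms by (intro sets.Diff saturated_sets)
  fix x y assume x: "x \<in> E - F" and y: "y \<in> carrier G" "\<forall>n. p n y = p n x"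
  have xG: "x \<in> carrier G" using x sets.sets_into_space[OF saturated_sets[OF assms(1)]] by auto
  have "\<forall>x\<in>E. \<forall>y\<in>carrier G. (\<forall>n. p n y = p n x) \<longrightarrow> y \<in> E"
    using assms(1) by (simp add: saturated_def)
  then have "y \<in> E" using x y by (metis DiffD1)
  moreover have "y \<notin> F"
  proof
    assume "y \<in> F"
    then have "x \<in> F" using assms(2) xG y by (simp add: saturated_def)
    then show False using x by simp
  qed
  ultimately show "y \<in> E - F" by simp
qed

lemma saturated_Int: "E \<in> saturated p \<Longrightarrow> F \<in> saturated p \<Longrightarrow> E \<inter> F \<in> saturated p"
  using saturated_Diff[of E p "E - F"] saturated_Diff[of E p F] by (simp add: Diff_Diff_Int)

lemma saturated_UN:
  assumes "\<And>i. i \<in> I \<Longrightarrow> E i \<in> saturated p" "countable I"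
  shows "(\<Union>i\<in>I. E i) \<in> saturated p"
  unfolding saturated_def
proof (intro CollectI conjI ballI impI)
  show "(\<Union>i\<in>I. E i) \<in> sets m"
    using assms by (intro sets.countable_UN') (auto simp: saturated_def)
  fix x y assume "x \<in> (\<Union>i\<in>I. E i)" and y: "y \<in> carrier G" "\<forall>n. p n y = p n x"
  then obtain i where i: "i \<in> I" "x \<in> E i" by auto
  then have "y \<in> E i" using assms(1)[OF i(1)] y by (simp add: saturated_def)
  then show "y \<in> (\<Union>i\<in>I. E i)" using i by auto
qed

lemma saturated_fiber:
  assumes "\<And>n. p n \<in> measurable m (count_space UNIV)"
  shows "{x \<in> carrier G. p n x = i} \<in> saturated p"
proof -
  have "{x \<in> carrier G. p n x = i} \<in> sets m" by (rule nat_pred_sets[OF assms])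
  then show ?thesis by (simp add: saturated_def)
qed

text \<open>Modulo null sets, \<open>H\<close> is where the conditional probability of
  \<open>A\<close> given the saturated sets is positive. It is an intersection of saturated sets
  that contain \<open>A\<close> up to null sets and whose measures tend to the infimum.\<close>

lemma saturated_hull:
  assumes A: "A \<in> sets m"
  obtains H where "H \<in> saturated p" "measure m (A - H) = 0"
    "\<And>E. E \<in> saturated p \<Longrightarrow> measure m (A \<inter> E) = 0 \<Longrightarrow> measure m (H \<inter> E) = 0"
proof -
  define X where "X = {measure m E |E. E \<in> saturated p \<and> measure m (A - E) = 0}"
  have "A - carrier G = {}" using sets.sets_into_space[OF A] by auto
  then have "measure m (A - carrier G) = 0" by (simp only: measure_empty)
  then have "measure m (carrier G) \<in> X"
    unfolding X_def using saturated_carrier by (intro CollectI exI[of _ "carrier G"]) simp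
  then have ne: "X \<noteq> {}" by auto
  have bdd: "bdd_below X" by (rule bdd_belowI[of _ 0]) (auto simp: X_def)
  have "\<exists>E. E \<in> saturated p \<and> measure m (A - E) = 0 \<and> measure m E < Inf X + 1 / (real n + 1)" for n
    using cInf_lessD[OF ne, of "Inf X + 1 / (real n + 1)"] by (auto simp: X_def)
  then have "\<forall>n. \<exists>E. E \<in> saturated p \<and> measure m (A - E) = 0 \<and> measure m E < Inf X + 1 / (real n + 1)"
    by simp
  from choice[OF this] obtain E where E: "\<And>n. E n \<in> saturated p" "\<And>n. measure m (A - E n) = 0"
    "\<And>n. measure m (E n) < Inf X + 1 / (real n + 1)" by auto
  define H where "H = carrier G - (\<Union>n\<in>UNIV. carrier G - E n)"
  have H: "H \<in> saturated p"
    unfolding H_def by (intro saturated_Diff saturated_UN saturated_carrier E) simp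
  have sub: "H \<subseteq> E n" for n by (auto simp: H_def)
  have null: "measure m (A - F) = 0 \<longleftrightarrow> A - F \<in> null_sets m" if "F \<in> saturated p" for F
    using A saturated_sets[OF that] by (simp add: null_sets_def emeasure_eq_measure)
  have "A - H = (\<Union>n. A - E n)" using sets.sets_into_space[OF A] by (auto simp: H_def)
  moreover have "(\<Union>n. A - E n) \<in> null_sets m" using E null by (intro null_sets_UN) auto
  ultimately have AH: "A - H \<in> null_sets m" by simp
  have le: "measure m H \<le> Inf X"
  proof (rule LIMSEQ_le_const)
    have "(\<lambda>n. Inf X + 1 / (real n + 1)) \<longlonglongrightarrow> Inf X + 0"
      using LIMSEQ_inverse_real_of_nat by (intro tendsto_add tendsto_const) (simp add: inverse_eq_divide add.commute)
    then show "(\<lambda>n. Inf X + 1 / (real n + 1)) \<longlonglongrightarrow> Inf X" by simp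
    have "measure m H \<le> Inf X + 1 / (real n + 1)" for n
      using finite_measure_mono[OF sub[of n] saturated_sets[OF E(1)]] E(3)[of n] by simp
    then show "\<exists>N. \<forall>n\<ge>N. measure m H \<le> Inf X + 1 / (real n + 1)" by simp
  qed
  have "measure m (H \<inter> F) = 0" if F: "F \<in> saturated p" "measure m (A \<inter> F) = 0" for F
  proof -
    \<comment> \<open>If \<open>H\<close> had mass in \<open>F\<close>, the smaller set
      \<open>H - F\<close> would still contain \<open>A\<close> up to a null set and would beat the
      infimum.\<close>
    have HF: "H - F \<in> saturated p" using H F by (simp add: saturated_Diff)
    have s: "A \<inter> F \<in> sets m" using A saturated_sets[OF F(1)] by simp
    have "A \<inter> F \<in> null_sets m" using s F(2) by (simp add: null_sets_def emeasure_eq_measure)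
    then have "(A - H) \<union> (A \<inter> F) \<in> null_sets m" using AH by (intro null_sets.Un)
    moreover have "A - (H - F) = (A - H) \<union> (A \<inter> F)" by auto
    ultimately have "measure m (A - (H - F)) = 0" using null[OF HF] by simp
    then have "Inf X \<le> measure m (H - F)" using HF bdd by (intro cInf_lower) (auto simp: X_def)
    also have "measure m (H - F) = measure m H - measure m (H \<inter> F)"
      using saturated_sets[OF H] saturated_sets[OF F(1)] by (rule finite_measure_Diff')
    finally show ?thesis using le measure_nonneg[of m "H \<inter> F"] by linarith
  qed
  then show ?thesis using that[OF H] AH null[OF H] by simp
qed

lemma AE_not_in_measure_zero: "A \<in> sets m \<Longrightarrow> measure m A = 0 \<Longrightarrow> AE x in m. x \<notin> A"
  by (rule AE_not_in) (simp add: null_sets_def emeasure_eq_measure)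

lemma ex_point_AE:
  assumes "AE x in m. P x" "A \<in> sets m" "measure m A > 0"
  shows "\<exists>x\<in>A. P x"
proof (rule ccontr)
  assume *: "\<not> ?thesis"
  have "AE x in m. x \<notin> A" using assms(1) by eventually_elim (use * in auto)
  then have "measure m A = 0"
    using AE_iff_null_sets[OF assms(2)] by (intro measure_eq_0_null_sets) simp
  then show False using assms(3) by simp
qed

text \<open>Here \<open>supp x\<close> plays the role of the support of the conditional measure on the fibre of \<open>x\<close>.
  If no set of positive measure meets the fibres in single points, these supports have no isolated
  points, so that almost every fibre contains a perfect set.\<close>

lemma injective_on_positive_part:
  fixes p :: "nat \<Rightarrow> 'a \<Rightarrow> nat"
  assumes D: "D \<in> sets m" "measure m D > 0"
    and p: "\<And>n. p n \<in> measurable m (count_space UNIV)"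
    and countable_fibers: "\<And>x. x \<in> D \<Longrightarrow> countable {y \<in> D. \<forall>n. p n y = p n x}"
  obtains B where "B \<in> sets m" "B \<subseteq> D" "measure m B > 0" "inj_on (\<lambda>x n. p n x) B"
proof -
  \<comment> \<open>On \<open>K\<close> all labels are locally constant, so limits taken inside
    \<open>K\<close> do not leave a fibre.\<close>
  obtain K where K: "closedin T K" "K \<subseteq> D" "measure m (D - K) < measure m D"
    "\<And>n i. \<exists>U. openin T U \<and> U \<inter> K = {x \<in> K. p n x = i}"
    by (rule lusin_nat[OF D(1) p D(2)]) (rule that)
  have Ks [measurable]: "K \<in> sets m" using K(1) by (rule closedin_sets)
  have mK: "measure m K > 0" using finite_measure_Diff[OF D(1) Ks K(2)] K(3) by simp
  obtain \<O> \<K> :: "nat \<Rightarrow> 'a set" where \<O>: "\<And>i. openin T (\<O> i)" "\<And>i. closedin T (\<K> i)"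
    "\<And>i. \<O> i \<subseteq> \<K> i" "\<And>x U. openin T U \<Longrightarrow> x \<in> U \<Longrightarrow> \<exists>i. x \<in> \<O> i \<and> \<K> i \<subseteq> U"
    by (rule countable_base, rule that) assumption+
  have basic: "\<exists>i. x \<in> \<O> i \<and> \<O> i \<subseteq> U" if U: "openin T U" "x \<in> U" for x U
  proof -
    obtain i where "x \<in> \<O> i" "\<K> i \<subseteq> U" using \<O>(4)[OF U] by auto
    then show ?thesis using \<O>(3)[of i] by (intro exI[of _ i]) auto
  qed
  define A where "A i = \<O> i \<inter> K" for i
  have A: "A i \<in> sets m" for i unfolding A_def using openin_sets[OF \<O>(1)] Ks by simp
  have "\<forall>i. \<exists>H. H \<in> saturated p \<and> measure m (A i - H) = 0 \<and>
      (\<forall>E. E \<in> saturated p \<longrightarrow> measure m (A i \<inter> E) = 0 \<longrightarrow> measure m (H \<inter> E) = 0)"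
  proof
    fix i show "\<exists>H. H \<in> saturated p \<and> measure m (A i - H) = 0 \<and>
      (\<forall>E. E \<in> saturated p \<longrightarrow> measure m (A i \<inter> E) = 0 \<longrightarrow> measure m (H \<inter> E) = 0)"
      by (rule saturated_hull[OF A[of i], of p], rule exI) auto
  qed
  \<comment> \<open>Read \<open>x \<in> H i\<close> as: the fibre of \<open>x\<close> charges the
    basic set \<open>A i\<close>.\<close>
  from choice[OF this] obtain H where H: "\<And>i. H i \<in> saturated p" "\<And>i. measure m (A i - H i) = 0"
    "\<And>i E. E \<in> saturated p \<Longrightarrow> measure m (A i \<inter> E) = 0 \<Longrightarrow> measure m (H i \<inter> E) = 0" by auto
  have Hs: "H i \<in> sets m" for i using H(1) by (rule saturated_sets)
  have HG: "H i \<subseteq> carrier G" for i using sets.sets_into_space[OF Hs] by simp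
  have H_iff: "x \<in> H i \<longleftrightarrow> y \<in> H i" if "x \<in> carrier G" "y \<in> carrier G" "\<And>n. p n x = p n y" for x y i
    using H(1)[of i] that by (auto simp: saturated_def)
  have AE_H: "AE x in m. \<forall>i. x \<in> A i \<longrightarrow> x \<in> H i"
    unfolding AE_all_countable
  proof
    fix i have "AE x in m. x \<notin> A i - H i" using A Hs H(2) by (intro AE_not_in_measure_zero) auto
    then show "AE x in m. x \<in> A i \<longrightarrow> x \<in> H i" by eventually_elim auto
  qed
  have hull_le: "AE x in m. x \<in> H i \<longrightarrow> x \<in> E" if E: "E \<in> saturated p" and AE: "AE x in m. x \<in> A i \<longrightarrow> x \<in> E" for i E
  proof -
    have s: "carrier G - E \<in> saturated p" by (intro saturated_Diff saturated_carrier E)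
    have "AE x in m. x \<notin> A i \<inter> (carrier G - E)" using AE by eventually_elim auto
    then have "measure m (A i \<inter> (carrier G - E)) = 0"
      using A saturated_sets[OF s] by (intro measure_eq_0_null_sets) (subst AE_iff_null_sets, auto)
    then have "measure m (H i \<inter> (carrier G - E)) = 0" using H(3) s by simp
    then have "AE x in m. x \<notin> H i \<inter> (carrier G - E)"
      using Hs saturated_sets[OF s] by (intro AE_not_in_measure_zero) auto
    then show ?thesis by eventually_elim (use HG in auto)
  qed
  have AE_cover: "AE x in m. x \<in> H l \<longrightarrow> (\<exists>j\<in>J. x \<in> H j)" if cov: "A l \<subseteq> (\<Union>j\<in>J. A j)" for l and J :: "nat set"
  proof -
    have "(\<Union>j\<in>J. H j) \<in> saturated p" by (intro saturated_UN H) simp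
    moreover have "AE x in m. x \<in> A l \<longrightarrow> x \<in> (\<Union>j\<in>J. H j)"
      using AE_H
    proof eventually_elim
      case (elim x)
      show ?case
      proof
        assume "x \<in> A l"
        then obtain j where "j \<in> J" "x \<in> A j" using cov by auto
        then show "x \<in> (\<Union>j\<in>J. H j)" using elim by auto
      qed
    qed
    ultimately have "AE x in m. x \<in> H l \<longrightarrow> x \<in> (\<Union>j\<in>J. H j)" by (rule hull_le)
    then show ?thesis by eventually_elim auto
  qed
  \<comment> \<open>There are only countably many finite \<open>J\<close>, so a single null set
    serves all finite covers.\<close>
  have AE_fin: "AE x in m. \<forall>l. \<forall>J\<in>{J. finite J \<and> A l \<subseteq> (\<Union>j\<in>J. A j)}. x \<in> H l \<longrightarrow> (\<exists>j\<in>J. x \<in> H j)"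
    unfolding AE_all_countable
  proof
    fix l
    have "countable {J :: nat set. finite J \<and> A l \<subseteq> (\<Union>j\<in>J. A j)}"
      by (rule countable_subset[OF _ countable_Collect_finite]) auto
    then show "AE x in m. \<forall>J\<in>{J. finite J \<and> A l \<subseteq> (\<Union>j\<in>J. A j)}. x \<in> H l \<longrightarrow> (\<exists>j\<in>J. x \<in> H j)"
      by (subst AE_ball_countable) (use AE_cover in auto)
  qed
  \<comment> \<open>A charged basic set contains the closed companion of another charged one; this
    provides the compact set used in \<open>meets\<close>.\<close>
  have AE_shrink: "AE x in m. \<forall>j. x \<in> H j \<longrightarrow> (\<exists>l\<in>{l. \<K> l \<subseteq> \<O> j}. x \<in> H l)"
    unfolding AE_all_countable
  proof (rule allI, rule AE_cover)
    fix j show "A j \<subseteq> (\<Union>l\<in>{l. \<K> l \<subseteq> \<O> j}. A l)"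
    proof
      fix x assume x: "x \<in> A j"
      then obtain l where "x \<in> \<O> l" "\<K> l \<subseteq> \<O> j" using \<O>(4)[OF \<O>(1)[of j], of x] by (auto simp: A_def)
      then show "x \<in> (\<Union>l\<in>{l. \<K> l \<subseteq> \<O> j}. A l)" using x by (auto simp: A_def)
    qed
  qed
  have AE_fiber: "AE x in m. \<forall>i n j. A i \<subseteq> {x \<in> carrier G. p n x = j} \<longrightarrow> x \<in> H i \<longrightarrow> p n x = j"
    unfolding AE_all_countable
  proof (intro allI)
    fix i n j
    show "AE x in m. A i \<subseteq> {x \<in> carrier G. p n x = j} \<longrightarrow> x \<in> H i \<longrightarrow> p n x = j"
    proof (cases "A i \<subseteq> {x \<in> carrier G. p n x = j}")
      case True
      have "AE x in m. x \<in> H i \<longrightarrow> x \<in> {x \<in> carrier G. p n x = j}"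
        by (rule hull_le[OF saturated_fiber[OF p]]) (use True in auto)
      then show ?thesis by eventually_elim auto
    qed auto
  qed
  define supp where "supp x = {z \<in> K. \<forall>i. z \<in> \<O> i \<longrightarrow> x \<in> H i}" for x
  \<comment> \<open>The fibres that charge \<open>\<O> i\<close> but no two disjoint basic sets
    inside it, hence with at most one point of support there.\<close>
  define E where "E i = H i - (\<Union>(j, k)\<in>{(j, k). \<O> j \<subseteq> \<O> i \<and> \<O> k \<subseteq> \<O> i \<and> \<O> j \<inter> \<O> k = {}}. H j \<inter> H k)" for i
  have E: "E i \<in> saturated p" for i
    unfolding E_def by (intro saturated_Diff saturated_UN H) (auto intro: saturated_Int H)
  \<comment> \<open>The points of \<open>K\<close> lying in their own support; by
    \<open>AE_H\<close> these are almost all of \<open>K\<close>.\<close>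
  define Z where "Z = K - (\<Union>i. \<O> i - H i)"
  have Z: "Z \<in> sets m" unfolding Z_def using Ks Hs openin_sets[OF \<O>(1)] by auto
  have Z_supp: "z \<in> supp z" if "z \<in> Z" for z using that by (auto simp: Z_def supp_def)
  define B where "B i = A i \<inter> E i \<inter> Z" for i
  have B: "B i \<in> sets m" for i unfolding B_def using A saturated_sets[OF E] Z by simp
  have B_sub: "B i \<subseteq> D" for i using K(2) by (auto simp: B_def A_def)
  have inj: "x = y" if xy: "x \<in> B i" "y \<in> B i" "\<And>n. p n x = p n y" for i x y
  proof (rule ccontr)
    assume "x \<noteq> y"
    have xyG: "x \<in> carrier G" "y \<in> carrier G" using sets.sets_into_space[OF B[of i]] xy by auto
    obtain U V where UV: "openin T U" "openin T V" "x \<in> U" "y \<in> V" "disjnt U V"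
      using Hausdorff[unfolded Hausdorff_space_def, rule_format, of x y] xyG \<open>x \<noteq> y\<close> by auto
    have Oi: "x \<in> \<O> i" "y \<in> \<O> i" using xy by (auto simp: B_def A_def)
    obtain j where j: "x \<in> \<O> j" "\<O> j \<subseteq> U \<inter> \<O> i"
      using basic[of "U \<inter> \<O> i" x] UV Oi \<O>(1)[of i] by auto
    obtain k where k: "y \<in> \<O> k" "\<O> k \<subseteq> V \<inter> \<O> i"
      using basic[of "V \<inter> \<O> i" y] UV Oi \<O>(1)[of i] by auto
    have "\<O> j \<inter> \<O> k = {}" using UV(5) j k by (auto simp: disjnt_iff)
    moreover have "x \<in> H j" using Z_supp[of x] xy j by (auto simp: B_def supp_def)
    moreover have "x \<in> H k" using Z_supp[of y] xy k H_iff[OF xyG xy(3), of k] by (auto simp: B_def supp_def)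
    moreover have "x \<in> E i" using xy by (simp add: B_def)
    ultimately show False using j k by (auto simp: E_def)
  qed
  show ?thesis
  proof (cases "\<exists>i. measure m (B i) > 0")
    case True
    then obtain i where i: "measure m (B i) > 0" ..
    have "inj_on (\<lambda>x n. p n x) (B i)"
    proof (rule inj_onI)
      fix x y assume "x \<in> B i" "y \<in> B i" and eq: "(\<lambda>n. p n x) = (\<lambda>n. p n y)"
      then show "x = y" by (intro inj[of x i y] fun_cong[OF eq])
    qed
    then show ?thesis by (rule that[OF B B_sub i])
  next
    case False
    \<comment> \<open>When every \<open>B i\<close> is null, the hull property spreads the absence
      of \<open>E i\<close> from \<open>A i\<close> to whole fibres. For almost every
      \<open>x\<close>, each charged basic set then contains two disjoint charged ones.\<close>
    have AE_E: "AE x in m. \<forall>i. x \<notin> E i"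
      unfolding AE_all_countable
    proof
      fix i
      have "AE x in m. x \<notin> B i"
        using False B by (intro AE_not_in_measure_zero) (auto simp: not_less measure_le_0_iff)
      then have "AE x in m. x \<in> A i \<longrightarrow> x \<in> carrier G - E i" using AE_H AE_space
      proof eventually_elim
        case (elim x)
        then show ?case by (auto simp: B_def Z_def A_def)
      qed
      then have "AE x in m. x \<in> H i \<longrightarrow> x \<in> carrier G - E i"
        by (intro hull_le saturated_Diff saturated_carrier E)
      then show "AE x in m. x \<notin> E i" by eventually_elim (auto simp: E_def)
    qed
    have "AE x in m. (\<forall>i. x \<in> A i \<longrightarrow> x \<in> H i) \<and>
        (\<forall>l. \<forall>J\<in>{J. finite J \<and> A l \<subseteq> (\<Union>j\<in>J. A j)}. x \<in> H l \<longrightarrow> (\<exists>j\<in>J. x \<in> H j)) \<and>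
        (\<forall>j. x \<in> H j \<longrightarrow> (\<exists>l\<in>{l. \<K> l \<subseteq> \<O> j}. x \<in> H l)) \<and>
        (\<forall>i n j. A i \<subseteq> {x \<in> carrier G. p n x = j} \<longrightarrow> x \<in> H i \<longrightarrow> p n x = j) \<and> (\<forall>i. x \<notin> E i)"
      using AE_H AE_fin AE_shrink AE_fiber AE_E by eventually_elim (intro conjI)
    \<comment> \<open>A point of \<open>K\<close> outside all exceptional null sets; its support
      will be perfect, against the countability of its fibre.\<close>
    from ex_point_AE[OF this Ks mK] obtain x where x: "x \<in> K" "\<And>i. x \<in> A i \<Longrightarrow> x \<in> H i"
      "\<And>l J. finite J \<Longrightarrow> A l \<subseteq> (\<Union>j\<in>J. A j) \<Longrightarrow> x \<in> H l \<Longrightarrow> \<exists>j\<in>J. x \<in> H j"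
      "\<And>j. x \<in> H j \<Longrightarrow> \<exists>l. \<K> l \<subseteq> \<O> j \<and> x \<in> H l"
      "\<And>i n j. A i \<subseteq> {x \<in> carrier G. p n x = j} \<Longrightarrow> x \<in> H i \<Longrightarrow> p n x = j" "\<And>i. x \<notin> E i"
      by auto
    have KG: "K \<subseteq> carrier G" using closedin_subset[OF K(1)] by simp
    have fiber: "p n z = p n x" if z: "z \<in> supp x" for z n
    proof -
      have zK: "z \<in> K" using z by (simp add: supp_def)
      obtain U where U: "openin T U" "U \<inter> K = {y \<in> K. p n y = p n z}" using K(4)[of n "p n z"] by auto
      then have "z \<in> U" using zK by auto
      then obtain i where i: "z \<in> \<O> i" "\<O> i \<subseteq> U" using basic[OF U(1)] by auto
      have "A i \<subseteq> {x \<in> carrier G. p n x = p n z}" using i U(2) KG by (auto simp: A_def)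
      moreover have "x \<in> H i" using z i by (simp add: supp_def)
      ultimately show ?thesis using x(5) by simp
    qed
    have "supp x \<subseteq> {y \<in> D. \<forall>n. p n y = p n x}" using fiber K(2) by (auto simp: supp_def)
    then have count: "countable (supp x)" using countable_fibers[of x] x(1) K(2) by (meson countable_subset subsetD)
    have "supp x = K - (\<Union>i\<in>{i. x \<notin> H i}. \<O> i)" by (auto simp: supp_def)
    moreover have "openin T (\<Union>i\<in>{i. x \<notin> H i}. \<O> i)" using \<O>(1) by auto
    ultimately have closed: "closedin T (supp x)" using K(1) by (simp add: closedin_diff)
    \<comment> \<open>Otherwise the compact set \<open>\<K> l \<inter> K\<close> is covered by
      uncharged basic sets, hence by finitely many of them, although it contains the charged set
      \<open>A l\<close>.\<close>
    have meets: "\<exists>z\<in>supp x. z \<in> \<O> j" if j: "x \<in> H j" for j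
    proof (rule ccontr)
      assume no: "\<not> ?thesis"
      obtain l where l: "\<K> l \<subseteq> \<O> j" "x \<in> H l" using x(4)[OF j] by auto
      have comp: "compactin T (\<K> l \<inter> K)" using compact \<O>(2) K(1) by (intro closedin_compact_space closedin_Int)
      have cov: "\<K> l \<inter> K \<subseteq> \<Union>(\<O> ` {i. x \<notin> H i})" 
      proof
        fix z assume z: "z \<in> \<K> l \<inter> K"
        then have "z \<notin> supp x" using no l(1) by auto
        then show "z \<in> \<Union>(\<O> ` {i. x \<notin> H i})" using z by (auto simp: supp_def)
      qed
      obtain \<F> where \<F>: "finite \<F>" "\<F> \<subseteq> \<O> ` {i. x \<notin> H i}" "\<K> l \<inter> K \<subseteq> \<Union>\<F>"
        using compactinD[OF comp _ cov] \<O>(1) by auto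
      obtain J where J: "finite J" "J \<subseteq> {i. x \<notin> H i}" "\<F> = \<O> ` J"
        using finite_subset_image[OF \<F>(1,2)] by auto
      have "A l \<subseteq> (\<Union>j\<in>J. A j)" using \<F>(3) J(3) \<O>(3)[of l] by (auto simp: A_def)
      then show False using x(3)[OF J(1) _ l(2)] J(2) by auto
    qed
    have "T derived_set_of supp x = supp x"
    proof (intro subset_antisym subsetI)
      fix z assume "z \<in> T derived_set_of supp x"
      then show "z \<in> supp x" using closed by (auto simp: closedin_contains_derived_set)
    next
      fix z assume z: "z \<in> supp x"
      have zG: "z \<in> carrier G" using z KG by (auto simp: supp_def)
      have "\<exists>y. y \<noteq> z \<and> y \<in> supp x \<and> y \<in> U" if U: "z \<in> U" "openin T U" for U
      proof -
        obtain i where i: "z \<in> \<O> i" "\<O> i \<subseteq> U" using basic[OF U(2,1)] by auto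
        have "x \<in> H i" using z i by (simp add: supp_def)
        then obtain j k where jk: "\<O> j \<subseteq> \<O> i" "\<O> k \<subseteq> \<O> i" "\<O> j \<inter> \<O> k = {}" "x \<in> H j" "x \<in> H k"
          using x(6)[of i] by (auto simp: E_def)
        obtain y y' where y: "y \<in> supp x" "y \<in> \<O> j" "y' \<in> supp x" "y' \<in> \<O> k"
          using meets[OF jk(4)] meets[OF jk(5)] by auto
        have "y \<in> U" "y' \<in> U" "y \<noteq> y'" using y jk(1-3) i by auto
        then show ?thesis using y by metis
      qed
      then show "z \<in> T derived_set_of supp x" using zG by (auto simp: in_derived_set_of)
    qed
    moreover have "supp x \<noteq> {}" using x(1,2) by (auto simp: supp_def A_def)
    moreover have "locally_compact_space T" using compact by (simp add: compact_imp_locally_compact_space)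
    \<comment> \<open>A nonempty perfect set in a locally compact Hausdorff space has at least the
      cardinality of the continuum.\<close>
    ultimately have "(UNIV :: real set) \<lesssim> supp x"
      using Hausdorff by (intro lepoll_perfect_set) auto
    then have "countable (UNIV :: real set)" using count by (rule countable_lepoll[rotated])
    then show ?thesis using uncountable_UNIV_real by simp
  qed
qed

section \<open>The spectral gap\<close>

lemma square_integrable_diff:
  fixes \<xi> \<eta> :: "'a \<Rightarrow> real"
  assumes "\<xi> \<in> borel_measurable m" "integrable m (\<lambda>x. (\<xi> x)\<^sup>2)"
    and "\<eta> \<in> borel_measurable m" "integrable m (\<lambda>x. (\<eta> x)\<^sup>2)"
  shows "integrable m (\<lambda>x. (\<xi> x - \<eta> x)\<^sup>2)"
proof (rule Bochner_Integration.integrable_bound)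
  show "integrable m (\<lambda>x. 2 * (\<xi> x)\<^sup>2 + 2 * (\<eta> x)\<^sup>2)" using assms by simp
  have "(s - t)\<^sup>2 \<le> 2 * s\<^sup>2 + 2 * t\<^sup>2" for s t :: real
    using zero_le_power2[of "s + t"] by (simp add: power2_eq_square algebra_simps)
  then show "AE x in m. norm ((\<xi> x - \<eta> x)\<^sup>2) \<le> norm (2 * (\<xi> x)\<^sup>2 + 2 * (\<eta> x)\<^sup>2)" by simp
qed (use assms in simp)

lemma square_integrable_translate:
  fixes \<xi> :: "'a \<Rightarrow> real"
  assumes "\<xi> \<in> borel_measurable m" "integrable m (\<lambda>x. (\<xi> x)\<^sup>2)" "g \<in> carrier G"
  shows "integrable m (\<lambda>x. (\<xi> (g \<otimes> x))\<^sup>2)"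
proof -
  have "integrable (distr m m (\<lambda>x. g \<otimes> x)) (\<lambda>x. (\<xi> x)\<^sup>2)" using assms by (simp add: distr_translate)
  then show ?thesis using assms by (subst (asm) integrable_distr_eq) auto
qed

lemma measurable_translate:
  assumes "\<xi> \<in> measurable m N" "g \<in> carrier G"
  shows "(\<lambda>x. \<xi> (g \<otimes> x)) \<in> measurable m N"
  using measurable_compose[OF translation_measurable[OF assms(2)] assms(1)] .

text \<open>If no finite set and constant work, take functions that violate the inequality for the
  first \<open>n\<close> elements with constant \<open>n + 1\<close>. Centred and normalised, they
  form an almost invariant sequence, against the gap.\<close>

lemma spectral_gap_poincare:
  assumes \<Gamma>: "subgroup \<Gamma> G" "countable \<Gamma>"
    and gap: "spectral_gap (G\<lparr>carrier := \<Gamma>\<rparr>) (left_translation G) m"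
  obtains F C where "finite F" "F \<subseteq> \<Gamma>" "C \<ge> 0"
    "\<And>\<xi> :: 'a \<Rightarrow> real. \<xi> \<in> borel_measurable m \<Longrightarrow> integrable m (\<lambda>x. (\<xi> x)\<^sup>2) \<Longrightarrow>
      (\<integral>x. (\<xi> x - (\<integral>y. \<xi> y \<partial>m))\<^sup>2 \<partial>m) \<le> C * (\<Sum>g\<in>F. \<integral>x. (\<xi> (g \<otimes> x) - \<xi> x)\<^sup>2 \<partial>m)"
proof (rule ccontr)
  assume no: "\<not> thesis"
  have ne: "\<Gamma> \<noteq> {}" using subgroup.one_closed[OF \<Gamma>(1)] by auto
  have \<Gamma>G: "\<Gamma> \<subseteq> carrier G" by (rule subgroup.subset[OF \<Gamma>(1)])
  define \<gamma> where "\<gamma> = from_nat_into \<Gamma>"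
  have \<gamma>: "\<gamma> i \<in> \<Gamma>" for i unfolding \<gamma>_def using ne by (rule from_nat_into)
  have range: "range \<gamma> = \<Gamma>" unfolding \<gamma>_def using ne \<Gamma>(2) by (rule range_from_nat_into)
  \<comment> \<open>Inverses appear because \<open>koopman\<close> translates by the inverse of
    \<open>g\<close>.\<close>
  define F where "F n = (\<lambda>i. inv (\<gamma> i)) ` {..<n}" for n :: nat
  have F: "finite (F n)" "F n \<subseteq> \<Gamma>" for n
    using \<gamma> subgroup.m_inv_closed[OF \<Gamma>(1)] by (auto simp: F_def)
  have "\<exists>\<xi> :: 'a \<Rightarrow> real. \<xi> \<in> borel_measurable m \<and> integrable m (\<lambda>x. (\<xi> x)\<^sup>2) \<and>
      (real n + 1) * (\<Sum>g\<in>F n. \<integral>x. (\<xi> (g \<otimes> x) - \<xi> x)\<^sup>2 \<partial>m) < (\<integral>x. (\<xi> x - (\<integral>y. \<xi> y \<partial>m))\<^sup>2 \<partial>m)" for n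
  proof (rule ccontr)
    assume *: "\<not> ?thesis"
    have "(\<integral>x. (\<xi> x - (\<integral>y. \<xi> y \<partial>m))\<^sup>2 \<partial>m)
        \<le> (real n + 1) * (\<Sum>g\<in>F n. \<integral>x. (\<xi> (g \<otimes> x) - \<xi> x)\<^sup>2 \<partial>m)"
      if "\<xi> \<in> borel_measurable m" "integrable m (\<lambda>x. (\<xi> x)\<^sup>2)" for \<xi> :: "'a \<Rightarrow> real"
    proof (rule ccontr)
      assume "\<not> ?thesis"
      then show False using * that by (auto simp: not_le)
    qed
    then have thesis by (intro that[OF F[of n], of "real n + 1"]) simp_all
    then show False using no by simp
  qed
  then have "\<exists>\<xi> :: nat \<Rightarrow> 'a \<Rightarrow> real. \<forall>n. \<xi> n \<in> borel_measurable m \<and> integrable m (\<lambda>x. (\<xi> n x)\<^sup>2) \<and>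
      (real n + 1) * (\<Sum>g\<in>F n. \<integral>x. (\<xi> n (g \<otimes> x) - \<xi> n x)\<^sup>2 \<partial>m)
        < (\<integral>x. (\<xi> n x - (\<integral>y. \<xi> n y \<partial>m))\<^sup>2 \<partial>m)"
    by (intro choice allI)
  then obtain \<xi> :: "nat \<Rightarrow> 'a \<Rightarrow> real" where meas [measurable]: "\<And>n. \<xi> n \<in> borel_measurable m"
    and int: "\<And>n. integrable m (\<lambda>x. (\<xi> n x)\<^sup>2)"
    and less: "\<And>n. (real n + 1) * (\<Sum>g\<in>F n. \<integral>x. (\<xi> n (g \<otimes> x) - \<xi> n x)\<^sup>2 \<partial>m)
      < (\<integral>x. (\<xi> n x - (\<integral>y. \<xi> n y \<partial>m))\<^sup>2 \<partial>m)" by auto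
  define c V where "c n = (\<integral>y. \<xi> n y \<partial>m)" and "V n = (\<integral>x. (\<xi> n x - c n)\<^sup>2 \<partial>m)" for n
  have V: "V n > 0" for n
  proof -
    have "0 \<le> (real n + 1) * (\<Sum>g\<in>F n. \<integral>x. (\<xi> n (g \<otimes> x) - \<xi> n x)\<^sup>2 \<partial>m)"
      by (intro mult_nonneg_nonneg sum_nonneg) auto
    then show ?thesis using less[of n] by (simp add: V_def c_def)
  qed
  define \<zeta> where "\<zeta> n x = complex_of_real ((\<xi> n x - c n) / sqrt (V n))" for n x
  have cmod: "(cmod (complex_of_real (t / sqrt (V n))))\<^sup>2 = t\<^sup>2 / V n" for t n
    using V[of n] by (simp add: norm_divide power_divide del: of_real_divide)
  have int_sub: "integrable m (\<lambda>x. (\<xi> n x - c n)\<^sup>2)" for n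
    by (rule square_integrable_diff) (use int in auto)
  have int1: "integrable m (\<xi> n)" for n by (rule square_integrable_imp_integrable) (use int in auto)
  have zero: "\<zeta> n \<in> L2_zero m" for n
    unfolding L2_zero_def
  proof (intro CollectI conjI)
    show "\<zeta> n \<in> borel_measurable m" unfolding \<zeta>_def by measurable
    show "integrable m (\<lambda>x. (cmod (\<zeta> n x))\<^sup>2)"
      unfolding \<zeta>_def cmod using int_sub[of n] by simp
    have "(\<integral>x. \<zeta> n x \<partial>m) = complex_of_real (\<integral>x. (\<xi> n x - c n) / sqrt (V n) \<partial>m)"
      unfolding \<zeta>_def by (rule integral_complex_of_real)
    also have "(\<integral>x. (\<xi> n x - c n) / sqrt (V n) \<partial>m) = ((\<integral>x. \<xi> n x \<partial>m) - c n) / sqrt (V n)"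
      using int1[of n] prob_space by simp
    finally show "(\<integral>x. \<zeta> n x \<partial>m) = 0" by (simp add: c_def)
  qed
  have one: "L2_norm m (\<zeta> n) = 1" for n
  proof -
    have "(\<integral>x. (cmod (\<zeta> n x))\<^sup>2 \<partial>m) = V n / V n"
      unfolding \<zeta>_def cmod by (simp add: V_def)
    then show ?thesis using V[of n] by (simp add: L2_norm_def)
  qed
  have inv: "(\<lambda>n. L2_norm m (\<lambda>x. koopman (G\<lparr>carrier := \<Gamma>\<rparr>) (left_translation G) g (\<zeta> n) x - \<zeta> n x)) \<longlonglongrightarrow> 0"
    if g: "g \<in> \<Gamma>" for g
  proof -
    obtain i where i: "g = \<gamma> i" using g range by auto
    have gG: "g \<in> carrier G" using g \<Gamma>G by auto
    have bound: "norm (L2_norm m (\<lambda>x. koopman (G\<lparr>carrier := \<Gamma>\<rparr>) (left_translation G) g (\<zeta> n) x - \<zeta> n x))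
        \<le> sqrt (1 / (real n + 1))" if n: "n > i" for n
    proof -
      have k: "(cmod (koopman (G\<lparr>carrier := \<Gamma>\<rparr>) (left_translation G) g (\<zeta> n) x - \<zeta> n x))\<^sup>2
          = (\<xi> n (inv g \<otimes> x) - \<xi> n x)\<^sup>2 / V n" if x: "x \<in> carrier G" for x
      proof -
        have "koopman (G\<lparr>carrier := \<Gamma>\<rparr>) (left_translation G) g (\<zeta> n) x - \<zeta> n x
          = complex_of_real ((\<xi> n (inv g \<otimes> x) - \<xi> n x) / sqrt (V n))"
          using x g m_inv_consistent[OF \<Gamma>(1)]
          by (simp add: koopman_def left_translation_def \<zeta>_def diff_divide_distrib)
        then show ?thesis by (simp only: cmod)
      qed
      have "(\<integral>x. (cmod (koopman (G\<lparr>carrier := \<Gamma>\<rparr>) (left_translation G) g (\<zeta> n) x - \<zeta> n x))\<^sup>2 \<partial>m)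
          = (\<integral>x. (\<xi> n (inv g \<otimes> x) - \<xi> n x)\<^sup>2 / V n \<partial>m)"
        by (rule Bochner_Integration.integral_cong) (use k in auto)
      also have "\<dots> = (\<integral>x. (\<xi> n (inv g \<otimes> x) - \<xi> n x)\<^sup>2 \<partial>m) / V n" by simp
      also have "\<dots> \<le> 1 / (real n + 1)"
      proof -
        have "inv g \<in> F n" using i n by (auto simp: F_def)
        then have "(\<integral>x. (\<xi> n (inv g \<otimes> x) - \<xi> n x)\<^sup>2 \<partial>m) \<le> (\<Sum>g\<in>F n. \<integral>x. (\<xi> n (g \<otimes> x) - \<xi> n x)\<^sup>2 \<partial>m)"
          using F by (intro member_le_sum) auto
        then have "(real n + 1) * (\<integral>x. (\<xi> n (inv g \<otimes> x) - \<xi> n x)\<^sup>2 \<partial>m)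
            \<le> (real n + 1) * (\<Sum>g\<in>F n. \<integral>x. (\<xi> n (g \<otimes> x) - \<xi> n x)\<^sup>2 \<partial>m)"
          by (intro mult_left_mono) auto
        also have "\<dots> < V n" using less[of n] by (simp add: V_def c_def)
        finally show ?thesis using V[of n] by (simp add: field_simps)
      qed
      finally show ?thesis by (simp add: L2_norm_def del: real_sqrt_divide)
    qed
    have "(\<lambda>n. sqrt (1 / (real n + 1))) \<longlonglongrightarrow> sqrt 0"
    proof (rule tendsto_real_sqrt)
      show "(\<lambda>n. 1 / (real n + 1)) \<longlonglongrightarrow> 0"
        using LIMSEQ_inverse_real_of_nat by (simp add: inverse_eq_divide add.commute)
    qed
    then have "(\<lambda>n. sqrt (1 / (real n + 1))) \<longlonglongrightarrow> 0" by simp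
    then show ?thesis
      by (rule Lim_null_comparison[rotated])
        (use bound in \<open>auto simp: eventually_sequentially intro!: exI[of _ "Suc i"]\<close>)
  qed
  have "\<not> spectral_gap (G\<lparr>carrier := \<Gamma>\<rparr>) (left_translation G) m"
    unfolding spectral_gap_def not_not
    by (intro exI[of _ \<zeta>] conjI allI ballI) (use zero one inv in auto)
  then show False using gap by simp
qed

text \<open>In terms of nonnegative integrals the inequality can be integrated over a further
  parameter by Tonelli's theorem.\<close>

lemma nn_integral_poincare:
  fixes \<xi> :: "'a \<Rightarrow> real"
  assumes F: "finite F" "F \<subseteq> carrier G" and C: "C \<ge> 0"
    and poincare: "(\<integral>x. (\<xi> x - (\<integral>y. \<xi> y \<partial>m))\<^sup>2 \<partial>m) \<le> C * (\<Sum>g\<in>F. \<integral>x. (\<xi> (g \<otimes> x) - \<xi> x)\<^sup>2 \<partial>m)"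
    and \<xi> [measurable]: "\<xi> \<in> borel_measurable m" and int: "integrable m (\<lambda>x. (\<xi> x)\<^sup>2)"
  shows "(\<integral>\<^sup>+x. ennreal ((\<xi> x - (\<integral>y. \<xi> y \<partial>m))\<^sup>2) \<partial>m)
    \<le> ennreal C * (\<Sum>g\<in>F. \<integral>\<^sup>+x. ennreal ((\<xi> (g \<otimes> x) - \<xi> x)\<^sup>2) \<partial>m)"
proof -
  have i1: "integrable m (\<lambda>x. (\<xi> x - (\<integral>y. \<xi> y \<partial>m))\<^sup>2)"
    by (rule square_integrable_diff) (use int in auto)
  have i2: "integrable m (\<lambda>x. (\<xi> (g \<otimes> x) - \<xi> x)\<^sup>2)" if "g \<in> F" for g
    using that F int
    by (intro square_integrable_diff square_integrable_translate measurable_translate) auto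
  have "(\<integral>\<^sup>+x. ennreal ((\<xi> x - (\<integral>y. \<xi> y \<partial>m))\<^sup>2) \<partial>m) = ennreal (\<integral>x. (\<xi> x - (\<integral>y. \<xi> y \<partial>m))\<^sup>2 \<partial>m)"
    by (rule nn_integral_eq_integral[OF i1]) simp
  also have "\<dots> \<le> ennreal (C * (\<Sum>g\<in>F. \<integral>x. (\<xi> (g \<otimes> x) - \<xi> x)\<^sup>2 \<partial>m))"
    using poincare by (rule ennreal_leI)
  also have "\<dots> = ennreal C * (\<Sum>g\<in>F. ennreal (\<integral>x. (\<xi> (g \<otimes> x) - \<xi> x)\<^sup>2 \<partial>m))"
    using C by (simp add: ennreal_mult sum_nonneg sum_ennreal)
  also have "(\<Sum>g\<in>F. ennreal (\<integral>x. (\<xi> (g \<otimes> x) - \<xi> x)\<^sup>2 \<partial>m))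
      = (\<Sum>g\<in>F. \<integral>\<^sup>+x. ennreal ((\<xi> (g \<otimes> x) - \<xi> x)\<^sup>2) \<partial>m)"
    by (intro sum.cong refl nn_integral_eq_integral[symmetric] i2) auto
  finally show ?thesis .
qed

text \<open>Here \<open>v\<close> is a map from the group to L^2. For fixed \<open>t\<close> the
  scalar inequality applies to \<open>v x t\<close> as a function of \<open>x\<close>; integrating
  over \<open>t\<close> and exchanging integrals gives the vector inequality with the same
  constant.\<close>

lemma vector_poincare:
  fixes v :: "'a \<Rightarrow> 'a \<Rightarrow> real"
  assumes F: "finite F" "F \<subseteq> carrier G" and C: "C \<ge> 0"
    and poincare: "\<And>\<xi> :: 'a \<Rightarrow> real. \<xi> \<in> borel_measurable m \<Longrightarrow> integrable m (\<lambda>x. (\<xi> x)\<^sup>2) \<Longrightarrow>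
      (\<integral>x. (\<xi> x - (\<integral>y. \<xi> y \<partial>m))\<^sup>2 \<partial>m) \<le> C * (\<Sum>g\<in>F. \<integral>x. (\<xi> (g \<otimes> x) - \<xi> x)\<^sup>2 \<partial>m)"
    and v [measurable]: "(\<lambda>z. v (fst z) (snd z)) \<in> borel_measurable (m \<Otimes>\<^sub>M m)"
    and fin: "(\<integral>\<^sup>+x. \<integral>\<^sup>+t. ennreal ((v x t)\<^sup>2) \<partial>m \<partial>m) < \<infinity>"
  shows "(\<integral>\<^sup>+x. \<integral>\<^sup>+t. ennreal ((v x t - (\<integral>y. v y t \<partial>m))\<^sup>2) \<partial>m \<partial>m)
    \<le> ennreal C * (\<Sum>g\<in>F. \<integral>\<^sup>+x. \<integral>\<^sup>+t. ennreal ((v (g \<otimes> x) t - v x t)\<^sup>2) \<partial>m \<partial>m)"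
proof -
  interpret P: pair_sigma_finite m m ..
  have v2 [measurable]: "(\<lambda>z. v (snd z) (fst z)) \<in> borel_measurable (m \<Otimes>\<^sub>M m)"
    using measurable_compose[OF measurable_pair_swap' v] by (simp add: case_prod_beta)
  have vx [measurable]: "(\<lambda>x. v x t) \<in> borel_measurable m" if "t \<in> space m" for t
    using measurable_compose[OF measurable_Pair1'[OF that] v2] by simp
  have [measurable]: "(\<lambda>t. \<integral>y. v y t \<partial>m) \<in> borel_measurable m"
  proof (rule sigma_finite_measure.borel_measurable_lebesgue_integral[where f="\<lambda>t y. v y t"])
    show "sigma_finite_measure m" by unfold_locales
    show "(\<lambda>(t, y). v y t) \<in> borel_measurable (m \<Otimes>\<^sub>M m)"
      using v2 by (simp add: case_prod_beta)
  qed
  have swap: "(\<integral>\<^sup>+x. \<integral>\<^sup>+t. f x t \<partial>m \<partial>m) = (\<integral>\<^sup>+t. \<integral>\<^sup>+x. f x t \<partial>m \<partial>m)"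
    if "(\<lambda>z. f (fst z) (snd z)) \<in> borel_measurable (m \<Otimes>\<^sub>M m)" for f :: "'a \<Rightarrow> 'a \<Rightarrow> ennreal"
    using P.Fubini'[of "\<lambda>x t. f x t"] that by (simp add: case_prod_beta)
  have trv [measurable]: "(\<lambda>z. v (g \<otimes> fst z) (snd z)) \<in> borel_measurable (m \<Otimes>\<^sub>M m)" if "g \<in> carrier G" for g
  proof -
    have "(\<lambda>z. (g \<otimes> fst z, snd z)) \<in> measurable (m \<Otimes>\<^sub>M m) (m \<Otimes>\<^sub>M m)" using that by measurable
    from measurable_compose[OF this v] show ?thesis by simp
  qed
  have "(\<integral>\<^sup>+x. \<integral>\<^sup>+t. ennreal ((v x t)\<^sup>2) \<partial>m \<partial>m) = (\<integral>\<^sup>+t. \<integral>\<^sup>+x. ennreal ((v x t)\<^sup>2) \<partial>m \<partial>m)"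
    by (rule swap) measurable
  then have "(\<integral>\<^sup>+t. \<integral>\<^sup>+x. ennreal ((v x t)\<^sup>2) \<partial>m \<partial>m) \<noteq> \<infinity>" using fin by simp
  moreover have "(\<lambda>t. \<integral>\<^sup>+x. ennreal ((v x t)\<^sup>2) \<partial>m) \<in> borel_measurable m"
    by (rule borel_measurable_nn_integral[where f="\<lambda>t x. ennreal ((v x t)\<^sup>2)"])
      (use v2 in \<open>simp add: case_prod_beta\<close>)
  \<comment> \<open>Finiteness of the double integral makes almost every coordinate function square
    integrable, as the scalar inequality demands.\<close>
  ultimately have ae: "AE t in m. (\<integral>\<^sup>+x. ennreal ((v x t)\<^sup>2) \<partial>m) \<noteq> \<infinity>"
    by (intro nn_integral_PInf_AE)
  have "(\<integral>\<^sup>+x. \<integral>\<^sup>+t. ennreal ((v x t - (\<integral>y. v y t \<partial>m))\<^sup>2) \<partial>m \<partial>m)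
      = (\<integral>\<^sup>+t. \<integral>\<^sup>+x. ennreal ((v x t - (\<integral>y. v y t \<partial>m))\<^sup>2) \<partial>m \<partial>m)"
    by (rule swap) measurable
  also have "\<dots> \<le> (\<integral>\<^sup>+t. ennreal C * (\<Sum>g\<in>F. \<integral>\<^sup>+x. ennreal ((v (g \<otimes> x) t - v x t)\<^sup>2) \<partial>m) \<partial>m)"
  proof (rule nn_integral_mono_AE)
    show "AE t in m. (\<integral>\<^sup>+x. ennreal ((v x t - (\<integral>y. v y t \<partial>m))\<^sup>2) \<partial>m)
        \<le> ennreal C * (\<Sum>g\<in>F. \<integral>\<^sup>+x. ennreal ((v (g \<otimes> x) t - v x t)\<^sup>2) \<partial>m)"
      using ae AE_space
    proof eventually_elim
      case (elim t)
      have "integrable m (\<lambda>x. (v x t)\<^sup>2)"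
        unfolding integrable_iff_bounded using elim vx[of t] by (simp add: less_top)
      then show ?case
        using elim vx[of t] by (intro nn_integral_poincare F C poincare) auto
    qed
  qed
  also have "\<dots> = ennreal C * (\<Sum>g\<in>F. \<integral>\<^sup>+t. \<integral>\<^sup>+x. ennreal ((v (g \<otimes> x) t - v x t)\<^sup>2) \<partial>m \<partial>m)"
  proof -
    have [measurable]: "(\<lambda>t. \<integral>\<^sup>+x. ennreal ((v (g \<otimes> x) t - v x t)\<^sup>2) \<partial>m) \<in> borel_measurable m" if "g \<in> F" for g
    proof (rule borel_measurable_nn_integral[where f="\<lambda>t x. ennreal ((v (g \<otimes> x) t - v x t)\<^sup>2)"])
      have "g \<in> carrier G" using that F by auto
      from measurable_compose[OF measurable_pair_swap' trv[OF this]]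
      have "(\<lambda>z. v (g \<otimes> snd z) (fst z)) \<in> borel_measurable (m \<Otimes>\<^sub>M m)" by (simp add: case_prod_beta)
      then show "(\<lambda>(t, x). ennreal ((v (g \<otimes> x) t - v x t)\<^sup>2)) \<in> borel_measurable (m \<Otimes>\<^sub>M m)"
        using v2 by (simp add: case_prod_beta)
    qed
    show ?thesis by (subst nn_integral_cmult, measurable) (simp add: nn_integral_sum)
  qed
  also have "(\<Sum>g\<in>F. \<integral>\<^sup>+t. \<integral>\<^sup>+x. ennreal ((v (g \<otimes> x) t - v x t)\<^sup>2) \<partial>m \<partial>m)
      = (\<Sum>g\<in>F. \<integral>\<^sup>+x. \<integral>\<^sup>+t. ennreal ((v (g \<otimes> x) t - v x t)\<^sup>2) \<partial>m \<partial>m)"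
  proof (intro sum.cong refl swap[symmetric])
    fix g assume "g \<in> F"
    then have "g \<in> carrier G" using F by auto
    note [measurable] = trv[OF this]
    show "(\<lambda>z. ennreal ((v (g \<otimes> fst z) (snd z) - v (fst z) (snd z))\<^sup>2)) \<in> borel_measurable (m \<Otimes>\<^sub>M m)"
      by measurable
  qed
  finally show ?thesis .
qed

section \<open>Unit vectors attached to translated cells\<close>

lemma nn_integral_normalized_indicators:
  assumes A: "A \<in> sets m" "measure m A > 0" and B: "B \<in> sets m" "measure m B > 0"
  shows "(\<integral>\<^sup>+t. ennreal ((indicator A t / sqrt (measure m A) - indicator B t / sqrt (measure m B))\<^sup>2) \<partial>m)
    = ennreal (2 - 2 * measure m (A \<inter> B) / sqrt (measure m A * measure m B))"
proof -
  let ?a = "measure m A" and ?b = "measure m B"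
  have eq: "(indicator A t / sqrt ?a - indicator B t / sqrt ?b)\<^sup>2
      = indicator A t / ?a + indicator B t / ?b - 2 / sqrt (?a * ?b) * indicator (A \<inter> B) t" for t
    using A(2) B(2) by (auto simp: indicator_def power2_diff power_divide real_sqrt_mult)
  have int: "integrable m (\<lambda>t. indicator A t / ?a + indicator B t / ?b - 2 / sqrt (?a * ?b) * indicator (A \<inter> B) t)"
    using A B by (intro Bochner_Integration.integrable_diff Bochner_Integration.integrable_add
      integrable_divide integrable_mult_right integrable_real_indicator) (auto simp: emeasure_eq_measure)
  have "(\<integral>\<^sup>+t. ennreal ((indicator A t / sqrt ?a - indicator B t / sqrt ?b)\<^sup>2) \<partial>m)
      = ennreal (\<integral>t. indicator A t / ?a + indicator B t / ?b - 2 / sqrt (?a * ?b) * indicator (A \<inter> B) t \<partial>m)"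
    unfolding eq[symmetric]
  proof (rule nn_integral_eq_integral)
    show "integrable m (\<lambda>t. (indicator A t / sqrt ?a - indicator B t / sqrt ?b)\<^sup>2)"
      unfolding eq by (rule int)
  qed simp
  also have "(\<integral>t. indicator A t / ?a + indicator B t / ?b - 2 / sqrt (?a * ?b) * indicator (A \<inter> B) t \<partial>m)
      = 2 - 2 * measure m (A \<inter> B) / sqrt (?a * ?b)"
  proof -
    have "A \<inter> carrier G = A" "B \<inter> carrier G = B" "A \<inter> B \<inter> carrier G = A \<inter> B"
      using sets.sets_into_space[OF A(1)] sets.sets_into_space[OF B(1)] by auto
    then show ?thesis
      using A B by (subst Bochner_Integration.integral_diff Bochner_Integration.integral_add; simp add: emeasure_eq_measure)
  qed
  finally show ?thesis .
qed

lemma AE_measure_cell_pos: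
  assumes f: "f \<in> measurable m (count_space UNIV)"
  shows "AE x in m. measure m (cell f x) > 0"
proof -
  have "AE x in m. \<forall>i. f x = i \<longrightarrow> measure m {y \<in> carrier G. f y = i} > 0"
    unfolding AE_all_countable
  proof
    fix i
    show "AE x in m. f x = i \<longrightarrow> measure m {y \<in> carrier G. f y = i} > 0"
    proof (cases "measure m {y \<in> carrier G. f y = i} > 0")
      case False
      then have "measure m {y \<in> carrier G. f y = i} = 0"
        using measure_nonneg[of m "{y \<in> carrier G. f y = i}"] by linarith
      then have "{y \<in> carrier G. f y = i} \<in> null_sets m"
        using nat_pred_sets[OF f] by (simp add: null_sets_def emeasure_eq_measure)
      then have "AE x in m. x \<notin> {y \<in> carrier G. f y = i}" by (rule AE_not_in)
      then show ?thesis using AE_space by eventually_elim auto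
    qed auto
  qed
  then show ?thesis by eventually_elim (simp add: cell_def)
qed

text \<open>The unit vector of \<open>L\<^sup>2(G)\<close> given by the cell of \<open>x\<close> translated back to the identity; it is
  \<open>0\<close> if the cell is null.\<close>

definition cell_vector :: "('a \<Rightarrow> nat) \<Rightarrow> 'a \<Rightarrow> 'a \<Rightarrow> real"
  where "cell_vector f x t = of_bool (f (x \<otimes> t) = f x) / sqrt (measure m (cell f x))"

lemma cell_vector_eq:
  assumes "f \<in> measurable m (count_space UNIV)" "x \<in> carrier G" "t \<in> carrier G"
  shows "cell_vector f x t = indicator (tr x (cell f x)) t / sqrt (measure m (tr x (cell f x)))"
  using assms by (simp add: measure_tr cell_vector_def) (simp add: tr_def cell_def indicator_def)

lemma cell_vector_measurable:
  assumes f: "f \<in> measurable m (count_space UNIV)"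
  shows "(\<lambda>z. cell_vector f (fst z) (snd z)) \<in> borel_measurable (m \<Otimes>\<^sub>M m)"
proof -
  have 1: "(\<lambda>z. f (fst z \<otimes> snd z)) \<in> measurable (m \<Otimes>\<^sub>M m) (count_space UNIV)"
    using measurable_compose[OF mult_measurable_pair f] .
  have 2: "(\<lambda>z. f (fst z)) \<in> measurable (m \<Otimes>\<^sub>M m) (count_space UNIV)"
    using measurable_compose[OF measurable_fst f] .
  let ?h = "\<lambda>j i. of_bool (i = j) / sqrt (measure m {y \<in> carrier G. f y = j}) :: real"
  have "(\<lambda>z. ?h j (f (fst z \<otimes> snd z))) \<in> borel_measurable (m \<Otimes>\<^sub>M m)" for j
    by (rule measurable_compose[OF 1]) simp
  then have "(\<lambda>z. ?h (f (fst z)) (f (fst z \<otimes> snd z))) \<in> borel_measurable (m \<Otimes>\<^sub>M m)"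
    by (rule measurable_compose_countable[OF _ 2])
  then show ?thesis by (simp add: cell_vector_def cell_def)
qed

lemma nn_integral_cell_vector_diff:
  assumes f: "f \<in> measurable m (count_space UNIV)"
    and x: "x \<in> carrier G" "measure m (cell f x) > 0" and y: "y \<in> carrier G" "measure m (cell f y) > 0"
  shows "(\<integral>\<^sup>+t. ennreal ((cell_vector f x t - cell_vector f y t)\<^sup>2) \<partial>m)
    = ennreal (2 - 2 * measure m (tr x (cell f x) \<inter> tr y (cell f y))
        / sqrt (measure m (cell f x) * measure m (cell f y)))"
proof -
  let ?X = "tr x (cell f x)" and ?Y = "tr y (cell f y)"
  have sets: "?X \<in> sets m" "?Y \<in> sets m" using x y f by auto
  have eq: "measure m ?X = measure m (cell f x)" "measure m ?Y = measure m (cell f y)"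
    using x y f by (auto simp: measure_tr)
  have "(\<integral>\<^sup>+t. ennreal ((cell_vector f x t - cell_vector f y t)\<^sup>2) \<partial>m)
      = (\<integral>\<^sup>+t. ennreal ((indicator ?X t / sqrt (measure m ?X) - indicator ?Y t / sqrt (measure m ?Y))\<^sup>2) \<partial>m)"
    by (rule nn_integral_cong) (use x y cell_vector_eq[OF f] in simp)
  also have "\<dots> = ennreal (2 - 2 * measure m (?X \<inter> ?Y) / sqrt (measure m ?X * measure m ?Y))"
    using sets x y eq by (intro nn_integral_normalized_indicators) auto
  finally show ?thesis unfolding eq .
qed

lemma nn_integral_cell_vector:
  assumes f: "f \<in> measurable m (count_space UNIV)" and x: "x \<in> carrier G"
  shows "(\<integral>\<^sup>+t. ennreal ((cell_vector f x t)\<^sup>2) \<partial>m) \<le> 1"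
proof -
  let ?X = "tr x (cell f x)" and ?a = "measure m (cell f x)"
  have X: "?X \<in> sets m" and a: "measure m ?X = ?a" using x f by (auto simp: measure_tr)
  have "(\<integral>\<^sup>+t. ennreal ((cell_vector f x t)\<^sup>2) \<partial>m) = (\<integral>\<^sup>+t. ennreal (1 / ?a) * indicator ?X t \<partial>m)"
    by (rule nn_integral_cong)
      (use x cell_vector_eq[OF f] a in \<open>auto simp: power_divide indicator_def\<close>)
  also have "\<dots> = ennreal (1 / ?a) * emeasure m ?X" using X by (simp add: nn_integral_cmult_indicator)
  also have "\<dots> = ennreal (1 / ?a * ?a)" using a by (simp add: emeasure_eq_measure ennreal_mult[symmetric])
  \<comment> \<open>A null cell gives the zero vector through division by zero, hence an inequality
    instead of the norm being 1.\<close>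
  also have "\<dots> \<le> 1" by (cases "?a = 0") auto
  finally show ?thesis .
qed

text \<open>The geometric mean of \<open>a\<close> and \<open>b\<close> is at most the larger of the
  two, and the overlap is compared with that one.\<close>

lemma overlap_ratio:
  fixes a b c d :: real
  assumes "a > 0" "b > 0" "d < 1" "c \<ge> (1 - d) * a" "c \<ge> (1 - d) * b"
  shows "2 - 2 * c / sqrt (a * b) \<le> 2 * d"
proof -
  have s: "sqrt (a * b) > 0" using assms by simp
  have "sqrt (a * b) \<le> sqrt ((max a b)\<^sup>2)"
    using assms by (intro real_sqrt_le_mono) (auto simp: power2_eq_square max_def intro: mult_mono)
  then have "sqrt (a * b) \<le> max a b" using assms by simp
  then have "(1 - d) * sqrt (a * b) \<le> (1 - d) * max a b" using assms by (intro mult_left_mono) auto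
  also have "\<dots> \<le> c" using assms by (auto simp: max_def)
  finally have "1 - d \<le> c / sqrt (a * b)" using s by (subst pos_le_divide_eq)
  then show ?thesis by simp
qed

text \<open>A point of the cell of \<open>x\<close> that also shares the label \<open>w\<close> of
  \<open>x\<close> is sent by \<open>g\<close> into the cell of \<open>g \<otimes> x\<close>, unless
  it lies off the conull set \<open>S\<close>. Moving both cells back to the identity preserves this
  overlap.\<close>

lemma overlap_translate:
  assumes f: "f \<in> measurable m (count_space UNIV)" and S: "S \<in> sets m" "measure m S = 1"
    and g: "g \<in> carrier G" and w: "w \<in> measurable m (count_space UNIV)"
    and equiv: "\<And>x y. x \<in> S \<Longrightarrow> y \<in> S \<Longrightarrow> w x = w y \<Longrightarrow> f x = f y \<Longrightarrow> f (g \<otimes> x) = f (g \<otimes> y)"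
    and x: "x \<in> S" and good: "measure m (cell f x - cell w x) \<le> d * measure m (cell f x)"
  shows "measure m (tr x (cell f x) \<inter> tr (g \<otimes> x) (cell f (g \<otimes> x))) \<ge> (1 - d) * measure m (cell f x)"
proof -
  have xG: "x \<in> carrier G" using x sets.sets_into_space[OF S(1)] by auto
  have C: "cell f x \<in> sets m" "cell w x \<in> sets m" "cell f (g \<otimes> x) \<in> sets m" using f w by auto
  have GS: "carrier G - S \<in> sets m" using S sets.compl_sets[of S m] by simp
  have zero: "measure m (carrier G - S) = 0" using prob_compl[OF S(1)] S(2) by simp
  have "cell f x \<inter> cell w x \<subseteq> (cell f x \<inter> tr g (cell f (g \<otimes> x))) \<union> (carrier G - S)"
  proof
    fix y assume y: "y \<in> cell f x \<inter> cell w x"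
    show "y \<in> (cell f x \<inter> tr g (cell f (g \<otimes> x))) \<union> (carrier G - S)"
      using y equiv[of y x] x g by (cases "y \<in> S") (auto simp: cell_def tr_def)
  qed
  then have "measure m (cell f x \<inter> cell w x) \<le> measure m ((cell f x \<inter> tr g (cell f (g \<otimes> x))) \<union> (carrier G - S))"
    using C GS g by (intro finite_measure_mono) auto
  also have "\<dots> \<le> measure m (cell f x \<inter> tr g (cell f (g \<otimes> x))) + measure m (carrier G - S)"
    using C GS g by (intro measure_Un_le) auto
  also have "\<dots> = measure m (tr x (cell f x \<inter> tr g (cell f (g \<otimes> x))))"
    using C g xG zero by (subst measure_tr) auto
  also have "tr x (cell f x \<inter> tr g (cell f (g \<otimes> x))) = tr x (cell f x) \<inter> tr (g \<otimes> x) (cell f (g \<otimes> x))"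
    using g xG by (simp add: tr_Int tr_tr)
  finally have "measure m (cell f x \<inter> cell w x) \<le> measure m (tr x (cell f x) \<inter> tr (g \<otimes> x) (cell f (g \<otimes> x)))" .
  moreover have "measure m (cell f x - cell w x) = measure m (cell f x) - measure m (cell f x \<inter> cell w x)"
    using C by (intro finite_measure_Diff') auto
  ultimately show ?thesis using good by (simp add: algebra_simps)
qed

lemma AE_translate:
  assumes "AE x in m. P x" "g \<in> carrier G"
  shows "AE x in m. P (g \<otimes> x)"
proof -
  have "AE x in distr m m (\<lambda>x. g \<otimes> x). P x"
    unfolding distr_translate[OF assms(2)] by (rule assms(1))
  then show ?thesis by (rule AE_distrD[OF translation_measurable[OF assms(2)]])
qed

lemma split_points_sets:
  assumes "f \<in> measurable m (count_space UNIV)" "w \<in> measurable m (count_space UNIV)"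
  shows "split_points f w d \<in> sets m"
proof -
  have "split_points f w d
    = (\<Union>i. {x \<in> carrier G. w x = i} \<inter>
        {x \<in> carrier G. measure m ({y \<in> carrier G. f y = f x} - {y \<in> carrier G. w y = i})
          > d * measure m {y \<in> carrier G. f y = f x}})"
    by (auto simp: cell_def)
  moreover have "{x \<in> carrier G. w x = i} \<inter>
        {x \<in> carrier G. measure m ({y \<in> carrier G. f y = f x} - {y \<in> carrier G. w y = i})
          > d * measure m {y \<in> carrier G. f y = f x}} \<in> sets m" for i
    by (intro sets.Int nat_pred_sets[OF assms(2)] nat_pred_sets[OF assms(1), where
      P="\<lambda>j. measure m ({y \<in> carrier G. f y = j} - {y \<in> carrier G. w y = i}) > d * measure m {y \<in> carrier G. f y = j}"])
  ultimately show ?thesis by auto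
qed

text \<open>The overlap must be large relative to both cells: the label for \<open>g\<close>
  controls the cell of \<open>x\<close>, the label for \<open>inv g\<close> that of
  \<open>g \<otimes> x\<close>. Good points contribute at most \<open>2 * d\<close>; the others have
  measure at most \<open>2 * d\<close> and integrand at most 2, whence \<open>6 * d\<close>.\<close>

lemma almost_invariant_cell_vector:
  assumes f: "f \<in> measurable m (count_space UNIV)" and S: "S \<in> sets m" "measure m S = 1"
    and g: "g \<in> carrier G"
    and w: "w \<in> measurable m (count_space UNIV)" "w' \<in> measurable m (count_space UNIV)"
    and equiv: "\<And>x y. x \<in> S \<Longrightarrow> y \<in> S \<Longrightarrow> w x = w y \<Longrightarrow> f x = f y \<Longrightarrow> f (g \<otimes> x) = f (g \<otimes> y)"
      "\<And>x y. x \<in> S \<Longrightarrow> y \<in> S \<Longrightarrow> w' x = w' y \<Longrightarrow> f x = f y \<Longrightarrow> f (inv g \<otimes> x) = f (inv g \<otimes> y)"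
    and bad: "measure m (split_points f w d) \<le> d"
      "measure m (split_points f w' d) \<le> d"
    and d: "0 < d" "d < 1"
  shows "(\<integral>\<^sup>+x. \<integral>\<^sup>+t. ennreal ((cell_vector f (g \<otimes> x) t - cell_vector f x t)\<^sup>2) \<partial>m \<partial>m) \<le> ennreal (6 * d)"
proof -
  let ?A = "split_points f w d"
  let ?B = "split_points f w' d"
  have AB: "?A \<in> sets m" "?B \<in> sets m" using split_points_sets f w by auto
  have trB: "tr g ?B \<in> sets m" using AB g by auto
  have pos: "AE x in m. measure m (cell f x) > 0" by (rule AE_measure_cell_pos[OF f])
  have "AE x in m. x \<in> S" using prob_eq_1[OF S(1)] S(2) by simp
  note ae = this AE_translate[OF this g] pos AE_translate[OF pos g] AE_space
  have "(\<integral>\<^sup>+x. \<integral>\<^sup>+t. ennreal ((cell_vector f (g \<otimes> x) t - cell_vector f x t)\<^sup>2) \<partial>m \<partial>m)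
      \<le> (\<integral>\<^sup>+x. ennreal (2 * d) + ennreal 2 * indicator (?A \<union> tr g ?B) x \<partial>m)"
  proof (rule nn_integral_mono_AE)
    show "AE x in m. (\<integral>\<^sup>+t. ennreal ((cell_vector f (g \<otimes> x) t - cell_vector f x t)\<^sup>2) \<partial>m)
        \<le> ennreal (2 * d) + ennreal 2 * indicator (?A \<union> tr g ?B) x"
      using ae
    proof eventually_elim
      case (elim x)
      have xG: "x \<in> carrier G" "g \<otimes> x \<in> carrier G" using elim g by auto
      let ?c = "measure m (tr (g \<otimes> x) (cell f (g \<otimes> x)) \<inter> tr x (cell f x))"
      have eq: "(\<integral>\<^sup>+t. ennreal ((cell_vector f (g \<otimes> x) t - cell_vector f x t)\<^sup>2) \<partial>m)
          = ennreal (2 - 2 * ?c / sqrt (measure m (cell f (g \<otimes> x)) * measure m (cell f x)))"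
        using elim xG by (intro nn_integral_cell_vector_diff f) auto
      show ?case
      proof (cases "x \<in> ?A \<union> tr g ?B")
        case True
        have "ennreal (2 - 2 * ?c / sqrt (measure m (cell f (g \<otimes> x)) * measure m (cell f x))) \<le> ennreal 2"
          by (intro ennreal_leI) (simp add: divide_nonneg_nonneg)
        also have "\<dots> \<le> ennreal (2 * d) + ennreal 2" by simp
        also have "\<dots> = ennreal (2 * d) + ennreal 2 * indicator (?A \<union> tr g ?B) x"
          unfolding indicator_simps(1)[OF True] by simp
        finally show ?thesis unfolding eq .
      next
        case False
        have good: "measure m (cell f x - cell w x) \<le> d * measure m (cell f x)"
          "measure m (cell f (g \<otimes> x) - cell w' (g \<otimes> x)) \<le> d * measure m (cell f (g \<otimes> x))"
          using False xG by (auto simp: tr_def)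
        have c1: "?c \<ge> (1 - d) * measure m (cell f x)"
          unfolding Int_commute[of "tr (g \<otimes> x) (cell f (g \<otimes> x))"]
          by (rule overlap_translate[OF f S g w(1) equiv(1) elim(1) good(1)])
        have c2: "?c \<ge> (1 - d) * measure m (cell f (g \<otimes> x))"
        proof -
          have x: "inv g \<otimes> (g \<otimes> x) = x" using g xG by (simp add: m_assoc[symmetric])
          show ?thesis
            using overlap_translate[OF f S inv_closed[OF g] w(2) equiv(2) elim(2) good(2)]
            unfolding x .
        qed
        have "2 - 2 * ?c / sqrt (measure m (cell f (g \<otimes> x)) * measure m (cell f x)) \<le> 2 * d"
          by (rule overlap_ratio[OF elim(4,3) d(2) c2 c1])
        then have "ennreal (2 - 2 * ?c / sqrt (measure m (cell f (g \<otimes> x)) * measure m (cell f x))) \<le> ennreal (2 * d)"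
          by (rule ennreal_leI)
        also have "\<dots> = ennreal (2 * d) + ennreal 2 * indicator (?A \<union> tr g ?B) x"
          unfolding indicator_simps(2)[OF False] by simp
        finally show ?thesis unfolding eq .
      qed
    qed
  qed
  also have "\<dots> = ennreal (2 * d) + ennreal 2 * emeasure m (?A \<union> tr g ?B)"
  proof -
    have "emeasure m (carrier G) = 1" using emeasure_space_1 by simp
    then show ?thesis using AB trB by (subst nn_integral_add) (auto simp: nn_integral_cmult_indicator)
  qed
  also have "\<dots> = ennreal (2 * d + 2 * measure m (?A \<union> tr g ?B))"
    using d by (simp add: emeasure_eq_measure ennreal_mult ennreal_plus)
  also have "\<dots> \<le> ennreal (6 * d)"
  proof (rule ennreal_leI)
    have "measure m (?A \<union> tr g ?B) \<le> measure m ?A + measure m (tr g ?B)"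
      using AB trB by (intro measure_Un_le) auto
    moreover have "measure m (tr g ?B) = measure m ?B" using AB g by (simp add: measure_tr)
    ultimately show "2 * d + 2 * measure m (?A \<union> tr g ?B) \<le> 6 * d" using bad by linarith
  qed
  finally show ?thesis .
qed

section \<open>Open subgroups inside a given neighbourhood\<close>

lemma small_partition:
  assumes V: "openin T V" "\<one> \<in> V"
  obtains w :: "'a \<Rightarrow> nat" where "w \<in> measurable m (count_space UNIV)"
    "\<And>x y. x \<in> carrier G \<Longrightarrow> y \<in> carrier G \<Longrightarrow> w x = w y \<Longrightarrow> inv x \<otimes> y \<in> V"
proof -
  let ?W = "{z \<in> carrier G \<times> carrier G. inv (fst z) \<otimes> snd z \<in> V}"
  have "continuous_map (prod_topology T T) T (\<lambda>z. inv (fst z) \<otimes> snd z)"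
    by (intro continuous_map_mult continuous_map_inv continuous_map_fst continuous_map_snd)
  from openin_continuous_map_preimage[OF this V(1)] have "openin (prod_topology T T) ?W" by simp
  moreover have "(\<one>, \<one>) \<in> ?W" using V by simp
  ultimately obtain U1 U2 where U: "openin T U1" "openin T U2" "\<one> \<in> U1" "\<one> \<in> U2" "U1 \<times> U2 \<subseteq> ?W"
    unfolding openin_prod_topology_alt by meson
  define U where "U = U1 \<inter> U2"
  have opU: "openin T U" "\<one> \<in> U" using U by (auto simp: U_def)
  have UV: "inv a \<otimes> b \<in> V" if "a \<in> U" "b \<in> U" for a b
    using U(5) that by (auto simp: U_def)
  \<comment> \<open>This is the translate z U. For two of its points,
    \<open>inv x \<otimes> y\<close> has the form a^-1 b with \<open>a\<close> and \<open>b\<close>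
    in \<open>U\<close>, and so lies in \<open>V\<close>.\<close>
  define N where "N z = tr (inv z) U" for z
  have opN: "openin T (N z)" if "z \<in> carrier G" for z unfolding N_def using that opU by (intro openin_tr) auto
  have zN: "z \<in> N z" if "z \<in> carrier G" for z using that opU by (simp add: N_def tr_def)
  have comp: "compactin T (carrier G)" using compact by (simp add: compact_space_def)
  have cov: "carrier G \<subseteq> \<Union>(N ` carrier G)" using zN by auto
  obtain \<F> where \<F>: "finite \<F>" "\<F> \<subseteq> N ` carrier G" "carrier G \<subseteq> \<Union>\<F>"
    using compactinD[OF comp _ cov] opN by auto
  obtain Z where Z: "finite Z" "Z \<subseteq> carrier G" "\<F> = N ` Z" using finite_subset_image[OF \<F>(1,2)] by auto
  have ne: "Z \<noteq> {}" using \<F>(3) Z(3) one_closed by auto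
  define z where "z = from_nat_into Z"
  have z: "z i \<in> carrier G" for i using from_nat_into[OF ne, of i] Z(2) by (auto simp: z_def)
  have rz: "range z = Z" unfolding z_def using ne Z(1) by (intro range_from_nat_into countable_finite)
  define w where "w x = (LEAST i. x \<in> N (z i))" for x
  have wN: "x \<in> N (z (w x))" if x: "x \<in> carrier G" for x
  proof -
    obtain \<zeta> where "\<zeta> \<in> Z" "x \<in> N \<zeta>" using x \<F>(3) Z(3) by auto
    then have "\<exists>i. x \<in> N (z i)" using rz by (metis rangeE)
    then show ?thesis unfolding w_def by (rule LeastI_ex)
  qed
  have "w \<in> measurable m (count_space UNIV)"
    unfolding w_def
  proof (rule measurable_Least)
    fix i
    have "N (z i) \<in> sets m" using opN z by (simp add: openin_sets)
    then show "(\<lambda>x. x \<in> N (z i)) \<in> measurable m (count_space UNIV)" by simp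
  qed
  moreover have "inv x \<otimes> y \<in> V" if xy: "x \<in> carrier G" "y \<in> carrier G" "w x = w y" for x y
  proof -
    define \<zeta> where "\<zeta> = z (w x)"
    have \<zeta>: "\<zeta> \<in> carrier G" using z by (simp add: \<zeta>_def)
    have "inv \<zeta> \<otimes> x \<in> U" "inv \<zeta> \<otimes> y \<in> U"
      using wN[OF xy(1)] wN[OF xy(2)] xy(3) by (auto simp: N_def tr_def \<zeta>_def)
    then have "inv (inv \<zeta> \<otimes> x) \<otimes> (inv \<zeta> \<otimes> y) \<in> V" by (rule UV)
    moreover have "inv (inv \<zeta> \<otimes> x) \<otimes> (inv \<zeta> \<otimes> y) = inv x \<otimes> y"
    proof -
      have "\<zeta> \<otimes> (inv \<zeta> \<otimes> y) = y" using \<zeta> xy by (simp add: m_assoc[symmetric])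
      then show ?thesis using \<zeta> xy by (simp add: inv_mult_group m_assoc)
    qed
    ultimately show ?thesis by simp
  qed
  ultimately show ?thesis using that by simp
qed

text \<open>By Markov's inequality most vectors are close to \<open>h\<close>, so a typical cell A
  consists mostly of points with nearly equal vectors. For y = x b in A, the set y^-1 A is b^-1 B
  with B = x^-1 A, so near equality says that b^-1 B almost coincides with B. The label
  \<open>w\<close> keeps most of B inside \<open>V\<close>, and with it the subgroup inside
  \<open>U\<close>.\<close>

lemma open_subgroup_from_cells:
  assumes f: "f \<in> measurable m (count_space UNIV)"
    and w: "w \<in> measurable m (count_space UNIV)"
    and wV: "\<And>x y. x \<in> carrier G \<Longrightarrow> y \<in> carrier G \<Longrightarrow> w x = w y \<Longrightarrow> inv x \<otimes> y \<in> V"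
    and V: "openin T V" "\<And>a b. a \<in> V \<Longrightarrow> b \<in> V \<Longrightarrow> a \<otimes> inv b \<in> U"
    and bad: "measure m (split_points f w (1/32)) < 1/4"
    and h: "h \<in> borel_measurable m"
    and int: "(\<integral>\<^sup>+x. \<integral>\<^sup>+t. ennreal ((cell_vector f x t - h t)\<^sup>2) \<partial>m \<partial>m) \<le> ennreal (1/5000)"
  shows "\<exists>H. subgroup H G \<and> openin T H \<and> H \<subseteq> U"
proof -
  interpret P: pair_sigma_finite m m ..
  define \<phi> where "\<phi> x = (\<integral>\<^sup>+t. ennreal ((cell_vector f x t - h t)\<^sup>2) \<partial>m)" for x
  have \<phi>: "\<phi> \<in> borel_measurable m"
  proof -
    have h2: "(\<lambda>z. h (snd z)) \<in> borel_measurable (m \<Otimes>\<^sub>M m)"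
      using measurable_compose[OF measurable_snd h] .
    have "(\<lambda>z. ennreal ((cell_vector f (fst z) (snd z) - h (snd z))\<^sup>2)) \<in> borel_measurable (m \<Otimes>\<^sub>M m)"
      using h2 cell_vector_measurable[OF f] by measurable
    then show ?thesis
      unfolding \<phi>_def
      by (intro borel_measurable_nn_integral[where f="\<lambda>x t. ennreal ((cell_vector f x t - h t)\<^sup>2)"])
        (simp add: case_prod_beta)
  qed
  \<comment> \<open>The threshold 1/32 fits \<open>stable\<close>: two such errors combine to at
    most 1/8 in squared distance, which means an overlap of at least 15/16.\<close>
  define Q where "Q = {x \<in> space m. 1 \<le> ennreal 32 * \<phi> x}"
  have Q: "Q \<in> sets m" unfolding Q_def using \<phi> by measurable
  have "emeasure m Q \<le> ennreal 32 * (\<integral>\<^sup>+x. \<phi> x * indicator (space m) x \<partial>m)"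
  proof -
    have "Q = {x \<in> space m. 1 \<le> ennreal 32 * \<phi> x}" by (simp add: Q_def)
    then show ?thesis using nn_integral_Markov_inequality[of \<phi> "space m" m "ennreal 32"] \<phi> sets.top[of m] by simp
  qed
  also have "(\<integral>\<^sup>+x. \<phi> x * indicator (space m) x \<partial>m) = (\<integral>\<^sup>+x. \<phi> x \<partial>m)"
    by (rule nn_integral_cong) simp
  also have "ennreal 32 * (\<integral>\<^sup>+x. \<phi> x \<partial>m) \<le> ennreal 32 * ennreal (1/5000)"
    using int by (intro mult_left_mono) (auto simp: \<phi>_def)
  also have "\<dots> = ennreal (32/5000)" by (subst ennreal_mult[symmetric]) auto
  finally have mQ: "measure m Q \<le> 32/5000" by (simp add: emeasure_eq_measure)
  define E where "E = carrier G - Q"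
  have E: "E \<in> sets m" unfolding E_def using Q sets.compl_sets[of Q m] by simp
  define X1 where "X1 = {x \<in> E. measure m (cell f x - E) > 1/32 * measure m (cell f x)}"
  define X2 where "X2 = split_points f w (1/32)"
  have X1: "X1 \<in> sets m"
  proof -
    have "X1 = E \<inter> {x \<in> carrier G. measure m ({y \<in> carrier G. f y = f x} - E)
        > 1/32 * measure m {y \<in> carrier G. f y = f x}}"
      unfolding X1_def cell_def by (auto simp: E_def)
    moreover have "{x \<in> carrier G. measure m ({y \<in> carrier G. f y = f x} - E)
        > 1/32 * measure m {y \<in> carrier G. f y = f x}} \<in> sets m"
      by (rule nat_pred_sets[OF f])
    ultimately show ?thesis using E by simp
  qed
  have X2: "X2 \<in> sets m" unfolding X2_def by (rule split_points_sets[OF f w])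
  have m1: "measure m X1 \<le> 33 * (32/5000)"
  proof -
    \<comment> \<open>With \<open>J = UNIV\<close> the union of cells is the whole group, and the
      symmetric difference is the complement \<open>Q\<close> of \<open>E\<close>.\<close>
    have "measure m X1 \<le> (1/(1/32) + 1) * measure m (sym_diff E {x \<in> carrier G. f x \<in> UNIV})"
      unfolding X1_def by (rule measure_bad_cells[OF f E]) simp
    also have "sym_diff E {x \<in> carrier G. f x \<in> UNIV} = Q"
      using sets.sets_into_space[OF Q] by (auto simp: E_def)
    finally show ?thesis using mQ by simp
  qed
  \<comment> \<open>The total stays below 34 * 32/5000 + 1/4.\<close>
  have small: "measure m (Q \<union> X1 \<union> X2) < 1"
  proof -
    have "measure m (Q \<union> X1 \<union> X2) \<le> measure m (Q \<union> X1) + measure m X2"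
      using Q X1 X2 by (intro measure_Un_le) auto
    moreover have "measure m (Q \<union> X1) \<le> measure m Q + measure m X1"
      using Q X1 by (intro measure_Un_le) auto
    moreover have "measure m X2 < 1/4" using bad by (simp add: X2_def)
    ultimately show ?thesis using mQ m1 by linarith
  qed
  have "\<exists>x\<in>carrier G - (Q \<union> X1 \<union> X2). measure m (cell f x) > 0"
  proof (rule ex_point_AE[OF AE_measure_cell_pos[OF f]])
    show s: "carrier G - (Q \<union> X1 \<union> X2) \<in> sets m"
      using sets.compl_sets[of "Q \<union> X1 \<union> X2" m] Q X1 X2 by simp
    show "measure m (carrier G - (Q \<union> X1 \<union> X2)) > 0"
      using prob_compl[of "Q \<union> X1 \<union> X2"] Q X1 X2 small by simp
  qed
  then obtain x where x: "x \<in> carrier G" "x \<notin> Q" "x \<notin> X1" "x \<notin> X2" "measure m (cell f x) > 0"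
    by auto
  let ?a = "measure m (cell f x)"
  define B where "B = tr x (cell f x)"
  \<comment> \<open>Membership in \<open>E\<close> gives stability of \<open>b\<close>, and
    membership in the piece of \<open>x\<close> puts \<open>b\<close> into \<open>V\<close>. Each
    condition costs at most 1/32 of the cell.\<close>
  define D where "D = tr x (cell f x \<inter> E \<inter> cell w x)"
  have C: "cell f x \<in> sets m" "cell w x \<in> sets m" using f w by auto
  have B: "B \<in> sets m" "measure m B = ?a" unfolding B_def using x C by (auto simp: measure_tr)
  have Ds: "D \<in> sets m" unfolding D_def using x C E by auto
  have DB: "D \<subseteq> B" by (auto simp: D_def B_def tr_def)
  have small_BD: "measure m (B - D) \<le> measure m B / 8"
  proof -
    have "B - D = tr x (cell f x - (E \<inter> cell w x))" by (auto simp: B_def D_def tr_def)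
    then have "measure m (B - D) = measure m (cell f x - (E \<inter> cell w x))"
      using x C E by (simp add: measure_tr)
    also have "cell f x - (E \<inter> cell w x) = (cell f x - E) \<union> (cell f x - cell w x)" by auto
    also have "measure m \<dots> \<le> measure m (cell f x - E) + measure m (cell f x - cell w x)"
      using C E by (intro measure_Un_le) auto
    also have "\<dots> \<le> 1/32 * ?a + 1/32 * ?a"
      using x by (intro add_mono) (auto simp: X1_def X2_def E_def)
    finally show ?thesis using x(5) B by simp
  qed
  have stable: "measure m (tr b B \<inter> B) \<ge> 15/16 * measure m B" if b: "b \<in> D" for b
  proof -
    define y where "y = x \<otimes> b"
    have bG: "b \<in> carrier G" and y: "y \<in> carrier G" "y \<in> cell f x" "y \<notin> Q"
      using b x by (auto simp: D_def tr_def y_def E_def)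
    have cy: "cell f y = cell f x" using y by (auto simp: cell_def)
    have By: "tr y (cell f y) = tr b B" by (subst cy) (use x bG in \<open>simp add: B_def y_def tr_tr\<close>)
    have le: "\<phi> z \<le> ennreal (1/32)" if "z \<in> carrier G" "z \<notin> Q" for z
    proof -
      have "ennreal 32 * \<phi> z \<le> 1" using that by (auto simp: Q_def not_le intro: less_imp_le)
      then have "ennreal (1/32) * (ennreal 32 * \<phi> z) \<le> ennreal (1/32) * 1" by (rule mult_left_mono) simp
      moreover have "ennreal (1/32) * (ennreal 32 * \<phi> z) = \<phi> z"
      proof -
        have "ennreal (1/32) * ennreal 32 = ennreal (1/32 * 32)" by (rule ennreal_mult[symmetric]) auto
        then show ?thesis by (simp add: mult.assoc[symmetric])
      qed
      ultimately show ?thesis by simp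
    qed
    have meas: "(\<lambda>t. cell_vector f z t) \<in> borel_measurable m" if "z \<in> carrier G" for z
      using measurable_compose[OF measurable_Pair1'[of z m] cell_vector_measurable[OF f]] that by simp
    have "(\<integral>\<^sup>+t. ennreal ((cell_vector f y t - cell_vector f x t)\<^sup>2) \<partial>m)
        \<le> (\<integral>\<^sup>+t. ennreal 2 * ennreal ((cell_vector f y t - h t)\<^sup>2) + ennreal 2 * ennreal ((cell_vector f x t - h t)\<^sup>2) \<partial>m)"
    proof (rule nn_integral_mono)
      fix t
      have sq: "(a - b)\<^sup>2 \<le> 2 * (a - c)\<^sup>2 + 2 * (b - c)\<^sup>2" for a b c :: real
        using zero_le_power2[of "a + b - 2 * c"] by (simp add: power2_eq_square algebra_simps)
      have "ennreal ((cell_vector f y t - cell_vector f x t)\<^sup>2)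
          \<le> ennreal (2 * (cell_vector f y t - h t)\<^sup>2 + 2 * (cell_vector f x t - h t)\<^sup>2)"
        by (rule ennreal_leI[OF sq])
      then show "ennreal ((cell_vector f y t - cell_vector f x t)\<^sup>2)
          \<le> ennreal 2 * ennreal ((cell_vector f y t - h t)\<^sup>2) + ennreal 2 * ennreal ((cell_vector f x t - h t)\<^sup>2)"
        by (simp add: ennreal_plus ennreal_mult)
    qed
    also have "\<dots> = ennreal 2 * \<phi> y + ennreal 2 * \<phi> x"
      unfolding \<phi>_def using meas[OF y(1)] meas[OF x(1)] h
      by (subst nn_integral_add) (auto simp: nn_integral_cmult)
    also have "\<dots> \<le> ennreal 2 * ennreal (1/32) + ennreal 2 * ennreal (1/32)"
      using le x y by (intro add_mono mult_left_mono) auto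
    also have "\<dots> = ennreal (1/8)"
    proof -
      have "ennreal 2 * ennreal (1/32) = ennreal (2 * (1/32))" by (rule ennreal_mult[symmetric]) auto
      moreover have "ennreal (1/16) + ennreal (1/16) = ennreal (1/16 + 1/16)"
        by (rule ennreal_plus[symmetric]) auto
      ultimately show ?thesis by simp
    qed
    finally have "ennreal (2 - 2 * measure m (tr y (cell f y) \<inter> tr x (cell f x)) / sqrt (measure m (cell f y) * ?a)) \<le> ennreal (1/8)"
      using nn_integral_cell_vector_diff[OF f y(1) _ x(1,5)] cy x(5) by simp
    then have "2 - 2 * measure m (tr b B \<inter> B) / ?a \<le> 1/8"
      unfolding cy By[unfolded cy] B_def[symmetric] using x(5) by (simp add: ennreal_le_iff)
    then show ?thesis using x(5) B by (simp add: field_simps)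
  qed
  obtain H where H: "subgroup H G" "openin T H" "\<And>h. h \<in> H \<Longrightarrow> \<exists>b\<in>D. h \<otimes> b \<in> D"
    using openin_subgroup_of_almost_subgroup[OF B(1) _ Ds DB small_BD stable] x(5) B(2) by auto
  have DV: "D \<subseteq> V"
  proof
    fix b assume b: "b \<in> D"
    then have bG: "b \<in> carrier G" and "w x = w (x \<otimes> b)" using x by (auto simp: D_def tr_def cell_def)
    then have "inv x \<otimes> (x \<otimes> b) \<in> V" using x by (intro wV) auto
    then show "b \<in> V" using x bG by (simp add: m_assoc[symmetric])
  qed
  have "H \<subseteq> U"
  proof
    fix g assume g: "g \<in> H"
    then obtain b where b: "b \<in> D" "g \<otimes> b \<in> D" using H(3) by auto
    have G: "g \<in> carrier G" "b \<in> carrier G" using g b subgroup.mem_carrier[OF H(1)] by (auto simp: D_def tr_def)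
    have "(g \<otimes> b) \<otimes> inv b \<in> U" using b DV by (intro V(2)) auto
    then show "g \<in> U" using G by (simp add: m_assoc)
  qed
  then show ?thesis using H by auto
qed

text \<open>The label in \<open>equiv\<close> depends on \<open>g\<close> but not on
  \<open>n\<close>, so \<open>density\<close> eventually makes the cells fine compared with it. The
  Poincare inequality involves finitely many \<open>g\<close>, so one level serves them all.\<close>

lemma profinite_of_codes:
  fixes \<kappa> :: "nat \<Rightarrow> 'a \<Rightarrow> nat"
  assumes \<Gamma>: "subgroup \<Gamma> G" "countable \<Gamma>"
    and gap: "spectral_gap (G\<lparr>carrier := \<Gamma>\<rparr>) (left_translation G) m"
    and \<kappa>: "\<And>n. \<kappa> n \<in> measurable m (count_space UNIV)"
    and refine: "\<And>n x y. \<kappa> (Suc n) x = \<kappa> (Suc n) y \<Longrightarrow> \<kappa> n x = \<kappa> n y"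
    and S: "S \<in> sets m" "measure m S = 1"
    and sep: "\<And>x y. x \<in> S \<Longrightarrow> y \<in> S \<Longrightarrow> (\<And>n. \<kappa> n x = \<kappa> n y) \<Longrightarrow> x = y"
    and equiv: "\<And>g. g \<in> \<Gamma> \<Longrightarrow> \<exists>w. w \<in> measurable m (count_space UNIV) \<and>
      (\<forall>n. \<forall>x\<in>S. \<forall>y\<in>S. w x = (w y :: nat) \<longrightarrow> \<kappa> n x = \<kappa> n y \<longrightarrow> \<kappa> n (g \<otimes> x) = \<kappa> n (g \<otimes> y))"
  shows "profinite_group G T"
proof (rule profinite_groupI)
  fix U assume U: "openin T U" "\<one> \<in> U"
  obtain F C where F: "finite F" "F \<subseteq> \<Gamma>" and C: "C \<ge> 0"
    and poincare: "\<And>\<xi> :: 'a \<Rightarrow> real. \<xi> \<in> borel_measurable m \<Longrightarrow> integrable m (\<lambda>x. (\<xi> x)\<^sup>2) \<Longrightarrow>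
      (\<integral>x. (\<xi> x - (\<integral>y. \<xi> y \<partial>m))\<^sup>2 \<partial>m) \<le> C * (\<Sum>g\<in>F. \<integral>x. (\<xi> (g \<otimes> x) - \<xi> x)\<^sup>2 \<partial>m)"
    by (rule spectral_gap_poincare[OF \<Gamma> gap], rule that) assumption+
  have FG: "F \<subseteq> carrier G" using F(2) subgroup.subset[OF \<Gamma>(1)] by auto
  let ?W = "{z \<in> carrier G \<times> carrier G. fst z \<otimes> inv (snd z) \<in> U}"
  have "continuous_map (prod_topology T T) T (\<lambda>z. fst z \<otimes> inv (snd z))"
    by (intro continuous_map_mult continuous_map_inv continuous_map_fst continuous_map_snd)
  from openin_continuous_map_preimage[OF this U(1)] have W: "openin (prod_topology T T) ?W" by simp
  have "(\<one>, \<one>) \<in> ?W" using U by simp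
  from openin_prod_topology_alt[THEN iffD1, rule_format, OF W this] obtain V1 V2 where V12: "openin T V1" "openin T V2" "\<one> \<in> V1" "\<one> \<in> V2" "V1 \<times> V2 \<subseteq> ?W"
    by auto
  define V where "V = V1 \<inter> V2"
  have V: "openin T V" "\<one> \<in> V" using V12 by (auto simp: V_def)
  have VU: "a \<otimes> inv b \<in> U" if "a \<in> V" "b \<in> V" for a b
    using V12(5) that by (auto simp: V_def)
  obtain w0 :: "'a \<Rightarrow> nat" where w0: "w0 \<in> measurable m (count_space UNIV)"
    "\<And>x y. x \<in> carrier G \<Longrightarrow> y \<in> carrier G \<Longrightarrow> w0 x = w0 y \<Longrightarrow> inv x \<otimes> y \<in> V"
    by (rule small_partition[OF V], rule that) assumption+
  have "\<forall>g\<in>\<Gamma>. \<exists>w :: 'a \<Rightarrow> nat. w \<in> measurable m (count_space UNIV) \<and>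
      (\<forall>n. \<forall>x\<in>S. \<forall>y\<in>S. w x = w y \<longrightarrow> \<kappa> n x = \<kappa> n y \<longrightarrow> \<kappa> n (g \<otimes> x) = \<kappa> n (g \<otimes> y))"
    by (rule ballI) (rule equiv)
  from bchoice[OF this] obtain w :: "'a \<Rightarrow> 'a \<Rightarrow> nat" where
    W: "\<forall>g\<in>\<Gamma>. w g \<in> measurable m (count_space UNIV) \<and>
      (\<forall>n. \<forall>x\<in>S. \<forall>y\<in>S. w g x = w g y \<longrightarrow> \<kappa> n x = \<kappa> n y \<longrightarrow> \<kappa> n (g \<otimes> x) = \<kappa> n (g \<otimes> y))" ..
  have w: "w g \<in> measurable m (count_space UNIV)" if "g \<in> \<Gamma>" for g
    by (rule conjunct1[OF bspec[OF W that]])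
  have w_equiv: "\<kappa> n (g \<otimes> x) = \<kappa> n (g \<otimes> y)"
    if "g \<in> \<Gamma>" "x \<in> S" "y \<in> S" "w g x = w g y" "\<kappa> n x = \<kappa> n y" for g n x y
    by (rule conjunct2[OF bspec[OF W that(1)], rule_format, OF that(2-5)])
  \<comment> \<open>Chosen so that \<open>C\<close> times \<open>card F\<close> terms of size
    \<open>6 * d\<close> is at most 1/5000, as 30000 = 6 * 5000. The added ones keep
    \<open>M\<close> positive.\<close>
  define M where "M = (C + 1) * (real (card F) + 1)"
  have M: "M > 0" "C * real (card F) \<le> M"
    unfolding M_def using C by (auto intro!: mult_pos_pos mult_mono)
  define d where "d = 1 / (30000 * M + 1)"
  have d: "0 < d" "d < 1" using M by (auto simp: d_def)
  have Cd: "C * (real (card F) * (6 * d)) \<le> 1/5000"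
  proof -
    have "30000 * (C * real (card F)) * d \<le> (30000 * M + 1) * d"
      using d M by (intro mult_right_mono) auto
    also have "\<dots> = 1" using M by (simp add: d_def)
    finally show ?thesis by simp
  qed
  \<comment> \<open>Inverses are included because the label for \<open>inv g\<close> controls the
    cell of \<open>g \<otimes> x\<close>.\<close>
  define F' where "F' = F \<union> (\<lambda>g. inv g) ` F"
  have F': "finite F'" "F' \<subseteq> \<Gamma>" "F \<subseteq> F'" "\<And>g. g \<in> F \<Longrightarrow> inv g \<in> F'"
    using F subgroup.m_inv_closed[OF \<Gamma>(1)] by (auto simp: F'_def)
  let ?bad = "\<lambda>n w d. measure m (split_points (\<kappa> n) w d)"
  have ev: "\<forall>\<^sub>F n in sequentially. ?bad n w' d' < e"
    if "w' \<in> measurable m (count_space UNIV)" "d' > 0" "e > 0" for w' d' e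
    unfolding eventually_sequentially
    by (rule density[where \<kappa>=\<kappa> and S=S]) (fact \<kappa> refine S sep that)+
  have "\<forall>\<^sub>F n in sequentially. (\<forall>g\<in>F'. ?bad n (w g) d < d) \<and> ?bad n w0 (1/32) < 1/4"
  proof (rule eventually_conj)
    show "\<forall>\<^sub>F n in sequentially. \<forall>g\<in>F'. ?bad n (w g) d < d"
      by (rule eventually_ball_finite[OF F'(1)], rule ballI, rule ev) (use w F'(2) d in auto)
    show "\<forall>\<^sub>F n in sequentially. ?bad n w0 (1/32) < 1/4"
      by (rule ev) (use w0 in auto)
  qed
  then obtain n where n: "\<And>g. g \<in> F' \<Longrightarrow> ?bad n (w g) d < d" "?bad n w0 (1/32) < 1/4"
    by (auto simp: eventually_sequentially)
  let ?f = "\<kappa> n"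
  have almost: "(\<integral>\<^sup>+x. \<integral>\<^sup>+t. ennreal ((cell_vector ?f (g \<otimes> x) t - cell_vector ?f x t)\<^sup>2) \<partial>m \<partial>m) \<le> ennreal (6 * d)"
    if g: "g \<in> F" for g
  proof (rule almost_invariant_cell_vector[OF \<kappa> S, where w="w g" and w'="w (inv g)"])
    have g': "g \<in> F'" "inv g \<in> F'" "g \<in> \<Gamma>" "inv g \<in> \<Gamma>" using g F' by auto
    show "g \<in> carrier G" using g FG by auto
    show "w g \<in> measurable m (count_space UNIV)" "w (inv g) \<in> measurable m (count_space UNIV)"
      using g' w by auto
    show "?f (g \<otimes> x) = ?f (g \<otimes> y)" if "x \<in> S" "y \<in> S" "w g x = w g y" "?f x = ?f y" for x y
      by (rule w_equiv[OF g'(3) that])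
    show "?f (inv g \<otimes> x) = ?f (inv g \<otimes> y)" if "x \<in> S" "y \<in> S" "w (inv g) x = w (inv g) y" "?f x = ?f y" for x y
      by (rule w_equiv[OF g'(4) that])
    show "?bad n (w g) d \<le> d" "?bad n (w (inv g)) d \<le> d" using n(1) g' by (auto intro: less_imp_le)
  qed (rule d)+
  let ?h = "\<lambda>t. \<integral>y. cell_vector ?f y t \<partial>m"
  have fin: "(\<integral>\<^sup>+x. \<integral>\<^sup>+t. ennreal ((cell_vector ?f x t)\<^sup>2) \<partial>m \<partial>m) < \<infinity>"
  proof -
    have "(\<integral>\<^sup>+x. \<integral>\<^sup>+t. ennreal ((cell_vector ?f x t)\<^sup>2) \<partial>m \<partial>m) \<le> (\<integral>\<^sup>+x. 1 \<partial>m)"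
      by (rule nn_integral_mono) (simp add: nn_integral_cell_vector[OF \<kappa>])
    also have "\<dots> = 1" using emeasure_space_1 by simp
    finally show ?thesis using order_le_less_trans by fastforce
  qed
  have "(\<integral>\<^sup>+x. \<integral>\<^sup>+t. ennreal ((cell_vector ?f x t - ?h t)\<^sup>2) \<partial>m \<partial>m)
    \<le> ennreal C * (\<Sum>g\<in>F. \<integral>\<^sup>+x. \<integral>\<^sup>+t. ennreal ((cell_vector ?f (g \<otimes> x) t - cell_vector ?f x t)\<^sup>2) \<partial>m \<partial>m)"
    by (rule vector_poincare[OF F(1) FG C poincare cell_vector_measurable[OF \<kappa>] fin])
  also have "\<dots> \<le> ennreal C * (\<Sum>g\<in>F. ennreal (6 * d))"
    using almost by (intro mult_left_mono sum_mono) auto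
  also have "\<dots> = ennreal (C * (real (card F) * (6 * d)))"
    using C d by (simp add: ennreal_mult ennreal_of_nat_eq_real_of_nat)
  also have "\<dots> \<le> ennreal (1/5000)" using Cd by (rule ennreal_leI)
  finally have int: "(\<integral>\<^sup>+x. \<integral>\<^sup>+t. ennreal ((cell_vector ?f x t - ?h t)\<^sup>2) \<partial>m \<partial>m) \<le> ennreal (1/5000)" .
  have h: "?h \<in> borel_measurable m"
  proof (rule borel_measurable_lebesgue_integral[where f="\<lambda>t y. cell_vector ?f y t"])
    show "(\<lambda>(t, y). cell_vector ?f y t) \<in> borel_measurable (m \<Otimes>\<^sub>M m)"
      using measurable_compose[OF measurable_pair_swap' cell_vector_measurable[OF \<kappa>[of n]]]
      by (simp add: case_prod_beta)
  qed
  show "\<exists>H. subgroup H G \<and> openin T H \<and> H \<subseteq> U"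
    by (rule open_subgroup_from_cells[OF \<kappa> w0 V(1) VU n(2) h int])
qed

section \<open>Modular and profinite targets\<close>

text \<open>Ergodicity from the gap: for the indicator of an invariant set of measure p the right
  side of the Poincare inequality vanishes, while the left side is p (1 - p).\<close>

lemma measure_invariant_eq_1:
  assumes \<Gamma>: "subgroup \<Gamma> G" "countable \<Gamma>"
    and gap: "spectral_gap (G\<lparr>carrier := \<Gamma>\<rparr>) (left_translation G) m"
    and E: "E \<in> sets m" "measure m E > 0"
    and invariant: "\<And>g x. g \<in> \<Gamma> \<Longrightarrow> x \<in> carrier G \<Longrightarrow> g \<otimes> x \<in> E \<longleftrightarrow> x \<in> E"
  shows "measure m E = 1"
proof -
  obtain F C where F: "finite F" "F \<subseteq> \<Gamma>" and C: "C \<ge> 0"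
    and poincare: "\<And>\<xi> :: 'a \<Rightarrow> real. \<xi> \<in> borel_measurable m \<Longrightarrow> integrable m (\<lambda>x. (\<xi> x)\<^sup>2) \<Longrightarrow>
      (\<integral>x. (\<xi> x - (\<integral>y. \<xi> y \<partial>m))\<^sup>2 \<partial>m) \<le> C * (\<Sum>g\<in>F. \<integral>x. (\<xi> (g \<otimes> x) - \<xi> x)\<^sup>2 \<partial>m)"
    by (rule spectral_gap_poincare[OF \<Gamma> gap], rule that) assumption+
  let ?p = "measure m E"
  have int1: "integrable m (indicator E :: 'a \<Rightarrow> real)" using E by (simp add: integrable_real_indicator emeasure_eq_measure)
  have sq: "(indicator E x :: real)\<^sup>2 = indicator E x" for x by (simp add: indicator_def)
  have EG: "E \<inter> carrier G = E" using sets.sets_into_space[OF E(1)] by auto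
  then have mean: "(\<integral>y. indicator E y \<partial>m) = ?p" by simp
  have "(\<integral>x. (indicator E x - ?p)\<^sup>2 \<partial>m) \<le> C * (\<Sum>g\<in>F. \<integral>x. (indicator E (g \<otimes> x) - indicator E x)\<^sup>2 \<partial>m)"
    using poincare[of "indicator E"] E(1) int1 unfolding sq mean by simp
  also have "(\<Sum>g\<in>F. \<integral>x. (indicator E (g \<otimes> x) - indicator E x :: real)\<^sup>2 \<partial>m) = (\<Sum>g\<in>F. \<integral>x. 0 \<partial>m)"
    using F(2) invariant
    by (intro sum.cong refl Bochner_Integration.integral_cong) (auto simp: indicator_def)
  finally have "(\<integral>x. (indicator E x - ?p)\<^sup>2 \<partial>m) \<le> 0" by simp
  also have "(\<integral>x. (indicator E x - ?p)\<^sup>2 \<partial>m) = (\<integral>x. (1 - 2 * ?p) * indicator E x + ?p\<^sup>2 \<partial>m)"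
    by (rule Bochner_Integration.integral_cong) (auto simp: indicator_def power2_eq_square algebra_simps)
  also have "\<dots> = (1 - 2 * ?p) * ?p + ?p\<^sup>2" using int1 prob_space EG by simp
  also have "\<dots> = ?p * (1 - ?p)" by (simp add: power2_eq_square algebra_simps)
  finally have "?p * (1 - ?p) \<le> 0" .
  then have "1 - ?p \<le> 0" using E(2) by (simp add: mult_le_0_iff)
  then show ?thesis using prob_le_1[of E] by simp
qed

text \<open>\<open>\<sigma> k n\<close> is the effect of the \<open>k\<close>-th acting element on
  the labels of level \<open>n\<close>. The index \<open>k\<close> may vary with the point and need
  not be unique, but it is common to all \<open>n\<close>. Points are first moved into a set where
  the labels are injective; by ergodicity almost every point can be moved there.\<close>

lemma profinite_of_labels:
  fixes p :: "nat \<Rightarrow> 'a \<Rightarrow> nat" and \<sigma> :: "nat \<Rightarrow> nat \<Rightarrow> nat \<Rightarrow> nat"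
  assumes \<Gamma>: "subgroup \<Gamma> G" "countable \<Gamma>"
    and gap: "spectral_gap (G\<lparr>carrier := \<Gamma>\<rparr>) (left_translation G) m"
    and D: "D \<in> sets m" "measure m D > 0"
    and p: "\<And>n. p n \<in> measurable m (count_space UNIV)"
    and relabel: "\<And>g x. g \<in> \<Gamma> \<Longrightarrow> x \<in> D \<Longrightarrow> g \<otimes> x \<in> D \<Longrightarrow> \<exists>k. \<forall>n. p n (g \<otimes> x) = \<sigma> k n (p n x)"
    and countable_fibers: "\<And>x. x \<in> D \<Longrightarrow> countable {y \<in> D. \<forall>n. p n y = p n x}"
  shows "profinite_group G T"
proof -
  obtain B where B: "B \<in> sets m" "B \<subseteq> D" "measure m B > 0"
    and inj: "inj_on (\<lambda>x n. p n x) B"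
    by (rule injective_on_positive_part[OF D p countable_fibers]) (assumption, rule that)
  have ne: "\<Gamma> \<noteq> {}" using subgroup.one_closed[OF \<Gamma>(1)] by auto
  define \<gamma> where "\<gamma> = from_nat_into \<Gamma>"
  have \<gamma>: "\<gamma> i \<in> \<Gamma>" for i unfolding \<gamma>_def using ne by (rule from_nat_into)
  have \<Gamma>G: "g \<in> carrier G" if "g \<in> \<Gamma>" for g using that by (rule subgroup.mem_carrier[OF \<Gamma>(1)])
  have \<gamma>G: "\<gamma> i \<in> carrier G" for i using \<gamma> \<Gamma>G by simp
  have ex_\<gamma>: "\<exists>i. g = \<gamma> i" if "g \<in> \<Gamma>" for g
    using that range_from_nat_into[OF ne \<Gamma>(2)] unfolding \<gamma>_def by (metis imageE)
  define S where "S = (\<Union>i. tr (\<gamma> i) B)"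
  have S: "S \<in> sets m" unfolding S_def using B \<gamma>G by auto
  have SG: "x \<in> carrier G" if "x \<in> S" for x using that by (auto simp: S_def tr_def)
  have S_translate: "g \<otimes> x \<in> S" if g: "g \<in> \<Gamma>" and x: "x \<in> S" for g x
  proof -
    obtain i where i: "\<gamma> i \<otimes> x \<in> B" using x by (auto simp: S_def tr_def)
    have "\<gamma> i \<otimes> inv g \<in> \<Gamma>"
      using \<gamma> g subgroup.m_closed[OF \<Gamma>(1)] subgroup.m_inv_closed[OF \<Gamma>(1)] by simp
    then obtain j where j: "\<gamma> i \<otimes> inv g = \<gamma> j" using ex_\<gamma> by auto
    have "inv g \<otimes> (g \<otimes> x) = x" using \<Gamma>G[OF g] SG[OF x] by (simp add: m_assoc[symmetric])
    then have "\<gamma> j \<otimes> (g \<otimes> x) = \<gamma> i \<otimes> x"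
      unfolding j[symmetric] using \<Gamma>G[OF g] SG[OF x] \<gamma>G[of i] by (simp add: m_assoc)
    then have "g \<otimes> x \<in> tr (\<gamma> j) B" using i \<Gamma>G[OF g] SG[OF x] by (simp add: tr_def)
    then show ?thesis unfolding S_def by (rule UN_I[OF UNIV_I])
  qed
  have mS: "measure m S = 1"
  proof (rule measure_invariant_eq_1[OF \<Gamma> gap S])
    have "measure m (tr (\<gamma> 0) B) \<le> measure m S" using S by (intro finite_measure_mono) (auto simp: S_def)
    then show "measure m S > 0" using B \<gamma>G by (simp add: measure_tr)
    fix g x assume g: "g \<in> \<Gamma>" and x: "x \<in> carrier G"
    have "inv g \<otimes> (g \<otimes> x) = x" using \<Gamma>G[OF g] x by (simp add: m_assoc[symmetric])
    then show "g \<otimes> x \<in> S \<longleftrightarrow> x \<in> S"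
      using S_translate[OF g, of x] S_translate[OF subgroup.m_inv_closed[OF \<Gamma>(1) g], of "g \<otimes> x"] by auto
  qed
  define q where "q x = (LEAST i. \<gamma> i \<otimes> x \<in> B)" for x
  define u where "u x = \<gamma> (q x) \<otimes> x" for x
  have u: "u x \<in> B" if "x \<in> S" for x
  proof -
    have "\<exists>i. \<gamma> i \<otimes> x \<in> B" using that by (auto simp: S_def tr_def)
    then show ?thesis unfolding u_def q_def by (rule LeastI_ex)
  qed
  have q: "q \<in> measurable m (count_space UNIV)"
    unfolding q_def
  proof (rule measurable_Least)
    fix i
    have "tr (\<gamma> i) B \<in> sets m" using B \<gamma>G by simp
    moreover have "{x \<in> space m. \<gamma> i \<otimes> x \<in> B} = tr (\<gamma> i) B" by (auto simp: tr_def)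
    ultimately show "(\<lambda>x. \<gamma> i \<otimes> x \<in> B) \<in> measurable m (count_space UNIV)" by (simp add: pred_def)
  qed
  have pu: "(\<lambda>x. p n (u x)) \<in> measurable m (count_space UNIV)" for n
    unfolding u_def
    by (rule measurable_compose_countable[OF _ q]) (rule measurable_translate[OF p \<gamma>G])
  \<comment> \<open>Coordinate 0 records the element used to reach \<open>B\<close>, so that
    \<open>x\<close> can be recovered from \<open>u x\<close>.\<close>
  define a where "a x n = (case n of 0 \<Rightarrow> q x | Suc k \<Rightarrow> p k (u x))" for x n
  have a: "(\<lambda>x. a x n) \<in> measurable m (count_space UNIV)" for n
    using q pu by (cases n) (simp_all add: a_def)
  define \<kappa> where "\<kappa> n x = joint_code (a x) n" for n x
  have \<kappa>: "\<kappa> n \<in> measurable m (count_space UNIV)" for n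
  proof (induction n)
    case 0 then show ?case using a[of 0] by (simp add: \<kappa>_def)
  next
    case (Suc n)
    have "(\<lambda>x. prod_encode (\<kappa> n x, a x (Suc n))) \<in> measurable m (count_space UNIV)"
      by (rule measurable_nat_binary[OF Suc a])
    then show ?case by (simp add: \<kappa>_def)
  qed
  show ?thesis
  proof (rule profinite_of_codes[OF \<Gamma> gap \<kappa> _ S mS])
    show "\<kappa> n x = \<kappa> n y" if "\<kappa> (Suc n) x = \<kappa> (Suc n) y" for n x y
      using that by (simp add: \<kappa>_def prod_encode_eq)
    show "x = y" if xy: "x \<in> S" "y \<in> S" "\<And>n. \<kappa> n x = \<kappa> n y" for x y
    proof -
      have eq: "a x n = a y n" for n using xy(3)[of n] by (auto simp: \<kappa>_def joint_code_eq_iff)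
      have "q x = q y" using eq[of 0] by (simp add: a_def)
      moreover have "p n (u x) = p n (u y)" for n using eq[of "Suc n"] by (simp add: a_def)
      then have "u x = u y" using u xy by (intro inj_onD[OF inj]) auto
      ultimately show ?thesis
        using Units_l_cancel[of "\<gamma> (q y)" x y] \<gamma>G SG xy by (simp add: u_def)
    qed
    fix g assume g: "g \<in> \<Gamma>"
    \<comment> \<open>One index for all levels; taking the least one makes the choice
      measurable.\<close>
    define k where "k x = (LEAST k. \<forall>n. p n (u (g \<otimes> x)) = \<sigma> k n (p n (u x)))" for x
    have k: "p n (u (g \<otimes> x)) = \<sigma> (k x) n (p n (u x))" if x: "x \<in> S" for x n
    proof -
      have G: "g \<in> carrier G" "x \<in> carrier G" using g \<Gamma>G SG x by auto
      \<comment> \<open>Undo the move of \<open>x\<close>, apply \<open>g\<close>, then perform the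
        move of \<open>g \<otimes> x\<close>: this element of \<Gamma> carries \<open>u x\<close> to
        \<open>u (g \<otimes> x)\<close>. Both points lie in \<open>D\<close>, where
        \<open>relabel\<close> applies.\<close>
      define h where "h = \<gamma> (q (g \<otimes> x)) \<otimes> (g \<otimes> inv (\<gamma> (q x)))"
      have h: "h \<in> \<Gamma>" unfolding h_def
        using \<gamma> g subgroup.m_closed[OF \<Gamma>(1)] subgroup.m_inv_closed[OF \<Gamma>(1)] by simp
      have "inv (\<gamma> (q x)) \<otimes> (\<gamma> (q x) \<otimes> x) = x" using \<gamma>G G by (simp add: m_assoc[symmetric])
      then have hu: "h \<otimes> u x = u (g \<otimes> x)" unfolding h_def u_def using \<gamma>G G by (simp add: m_assoc)
      have "u x \<in> D" "u (g \<otimes> x) \<in> D" using u[OF x] u[OF S_translate[OF g x]] B(2) by auto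
      then have "\<exists>k. \<forall>n. p n (u (g \<otimes> x)) = \<sigma> k n (p n (u x))"
        using relabel[OF h, of "u x"] unfolding hu by simp
      then have "\<forall>n. p n (u (g \<otimes> x)) = \<sigma> (k x) n (p n (u x))" unfolding k_def by (rule LeastI_ex)
      then show ?thesis by simp
    qed
    have qg: "(\<lambda>x. q (g \<otimes> x)) \<in> measurable m (count_space UNIV)"
      by (rule measurable_translate[OF q \<Gamma>G[OF g]])
    have k_meas: "k \<in> measurable m (count_space UNIV)"
      unfolding k_def
    proof (rule measurable_Least, rule pred_intros_countable)
      fix k n
      show "Measurable.pred m (\<lambda>x. p n (u (g \<otimes> x)) = \<sigma> k n (p n (u x)))"
        by (rule measurable_nat_binary[OF measurable_translate[OF pu \<Gamma>G[OF g]] pu])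
    qed
    \<comment> \<open>\<open>q (g \<otimes> x)\<close> is the new coordinate 0, and
      \<open>k x\<close> computes every other new coordinate from the old one of the same
      level.\<close>
    define w where "w x = prod_encode (q (g \<otimes> x), k x)" for x
    have "w \<in> measurable m (count_space UNIV)"
      unfolding w_def by (rule measurable_nat_binary[OF qg k_meas])
    moreover have "\<kappa> n (g \<otimes> x) = \<kappa> n (g \<otimes> y)"
      if xy: "x \<in> S" "y \<in> S" "w x = w y" "\<kappa> n x = \<kappa> n y" for n x y
    proof -
      have w: "q (g \<otimes> x) = q (g \<otimes> y)" "k x = k y" using xy(3) by (auto simp: w_def prod_encode_eq)
      have "a (g \<otimes> x) j = a (g \<otimes> y) j" if j: "j \<le> n" for j
      proof (cases j)
        case 0 then show ?thesis using w by (simp add: a_def)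
      next
        case (Suc i)
        have "a x (Suc i) = a y (Suc i)" using xy(4) j Suc by (auto simp: \<kappa>_def joint_code_eq_iff)
        then have "p i (u x) = p i (u y)" by (simp add: a_def)
        then have "p i (u (g \<otimes> x)) = p i (u (g \<otimes> y))" using k[OF xy(1), of i] k[OF xy(2), of i] w(2) by simp
        then show ?thesis using Suc by (simp add: a_def)
      qed
      then show ?thesis by (simp add: \<kappa>_def joint_code_eq_iff)
    qed
    ultimately show "\<exists>w. w \<in> measurable m (count_space UNIV) \<and>
      (\<forall>n. \<forall>x\<in>S. \<forall>y\<in>S. w x = (w y :: nat) \<longrightarrow> \<kappa> n x = \<kappa> n y \<longrightarrow> \<kappa> n (g \<otimes> x) = \<kappa> n (g \<otimes> y))"
      by (intro exI[of _ w] conjI allI ballI impI)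
  qed
qed

text \<open>Numbering the pieces turns the action of \<Delta> on the partitions into relabelling
  maps. Separation of points places the fibres of the labels inside those of \<alpha>, which are
  countable.\<close>

lemma profinite_of_invariant_partitions:
  fixes \<alpha> :: "'a \<Rightarrow> 'y" and \<psi> :: "'d \<Rightarrow> 'y \<Rightarrow> 'y" and P :: "nat \<Rightarrow> 'y set set"
  assumes \<Gamma>: "subgroup \<Gamma> G" "countable \<Gamma>"
    and gap: "spectral_gap (G\<lparr>carrier := \<Gamma>\<rparr>) (left_translation G) m"
    and D: "D \<in> sets m" "measure m D > 0"
    and \<Delta>: "countable \<Delta>" "\<Delta> \<noteq> {}"
    and partition: "\<And>n. partition_on Y (P n)" and countable: "\<And>n. countable (P n)"
    and permute: "\<And>n \<delta> A. \<delta> \<in> \<Delta> \<Longrightarrow> A \<in> P n \<Longrightarrow> \<psi> \<delta> ` A \<in> P n"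
    and sep: "separates_points Y P"
    and \<alpha>: "\<And>x. x \<in> D \<Longrightarrow> \<alpha> x \<in> Y" "\<And>n A. A \<in> P n \<Longrightarrow> {x \<in> D. \<alpha> x \<in> A} \<in> sets m"
    and hom: "\<And>g x. g \<in> \<Gamma> \<Longrightarrow> x \<in> D \<Longrightarrow> g \<otimes> x \<in> D \<Longrightarrow> \<exists>\<delta>\<in>\<Delta>. \<alpha> (g \<otimes> x) = \<psi> \<delta> (\<alpha> x)"
    and countable_fibers: "\<And>x. x \<in> D \<Longrightarrow> countable {y \<in> D. \<alpha> y = \<alpha> x}"
  shows "profinite_group G T"
proof -
  define piece where "piece n y = (THE A. A \<in> P n \<and> y \<in> A)" for n y
  have piece_eq: "piece n y = A" if A: "A \<in> P n" "y \<in> A" for n y A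
    unfolding piece_def
  proof (rule the_equality)
    fix A' assume "A' \<in> P n \<and> y \<in> A'"
    then show "A' = A"
      using A disjointD[OF partition_onD2[OF partition], of A' n A] by auto
  qed (use A in auto)
  have piece: "piece n y \<in> P n" "y \<in> piece n y" if "y \<in> Y" for n y
  proof -
    obtain A where A: "A \<in> P n" "y \<in> A" using \<open>y \<in> Y\<close> partition_onD1[OF partition[of n]] by auto
    then show "piece n y \<in> P n" "y \<in> piece n y" using piece_eq[OF A] by auto
  qed
  define p where "p n x = (if x \<in> D then to_nat_on (P n) (piece n (\<alpha> x)) else 0)" for n x
  define \<sigma> where "\<sigma> k n i = to_nat_on (P n) (\<psi> (from_nat_into \<Delta> k) ` from_nat_into (P n) i)" for k n i
  have DG: "D \<subseteq> carrier G" using sets.sets_into_space[OF D(1)] by simp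
  show ?thesis
  proof (rule profinite_of_labels[OF \<Gamma> gap D, where p=p and \<sigma>=\<sigma>])
    fix n
    show "p n \<in> measurable m (count_space UNIV)"
      unfolding measurable_count_space_eq2_countable
    proof (intro conjI ballI)
      fix i :: nat
      \<comment> \<open>Label 0 is also the value of \<open>p n\<close> off \<open>D\<close>, so its
        preimage gains the complement of \<open>D\<close>.\<close>
      let ?J = "{A \<in> P n. to_nat_on (P n) A = i}"
      have "p n -` {i} \<inter> space m
        = (\<Union>A\<in>?J. {x \<in> D. \<alpha> x \<in> A}) \<union> (if i = 0 then space m - D else {})"
      proof (intro subset_antisym subsetI)
        fix x assume x: "x \<in> p n -` {i} \<inter> space m"
        show "x \<in> (\<Union>A\<in>?J. {x \<in> D. \<alpha> x \<in> A}) \<union> (if i = 0 then space m - D else {})"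
        proof (cases "x \<in> D")
          case True
          then have "piece n (\<alpha> x) \<in> ?J" "x \<in> {z \<in> D. \<alpha> z \<in> piece n (\<alpha> x)}"
            using x piece \<alpha>(1) by (auto simp: p_def)
          then have "x \<in> (\<Union>A\<in>?J. {x \<in> D. \<alpha> x \<in> A})" by (rule UN_I)
          then show ?thesis by simp
        qed (use x in \<open>auto simp: p_def\<close>)
      next
        fix x assume "x \<in> (\<Union>A\<in>?J. {x \<in> D. \<alpha> x \<in> A}) \<union> (if i = 0 then space m - D else {})"
        then show "x \<in> p n -` {i} \<inter> space m"
          using DG by (auto simp: p_def piece_eq split: if_splits)
      qed
      moreover have "(\<Union>A\<in>?J. {x \<in> D. \<alpha> x \<in> A}) \<in> sets m"
        using countable[of n] by (intro sets.countable_UN') (auto intro: \<alpha>(2) countable_subset)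
      moreover have "(if i = 0 then space m - D else {}) \<in> sets m" using sets.compl_sets[OF D(1)] by simp
      ultimately show "p n -` {i} \<inter> space m \<in> sets m" by simp
    qed simp
  next
    fix g x assume g: "g \<in> \<Gamma>" and x: "x \<in> D" "g \<otimes> x \<in> D"
    obtain \<delta> where \<delta>: "\<delta> \<in> \<Delta>" "\<alpha> (g \<otimes> x) = \<psi> \<delta> (\<alpha> x)" using hom[OF g x] by auto
    obtain k where k: "\<delta> = from_nat_into \<Delta> k"
      using \<delta>(1) range_from_nat_into[OF \<Delta>(2,1)] by (metis imageE)
    have "p n (g \<otimes> x) = \<sigma> k n (p n x)" for n
    proof -
      have pc: "piece n (\<alpha> x) \<in> P n" "\<alpha> x \<in> piece n (\<alpha> x)" using piece \<alpha>(1) x(1) by auto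
      have "piece n (\<alpha> (g \<otimes> x)) = \<psi> \<delta> ` piece n (\<alpha> x)"
        by (rule piece_eq[OF permute[OF \<delta>(1) pc(1)]]) (use \<delta> pc in auto)
      then show ?thesis using x pc(1) countable[of n] k by (simp add: p_def \<sigma>_def)
    qed
    then show "\<exists>k. \<forall>n. p n (g \<otimes> x) = \<sigma> k n (p n x)" by (intro exI[of _ k]) simp
  next
    fix x assume x: "x \<in> D"
    have "{y \<in> D. \<forall>n. p n y = p n x} \<subseteq> {y \<in> D. \<alpha> y = \<alpha> x}"
    proof
      fix y assume "y \<in> {y \<in> D. \<forall>n. p n y = p n x}"
      then have y: "y \<in> D" "\<And>n. p n y = p n x" by auto
      have Y: "\<alpha> x \<in> Y" "\<alpha> y \<in> Y" using \<alpha>(1) x y by auto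
      have same: "piece n (\<alpha> y) = piece n (\<alpha> x)" for n
        using y(2)[of n] x y(1) piece(1)[OF Y(1), of n] piece(1)[OF Y(2), of n] countable[of n]
        by (simp add: p_def)
      have "\<alpha> y = \<alpha> x"
      proof (rule ccontr)
        assume "\<alpha> y \<noteq> \<alpha> x"
        then obtain n A where A: "A \<in> P n" "\<alpha> y \<in> A" "\<alpha> x \<notin> A"
          using sep Y unfolding separates_points_def by metis
        then have "piece n (\<alpha> x) = A" using piece_eq[OF A(1,2)] same by simp
        then show False using A(3) piece(2)[OF Y(1), of n] by simp
      qed
      then show "y \<in> {y \<in> D. \<alpha> y = \<alpha> x}" using y by simp
    qed
    then show "countable {y \<in> D. \<forall>n. p n y = p n x}"
      using countable_fibers[OF x] by (rule countable_subset)
  qed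
qed

section \<open>Orbit relations and the two hypotheses\<close>

lemma orbit_rel_translation:
  assumes \<Gamma>: "subgroup \<Gamma> G" and g: "g \<in> \<Gamma>" and x: "x \<in> carrier G"
  shows "(x, g \<otimes> x) \<in> orbit_rel (G\<lparr>carrier := \<Gamma>\<rparr>) (left_translation G) (carrier G)"
proof -
  have gG: "g \<in> carrier G" by (rule subgroup.mem_carrier[OF \<Gamma> g])
  have orbit: "orbit (G\<lparr>carrier := \<Gamma>\<rparr>) (left_translation G) y = {h \<otimes> y |h. h \<in> \<Gamma>}"
    if "y \<in> carrier G" for y
    using that by (auto simp: orbit_def left_translation_def)
  have "{h \<otimes> x |h. h \<in> \<Gamma>} = {h \<otimes> (g \<otimes> x) |h. h \<in> \<Gamma>}"
  proof (intro subset_antisym subsetI)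
    fix y assume "y \<in> {h \<otimes> x |h. h \<in> \<Gamma>}"
    then obtain h where h: "h \<in> \<Gamma>" "y = h \<otimes> x" by auto
    have hG: "h \<in> carrier G" by (rule subgroup.mem_carrier[OF \<Gamma> h(1)])
    have "inv g \<otimes> (g \<otimes> x) = x" using gG x by (simp add: m_assoc[symmetric])
    then have "y = (h \<otimes> inv g) \<otimes> (g \<otimes> x)" using h hG gG x by (simp add: m_assoc)
    moreover have "h \<otimes> inv g \<in> \<Gamma>"
      using h g subgroup.m_closed[OF \<Gamma>] subgroup.m_inv_closed[OF \<Gamma>] by simp
    ultimately show "y \<in> {h \<otimes> (g \<otimes> x) |h. h \<in> \<Gamma>}" by auto
  next
    fix y assume "y \<in> {h \<otimes> (g \<otimes> x) |h. h \<in> \<Gamma>}"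
    then obtain h where h: "h \<in> \<Gamma>" "y = h \<otimes> (g \<otimes> x)" by auto
    have hG: "h \<in> carrier G" by (rule subgroup.mem_carrier[OF \<Gamma> h(1)])
    have "y = (h \<otimes> g) \<otimes> x" using h hG gG x by (simp add: m_assoc)
    moreover have "h \<otimes> g \<in> \<Gamma>" using h g subgroup.m_closed[OF \<Gamma>] by simp
    ultimately show "y \<in> {h \<otimes> x |h. h \<in> \<Gamma>}" by auto
  qed
  then show ?thesis using x gG by (simp add: orbit_rel_def orbit)
qed

end

lemma (in group_action) orbit_relD:
  assumes "(x, y) \<in> orbit_rel G \<phi> E"
  shows "\<exists>g\<in>carrier G. y = \<phi> g x"
proof -
  have "y \<in> orbit G \<phi> y" using assms orbit_refl by (simp add: orbit_rel_def)
  then have "y \<in> orbit G \<phi> x" using assms by (simp add: orbit_rel_def)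
  then show ?thesis by (auto simp: orbit_def)
qed

theorem corollary2:
  fixes G :: "('a, 'b) monoid_scheme" and T :: "'a topology" and m :: "'a measure"
    and \<Gamma> :: "'a set"
  assumes "topological_group G T" and "compact_space T" and "Hausdorff_space T"
    and "second_countable T"
    and "haar_prob G T m"
    and "subgroup \<Gamma> G" and "countable \<Gamma>" and "T closure_of \<Gamma> = carrier G"
    and "spectral_gap (G\<lparr>carrier := \<Gamma>\<rparr>) (left_translation G) m"
    and "(\<exists>(\<Delta> :: 'd monoid) \<psi> (\<nu> :: 'y measure).
            profinite_action \<Delta> \<psi> \<nu> \<and>
            orbit_equivalent (G\<lparr>carrier := \<Gamma>\<rparr>) (left_translation G) m \<Delta> \<psi> \<nu>) \<or>
         (\<exists>D (\<Delta> :: 'e monoid) \<psi> (Y :: 'z measure) \<alpha>.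
            D \<in> sets (completion m) \<and> emeasure (completion m) D = 1 \<and>
            modular_action \<Delta> \<psi> Y \<and>
            countable_to_one_borel_hom
              (restrict_space m D)
              (Restr (orbit_rel (G\<lparr>carrier := \<Gamma>\<rparr>) (left_translation G) (carrier G)) D)
              Y (orbit_rel \<Delta> \<psi> (space Y)) \<alpha>)"
  shows "profinite_group G T"
proof -
  interpret compact_haar G T m by (unfold_locales) (rule assms)+
  note \<Gamma> = assms(6,7)
  from assms(10) show ?thesis
  proof (elim disjE exE conjE)
    fix \<Delta> :: "'d monoid" and \<psi> and \<nu> :: "'y measure"
    assume prof: "profinite_action \<Delta> \<psi> \<nu>"
      and oe: "orbit_equivalent (G\<lparr>carrier := \<Gamma>\<rparr>) (left_translation G) m \<Delta> \<psi> \<nu>"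
    obtain Z P where Z: "Z \<in> sets \<nu>" and "emeasure \<nu> Z = 1 \<and> (\<forall>g\<in>carrier \<Delta>. \<psi> g ` Z = Z) \<and>
        (\<forall>n. partition_on Z (P n) \<and> finite (P n) \<and> P n \<subseteq> sets \<nu> \<and>
          (\<forall>g\<in>carrier \<Delta>. \<forall>A\<in>P n. \<psi> g ` A \<in> P n)) \<and> separates_points Z P"
      using prof unfolding profinite_action_def by (elim conjE bexE exE) (rule that; (intro conjI)?; assumption)
    then have Z1: "emeasure \<nu> Z = 1" and sep: "separates_points Z P"
      and P: "\<And>n. partition_on Z (P n)" "\<And>n. finite (P n)" "\<And>n. P n \<subseteq> sets \<nu>"
        "\<And>n g A. g \<in> carrier \<Delta> \<Longrightarrow> A \<in> P n \<Longrightarrow> \<psi> g ` A \<in> P n" by simp_all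
    have "borel_action \<Delta> \<psi> \<nu>" and prob: "prob_space \<nu>"
      using prof by (auto simp: profinite_action_def pmp_action_def)
    then have act: "group_action \<Delta> (space \<nu>) \<psi>" and cnt: "countable (carrier \<Delta>)"
      by (auto simp: borel_action_def)
    interpret \<nu>: prob_space \<nu> by (rule prob)
    interpret \<Delta>: group_action \<Delta> "space \<nu>" \<psi> by (rule act)
    have ne: "carrier \<Delta> \<noteq> {}" using group_hom.axioms(1)[OF \<Delta>.group_hom] group.is_monoid monoid.one_closed by blast
    from oe obtain X0 Y0 \<alpha> where X0: "X0 \<in> sets m" and Y0: "Y0 \<in> sets \<nu>" "emeasure \<nu> Y0 = 1"
      and bij: "bij_betw \<alpha> X0 Y0"
      and meas: "\<alpha> \<in> measurable (restrict_space m X0) (restrict_space \<nu> Y0)"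
      and distr: "distr (restrict_space m X0) (restrict_space \<nu> Y0) \<alpha> = restrict_space \<nu> Y0"
      and rel: "map_prod \<alpha> \<alpha> ` Restr (orbit_rel (G\<lparr>carrier := \<Gamma>\<rparr>) (left_translation G) (space m)) X0 =
          Restr (orbit_rel \<Delta> \<psi> (space \<nu>)) Y0"
      unfolding orbit_equivalent_def by (elim conjE bexE exE) (rule that; assumption)
    have X0G: "X0 \<subseteq> carrier G" using sets.sets_into_space[OF X0] by simp
    have pre: "{x \<in> X0. \<alpha> x \<in> A} \<in> sets m" if A: "A \<in> sets \<nu>" for A
    proof -
      have "A \<inter> Y0 \<in> sets (restrict_space \<nu> Y0)" using A by (auto simp: sets_restrict_space)
      from measurable_sets[OF meas this]
      have "\<alpha> -` (A \<inter> Y0) \<inter> space (restrict_space m X0) \<in> sets (restrict_space m X0)" .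
      moreover have "\<alpha> -` (A \<inter> Y0) \<inter> space (restrict_space m X0) = {x \<in> X0. \<alpha> x \<in> A}"
        using bij X0G by (auto simp: space_restrict_space bij_betw_def)
      ultimately show ?thesis using X0 by (auto simp: sets_restrict_space)
    qed
    \<comment> \<open>Here \<alpha> is injective and lands in the conull set \<open>Z\<close> on
      which the partitions are given.\<close>
    define D where "D = {x \<in> X0. \<alpha> x \<in> Z}"
    have D: "D \<in> sets m" unfolding D_def by (rule pre[OF Z])
    have "emeasure m D = 1"
    proof -
      have ZY: "Z \<inter> Y0 \<in> sets (restrict_space \<nu> Y0)" using Z by (auto simp: sets_restrict_space)
      have "AE y in \<nu>. y \<in> Z" "AE y in \<nu>. y \<in> Y0"
        using \<nu>.prob_eq_1[OF Z] \<nu>.prob_eq_1[OF Y0(1)] Z1 Y0 by (auto simp: \<nu>.emeasure_eq_measure)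
      then have "AE y in \<nu>. y \<in> Z \<inter> Y0" by eventually_elim simp
      then have "emeasure \<nu> (Z \<inter> Y0) = 1"
        using \<nu>.prob_eq_1[of "Z \<inter> Y0"] Z Y0 by (simp add: \<nu>.emeasure_eq_measure)
      then have "1 = emeasure (restrict_space \<nu> Y0) (Z \<inter> Y0)"
        using Y0 by (subst emeasure_restrict_space) auto
      also have "\<dots> = emeasure (restrict_space m X0) (\<alpha> -` (Z \<inter> Y0) \<inter> space (restrict_space m X0))"
        by (subst distr[symmetric], subst emeasure_distr[OF meas]) (use ZY in auto)
      also have "\<alpha> -` (Z \<inter> Y0) \<inter> space (restrict_space m X0) = D"
        using bij X0G by (auto simp: space_restrict_space bij_betw_def D_def)
      also have "emeasure (restrict_space m X0) D = emeasure m D"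
        using X0 X0G by (subst emeasure_restrict_space) (auto simp: D_def Int_absorb2)
      finally show ?thesis by simp
    qed
    then have mD: "measure m D > 0" by (simp add: measure_def)
    show "profinite_group G T"
    proof (rule profinite_of_invariant_partitions[OF \<Gamma> assms(9) D mD cnt ne, where Y=Z and P=P and \<alpha>=\<alpha> and \<psi>=\<psi>])
      show "partition_on Z (P n)" "countable (P n)" for n using P by (auto intro: countable_finite)
      show "\<psi> \<delta> ` A \<in> P n" if "\<delta> \<in> carrier \<Delta>" "A \<in> P n" for n \<delta> A using P(4)[OF that] .
      show "separates_points Z P" by (rule sep)
      show "\<alpha> x \<in> Z" if "x \<in> D" for x using that by (simp add: D_def)
      show "{x \<in> D. \<alpha> x \<in> A} \<in> sets m" if "A \<in> P n" for n A
      proof -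
        have "{x \<in> D. \<alpha> x \<in> A} = D \<inter> {x \<in> X0. \<alpha> x \<in> A}" by (auto simp: D_def)
        then show ?thesis using D pre[of A] P(3)[of n] that by auto
      qed
      show "countable {y \<in> D. \<alpha> y = \<alpha> x}" if "x \<in> D" for x
      proof -
        have "{y \<in> D. \<alpha> y = \<alpha> x} \<subseteq> {x}"
          using that bij_betw_imp_inj_on[OF bij] by (auto simp: D_def inj_on_def)
        then show ?thesis by (rule countable_subset) simp
      qed
      fix g x assume g: "g \<in> \<Gamma>" and x: "x \<in> D" "g \<otimes>\<^bsub>G\<^esub> x \<in> D"
      have "(x, g \<otimes>\<^bsub>G\<^esub> x) \<in> Restr (orbit_rel (G\<lparr>carrier := \<Gamma>\<rparr>) (left_translation G) (space m)) X0"
        using orbit_rel_translation[OF \<Gamma>(1) g, of x] x X0G by (auto simp: D_def)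
      then have "map_prod \<alpha> \<alpha> (x, g \<otimes>\<^bsub>G\<^esub> x) \<in> Restr (orbit_rel \<Delta> \<psi> (space \<nu>)) Y0"
        unfolding rel[symmetric] by (rule imageI)
      then show "\<exists>\<delta>\<in>carrier \<Delta>. \<alpha> (g \<otimes>\<^bsub>G\<^esub> x) = \<psi> \<delta> (\<alpha> x)"
        using \<Delta>.orbit_relD[of "\<alpha> x" "\<alpha> (g \<otimes>\<^bsub>G\<^esub> x)"] by simp
    qed
  next
    fix D and \<Delta> :: "'e monoid" and \<psi> and Y :: "'z measure" and \<alpha>
    assume D: "D \<in> sets (completion m)" "emeasure (completion m) D = 1"
      and modular: "modular_action \<Delta> \<psi> Y"
      and hom: "countable_to_one_borel_hom (restrict_space m D)
        (Restr (orbit_rel (G\<lparr>carrier := \<Gamma>\<rparr>) (left_translation G) (carrier G)) D)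
        Y (orbit_rel \<Delta> \<psi> (space Y)) \<alpha>"
    obtain P where "(\<forall>n. partition_on (space Y) (P n) \<and> countable (P n) \<and> P n \<subseteq> sets Y \<and>
          (\<forall>g\<in>carrier \<Delta>. \<forall>A\<in>P n. \<psi> g ` A \<in> P n)) \<and> separates_points (space Y) P"
      using modular unfolding modular_action_def by (elim conjE exE) (rule that; (intro conjI)?; assumption)
    then have sep: "separates_points (space Y) P"
      and P: "\<And>n. partition_on (space Y) (P n)" "\<And>n. countable (P n)" "\<And>n. P n \<subseteq> sets Y"
        "\<And>n g A. g \<in> carrier \<Delta> \<Longrightarrow> A \<in> P n \<Longrightarrow> \<psi> g ` A \<in> P n" by simp_all
    have act: "group_action \<Delta> (space Y) \<psi>" and cnt: "countable (carrier \<Delta>)"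
      using modular by (auto simp: modular_action_def borel_action_def)
    interpret \<Delta>: group_action \<Delta> "space Y" \<psi> by (rule act)
    have ne: "carrier \<Delta> \<noteq> {}" using group_hom.axioms(1)[OF \<Delta>.group_hom] group.is_monoid monoid.one_closed by blast
    have meas: "\<alpha> \<in> measurable (restrict_space m D) Y"
      and rel: "map_prod \<alpha> \<alpha> ` Restr (orbit_rel (G\<lparr>carrier := \<Gamma>\<rparr>) (left_translation G) (carrier G)) D
        \<subseteq> orbit_rel \<Delta> \<psi> (space Y)"
      and fibers: "\<And>y. y \<in> space Y \<Longrightarrow> countable {x \<in> space (restrict_space m D). \<alpha> x = y}"
      using hom by (auto simp: countable_to_one_borel_hom_def)
    \<comment> \<open>\<open>D\<close> is measurable only for the completion; its main part lies in
      \<open>sets m\<close> and has the same measure.\<close>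
    define D0 where "D0 = main_part m D"
    have D0: "D0 \<in> sets m" unfolding D0_def using D(1) by (rule main_part_sets)
    have sub: "D0 \<subseteq> D" unfolding D0_def using main_part_null_part_Un[OF D(1)] by auto
    have "emeasure m D0 = 1" using D by (simp add: D0_def emeasure_completion)
    then have mD: "measure m D0 > 0" by (simp add: measure_def)
    have D0G: "D0 \<subseteq> carrier G" using sets.sets_into_space[OF D0] by simp
    have space: "D0 \<subseteq> space (restrict_space m D)" using sub D0G by (auto simp: space_restrict_space)
    have \<alpha>Y: "\<alpha> x \<in> space Y" if "x \<in> D0" for x using measurable_space[OF meas] that space by auto
    show "profinite_group G T"
    proof (rule profinite_of_invariant_partitions[OF \<Gamma> assms(9) D0 mD cnt ne, where Y="space Y" and P=P and \<alpha>=\<alpha> and \<psi>=\<psi>])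
      show "partition_on (space Y) (P n)" "countable (P n)" for n using P by auto
      show "\<psi> \<delta> ` A \<in> P n" if "\<delta> \<in> carrier \<Delta>" "A \<in> P n" for n \<delta> A using P(4)[OF that] .
      show "separates_points (space Y) P" by (rule sep)
      show "\<alpha> x \<in> space Y" if "x \<in> D0" for x using that by (rule \<alpha>Y)
      show "{x \<in> D0. \<alpha> x \<in> A} \<in> sets m" if "A \<in> P n" for n A
      proof -
        have "A \<in> sets Y" using P(3) that by auto
        \<comment> \<open>The relative Borel structure of \<open>D\<close> yields only traces of
          Borel sets; intersecting with \<open>D0\<close> makes them Borel again.\<close>
        from measurable_sets[OF meas this] obtain C where C: "C \<in> sets m"
          "\<alpha> -` A \<inter> space (restrict_space m D) = D \<inter> C" by (auto simp: sets_restrict_space)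
        have "{x \<in> D0. \<alpha> x \<in> A} = D0 \<inter> (\<alpha> -` A \<inter> space (restrict_space m D))" using space by auto
        also have "\<dots> = D0 \<inter> C" unfolding C(2) using sub by auto
        finally show ?thesis using C(1) D0 by simp
      qed
      show "countable {y \<in> D0. \<alpha> y = \<alpha> x}" if "x \<in> D0" for x
      proof -
        have "{y \<in> D0. \<alpha> y = \<alpha> x} \<subseteq> {y \<in> space (restrict_space m D). \<alpha> y = \<alpha> x}" using space by auto
        then show ?thesis using fibers[OF \<alpha>Y[OF that]] by (rule countable_subset)
      qed
      fix g x assume g: "g \<in> \<Gamma>" and x: "x \<in> D0" "g \<otimes>\<^bsub>G\<^esub> x \<in> D0"
      have "(x, g \<otimes>\<^bsub>G\<^esub> x) \<in> Restr (orbit_rel (G\<lparr>carrier := \<Gamma>\<rparr>) (left_translation G) (carrier G)) D"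
        using orbit_rel_translation[OF \<Gamma>(1) g, of x] x D0G sub by auto
      then have "map_prod \<alpha> \<alpha> (x, g \<otimes>\<^bsub>G\<^esub> x) \<in> orbit_rel \<Delta> \<psi> (space Y)"
        using rel by (meson imageI subsetD)
      then show "\<exists>\<delta>\<in>carrier \<Delta>. \<alpha> (g \<otimes>\<^bsub>G\<^esub> x) = \<psi> \<delta> (\<alpha> x)"
        using \<Delta>.orbit_relD[of "\<alpha> x" "\<alpha> (g \<otimes>\<^bsub>G\<^esub> x)"] by simp
    qed
  qed
qed

end
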